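(* Let $X$ be a real Hilbert space and $A$ a nonnegative self-adjoint operator with dense domain in $X$. Consider $$\tfrac{d}{dt}q=p,\qquad \tfrac{d}{dt}p=-c_-(q)^2Aq,\qquad c_-(q)=\frac1{1-\langle q,Aq\rangle},\qquad \langle q,Aq\rangle<1,\tag{K$_-$}$$ and let $H_-(q,p)=\frac12\bigl[\langle p,p\rangle+\frac{\langle q,Aq\rangle}{1-\langle q,Aq\rangle}\bigr]$. Let $1\le s<2$. There is a constant $C_s$ such that every $\mathcal H^\infty$ solution $(q,p)$ to (K$_-$) on an open interval $I\ni0$ with $(q(0),p(0))=(q_0,p_0)$ satisfies $$\|(q(t),p(t))\|_{\mathcal H^s}\le C_s\bigl[1+2H_-(q_0,p_0)\bigr]\|(q_0,p_0)\|_{\mathcal H^s}\qquad\text{for all }t\in I.$$ Moreover, if $\Omega\subset\mathcal H^\infty$ (with $\langle q,Aq\rangle<1$ for all $(q,p)\in\Omega$) is bounded and equicontinuous in $\mathcal H^s$ and $\sup_{(q,p)\in\Omega}H_-(q,p)<\infty$, then the set of orbits $$\Omega^*=\bigl\{(q(t),p(t)) : (q,p)\text{ is an }\mathcal H^\infty\text{ solution to (K}_-)\text{ on an open interval }I\ni0\text{ with }(q(0),p(0))\in\Omega,\ t\in I\bigr\}$$ is also bounded and equicontinuous in $\mathcal H^s$.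
   Context: Functions of $A$ are defined by the spectral functional calculus. For $s\in\mathbb R$, $H^s$ is the completion of the domain of $(1+A)^{s/2}$ in the norm $\|\phi\|_{H^s}^2=\langle\phi,(1+A)^s\phi\rangle$. For $s\ge1$, $\mathcal H^s=\{(q,p)\in X\times X: A^{1/2}q\in H^{s-1},\ p\in H^{s-1}\}$ with $\|(q,p)\|_{\mathcal H^s}^2=\|A^{1/2}q\|_{H^{s-1}}^2+\|p\|_{H^{s-1}}^2$, and $\mathcal H^\infty=\bigcap_{s\ge1}\mathcal H^s$. The expression $\langle q,Aq\rangle$ means $\|A^{1/2}q\|^2$. For $s\ge1$ and an open interval $I$, an $\mathcal H^s$ solution to (K$_-$) on $I$ is a map $t\mapsto(q(t),p(t))\in\mathcal H^s$ such that $A^{1/2}q,p\in C(I;H^{s-1})$, $q\in C^1(I;X)$ with $\frac{d}{dt}q=p$, $p\in C^1(I;H^{s-2})$ with $\frac{d}{dt}p=-c_-(q)^2Aq$ in $H^{s-2}$, and $\langle q(t),Aq(t)\rangle<1$ for all $t\in I$. An $\mathcal H^\infty$ solution is a map that is an $\mathcal H^s$ solution for every $s\ge1$. For $\kappa>0$ let $P_{\ge\kappa}=\chi_{[\kappa^2,\infty)}(A)$. A set that is bounded in $\mathcal H^s$ is equicontinuous in $\mathcal H^s$ if for every $\varepsilon>0$ there is $\kappa>0$ such that $\|(P_{\ge\kappa}q,P_{\ge\kappa}p)\|_{\mathcal H^s}\le\varepsilon$ for all its elements $(q,p)$. *)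

theory Defs
  imports "HOL-Analysis.Analysis"
begin

text \<open>A possibly unbounded operator is a pair (domain, map); the values of the map outside
  the domain are irrelevant.\<close>

type_synonym 'a lin_op = "'a set \<times> ('a \<Rightarrow> 'a)"

definition linear_op :: "('a::real_inner) lin_op \<Rightarrow> bool" where
  "linear_op A \<longleftrightarrow> subspace (fst A) \<and>
     (\<forall>x\<in>fst A. \<forall>y\<in>fst A. snd A (x + y) = snd A x + snd A y) \<and>
     (\<forall>c. \<forall>x\<in>fst A. snd A (c *\<^sub>R x) = c *\<^sub>R snd A x)"

definition op_graph :: "('a::real_inner) lin_op \<Rightarrow> ('a \<times> 'a) set" where
  "op_graph A = {(x, snd A x) |x. x \<in> fst A}"

definition adjoint_graph :: "('a::real_inner) lin_op \<Rightarrow> ('a \<times> 'a) set" where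
  "adjoint_graph A = {(y, z). \<forall>x\<in>fst A. inner (snd A x) y = inner x z}"

definition selfadjoint :: "('a::real_inner) lin_op \<Rightarrow> bool" where
  "selfadjoint A \<longleftrightarrow>
     linear_op A \<and> closure (fst A) = UNIV \<and> adjoint_graph A = op_graph A"

definition nonneg_selfadjoint :: "('a::real_inner) lin_op \<Rightarrow> bool" where
  "nonneg_selfadjoint A \<longleftrightarrow> selfadjoint A \<and> (\<forall>x\<in>fst A. 0 \<le> inner x (snd A x))"

definition projection_valued_measure :: "(real set \<Rightarrow> 'a \<Rightarrow> 'a::real_inner) \<Rightarrow> bool" where
  "projection_valued_measure E \<longleftrightarrow>
     (\<forall>S\<in>sets borel. bounded_linear (E S) \<and> (\<forall>x y. inner (E S x) y = inner x (E S y))) \<and>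
     (\<forall>S\<in>sets borel. \<forall>T\<in>sets borel. \<forall>x. E (S \<inter> T) x = E S (E T x)) \<and>
     (\<forall>x. E UNIV x = x) \<and>
     (\<forall>F :: nat \<Rightarrow> real set. range F \<subseteq> sets borel \<and> disjoint_family F \<longrightarrow>
        (\<forall>x. (\<lambda>n. E (F n) x) sums E (\<Union>n. F n) x))"

definition scalar_measure :: "(real set \<Rightarrow> 'a \<Rightarrow> 'a::real_inner) \<Rightarrow> 'a \<Rightarrow> real measure" where
  "scalar_measure E x = measure_of UNIV (sets borel) (\<lambda>S. ennreal (inner x (E S x)))"

definition pvm_dom :: "(real set \<Rightarrow> 'a \<Rightarrow> 'a::real_inner) \<Rightarrow> (real \<Rightarrow> real) \<Rightarrow> 'a set" where
  "pvm_dom E f = {x. integrable (scalar_measure E x) (\<lambda>l. (f l)\<^sup>2)}"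

text \<open>The operator given by the integral of \<open>f\<close> against \<open>E\<close>, determined weakly by pairing with the
  (dense) domain.  The right-hand side is, by polarization, the integral of \<open>f\<close> against
  the signed measure \<open>S \<mapsto> inner x (E S y)\<close>.\<close>

definition pvm_integral ::
    "(real set \<Rightarrow> 'a \<Rightarrow> 'a::real_inner) \<Rightarrow> (real \<Rightarrow> real) \<Rightarrow> 'a \<Rightarrow> 'a" where
  "pvm_integral E f x = (THE z. \<forall>y\<in>pvm_dom E f. inner z y =
     ((\<integral>l. f l \<partial>scalar_measure E (x + y)) - (\<integral>l. f l \<partial>scalar_measure E (x - y))) / 4)"

definition is_spectral_measure ::
    "('a::real_inner) lin_op \<Rightarrow> (real set \<Rightarrow> 'a \<Rightarrow> 'a) \<Rightarrow> bool" where
  "is_spectral_measure A E \<longleftrightarrow> projection_valued_measure E \<and>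
     pvm_dom E (\<lambda>l. l) = fst A \<and> (\<forall>x\<in>fst A. pvm_integral E (\<lambda>l. l) x = snd A x)"

text \<open>By the spectral theorem a self-adjoint operator on a Hilbert space has a spectral measure,
  and it is unique on Borel sets, so the choice below is immaterial.\<close>

definition spectral_measure :: "('a::real_inner) lin_op \<Rightarrow> real set \<Rightarrow> 'a \<Rightarrow> 'a" where
  "spectral_measure A = (SOME E. is_spectral_measure A E)"

definition fun_dom :: "('a::real_inner) lin_op \<Rightarrow> (real \<Rightarrow> real) \<Rightarrow> 'a set" where
  "fun_dom A f = pvm_dom (spectral_measure A) f"

definition fun_op :: "('a::real_inner) lin_op \<Rightarrow> (real \<Rightarrow> real) \<Rightarrow> 'a \<Rightarrow> 'a" where
  "fun_op A f = pvm_integral (spectral_measure A) f"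

text \<open>For every real \<open>s\<close> the map \<open>\<phi> \<mapsto> (1 + A)\<^sup>s\<^sup>/\<^sup>2 \<phi>\<close> is an isometry of its domain with
  the $H^s$ norm onto a dense subspace of the Hilbert space \<open>X\<close> (onto \<open>X\<close> if \<open>s \<ge> 0\<close>).  Hence
  \<open>X\<close>, with this map as the embedding, is a completion of the domain in the $H^s$ norm: an element of
  the completion is given by its image in \<open>X\<close> under the extended isometry (its coordinate).
  For \<open>s \<ge> 0\<close> the domain is already complete and $H^s$ is the domain itself.\<close>

definition Hs_weight :: "real \<Rightarrow> real \<Rightarrow> real" where
  "Hs_weight s l = (1 + l) powr (s / 2)"

definition Hs :: "('a::real_inner) lin_op \<Rightarrow> real \<Rightarrow> 'a set" where
  "Hs A s = fun_dom A (Hs_weight s)"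

definition Hs_coord :: "('a::real_inner) lin_op \<Rightarrow> real \<Rightarrow> 'a \<Rightarrow> 'a" where
  "Hs_coord A s x = fun_op A (Hs_weight s) x"

definition Hs_norm :: "('a::real_inner) lin_op \<Rightarrow> real \<Rightarrow> 'a \<Rightarrow> real" where
  "Hs_norm A s x = norm (Hs_coord A s x)"

text \<open>Coordinate in $H^s$ of \<open>A x\<close>, that is \<open>(1 + A)\<^sup>s\<^sup>/\<^sup>2 A x\<close>.  For \<open>s < 0\<close> this makes sense
  for suitable \<open>x\<close> outside the domain of \<open>A\<close>; then \<open>A x\<close> is an element of the completion only.\<close>

definition Hs_coord_of_image :: "('a::real_inner) lin_op \<Rightarrow> real \<Rightarrow> 'a \<Rightarrow> 'a" where
  "Hs_coord_of_image A s x = fun_op A (\<lambda>l. Hs_weight s l * l) x"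

definition Hs_continuous_on ::
    "('a::real_inner) lin_op \<Rightarrow> real \<Rightarrow> real set \<Rightarrow> (real \<Rightarrow> 'a) \<Rightarrow> bool" where
  "Hs_continuous_on A s I f \<longleftrightarrow>
     (\<forall>t\<in>I. f t \<in> Hs A s) \<and> continuous_on I (\<lambda>t. Hs_coord A s (f t))"

text \<open>\<open>f\<close> is continuously differentiable into (the completion) $H^s$, and the coordinate of its
  derivative is \<open>g\<close>; \<open>I\<close> is meant to be open.\<close>

definition Hs_C1_on :: "('a::real_inner) lin_op \<Rightarrow> real \<Rightarrow> real set \<Rightarrow>
    (real \<Rightarrow> 'a) \<Rightarrow> (real \<Rightarrow> 'a) \<Rightarrow> bool" where
  "Hs_C1_on A s I f g \<longleftrightarrow> (\<forall>t\<in>I. f t \<in> Hs A s) \<and>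
     (\<forall>t\<in>I. ((\<lambda>\<tau>. Hs_coord A s (f \<tau>)) has_vector_derivative g t) (at t)) \<and>
     continuous_on I g"

definition sqrt_dom :: "('a::real_inner) lin_op \<Rightarrow> 'a set" where
  "sqrt_dom A = fun_dom A sqrt"

definition sqrt_op :: "('a::real_inner) lin_op \<Rightarrow> 'a \<Rightarrow> 'a" where
  "sqrt_op A = fun_op A sqrt"

definition phase_space :: "('a::real_inner) lin_op \<Rightarrow> real \<Rightarrow> ('a \<times> 'a) set" where
  "phase_space A s = {(q, p). q \<in> sqrt_dom A \<and> sqrt_op A q \<in> Hs A (s - 1) \<and> p \<in> Hs A (s - 1)}"

definition phase_norm :: "('a::real_inner) lin_op \<Rightarrow> real \<Rightarrow> 'a \<times> 'a \<Rightarrow> real" where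
  "phase_norm A s = (\<lambda>(q, p).
     sqrt ((Hs_norm A (s - 1) (sqrt_op A q))\<^sup>2 + (Hs_norm A (s - 1) p)\<^sup>2))"

definition phase_space_inf :: "('a::real_inner) lin_op \<Rightarrow> ('a \<times> 'a) set" where
  "phase_space_inf A = (\<Inter>s\<in>{1..}. phase_space A s)"

text \<open>\<open>\<langle>q, A q\<rangle>\<close>, read as the squared norm of \<open>A\<^sup>1\<^sup>/\<^sup>2 q\<close>.\<close>

definition op_form :: "('a::real_inner) lin_op \<Rightarrow> 'a \<Rightarrow> real" where
  "op_form A q = (norm (sqrt_op A q))\<^sup>2"

definition c_minus :: "('a::real_inner) lin_op \<Rightarrow> 'a \<Rightarrow> real" where
  "c_minus A q = 1 / (1 - op_form A q)"

definition H_minus :: "('a::real_inner) lin_op \<Rightarrow> 'a \<times> 'a \<Rightarrow> real" where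
  "H_minus A = (\<lambda>(q, p). (inner p p + op_form A q / (1 - op_form A q)) / 2)"

definition K_minus_solution :: "('a::real_inner) lin_op \<Rightarrow> real \<Rightarrow> real set \<Rightarrow>
    (real \<Rightarrow> 'a) \<Rightarrow> (real \<Rightarrow> 'a) \<Rightarrow> bool" where
  "K_minus_solution A s I q p \<longleftrightarrow>
     (\<forall>t\<in>I. (q t, p t) \<in> phase_space A s) \<and>
     Hs_continuous_on A (s - 1) I (\<lambda>t. sqrt_op A (q t)) \<and>
     Hs_continuous_on A (s - 1) I p \<and>
     (\<forall>t\<in>I. (q has_vector_derivative p t) (at t)) \<and> continuous_on I p \<and>
     Hs_C1_on A (s - 2) I p (\<lambda>t. - ((c_minus A (q t))\<^sup>2 *\<^sub>R Hs_coord_of_image A (s - 2) (q t))) \<and>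
     (\<forall>t\<in>I. op_form A (q t) < 1)"

definition K_minus_solution_inf :: "('a::real_inner) lin_op \<Rightarrow> real set \<Rightarrow>
    (real \<Rightarrow> 'a) \<Rightarrow> (real \<Rightarrow> 'a) \<Rightarrow> bool" where
  "K_minus_solution_inf A I q p \<longleftrightarrow> (\<forall>s\<ge>1. K_minus_solution A s I q p)"

definition open_interval :: "real set \<Rightarrow> bool" where
  "open_interval I \<longleftrightarrow> open I \<and> is_interval I"

definition high_proj :: "('a::real_inner) lin_op \<Rightarrow> real \<Rightarrow> 'a \<Rightarrow> 'a" where
  "high_proj A \<kappa> = fun_op A (indicator {\<kappa>\<^sup>2..})"

definition phase_bounded :: "('a::real_inner) lin_op \<Rightarrow> real \<Rightarrow> ('a \<times> 'a) set \<Rightarrow> bool" where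
  "phase_bounded A s \<Omega> \<longleftrightarrow>
     \<Omega> \<subseteq> phase_space A s \<and> (\<exists>M. \<forall>u\<in>\<Omega>. phase_norm A s u \<le> M)"

definition phase_equicontinuous ::
    "('a::real_inner) lin_op \<Rightarrow> real \<Rightarrow> ('a \<times> 'a) set \<Rightarrow> bool" where
  "phase_equicontinuous A s \<Omega> \<longleftrightarrow> (\<forall>\<epsilon>>0. \<exists>\<kappa>>0. \<forall>(q, p)\<in>\<Omega>.
     phase_norm A s (high_proj A \<kappa> q, high_proj A \<kappa> p) \<le> \<epsilon>)"

definition orbits :: "('a::real_inner) lin_op \<Rightarrow> ('a \<times> 'a) set \<Rightarrow> ('a \<times> 'a) set" where
  "orbits A \<Omega> = {(q t, p t) |q p t. \<exists>I. open_interval I \<and> 0 \<in> I \<and> t \<in> I \<and>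
     K_minus_solution_inf A I q p \<and> (q 0, p 0) \<in> \<Omega>}"

end

theory Submission
  imports Defs "HOL-Probability.Helly_Selection"
begin

text \<open>For \<open>m > 0\<close> put \<open>N = A (A + m)\<^sup>-\<^sup>1\<close> and \<open>c = c\<^sub>-(q)\<close>.  Along solutions
  \<open>G = (1 - m \<langle>q, N q\<rangle>) (c + \<langle>p, N p\<rangle>) + m \<langle>q, N p\<rangle>\<^sup>2\<close> is conserved.  With
  \<open>D = \<langle>A\<^sup>1\<^sup>/\<^sup>2 q, N A\<^sup>1\<^sup>/\<^sup>2 q\<rangle>\<close> and \<open>P = \<langle>p, N p\<rangle>\<close> one has
  \<open>1 - m \<langle>q, N q\<rangle> = 1 / c + D\<close>, whence \<open>c D + P / c \<le> G - 1 \<le> c D + P\<close> by Cauchy--Schwarz.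
  Since \<open>1 \<le> c \<le> 1 + 2 H\<^sub>-\<close>, the quantity \<open>D + P\<close> at time \<open>t\<close> is at most \<open>(1 + 2 H\<^sub>-)\<^sup>2\<close> times its
  initial value, for every \<open>m\<close>.  Superposing the weights \<open>l / (l + m)\<close> over dyadic \<open>m\<close> gives weights
  comparable to \<open>l\<^sup>s\<^sup>-\<^sup>1\<close> at high frequencies, which yields the norm bound and the tail bound.

  The domains and functions of \<open>A\<close> are accessible only through a spectral measure, so its existence
  has to be proved: the spectral measures of \<open>B = (1 + A)\<^sup>-\<^sup>1\<close> solve the Hausdorff moment
  problems \<open>\<integral> b\<^sup>k = \<langle>x, B\<^sup>k x\<rangle>\<close>, and the calculus of polynomials in \<open>B\<close> extends isometrically
  from \<open>L\<^sup>2\<close> of these measures.\<close>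

section \<open>The L2 seminorm of a measure\<close>

text \<open>The existence of a spectral measure and the calculus built on it rest on one and the
  same extension argument. It is carried out once, in \<open>op_algebra\<close> and
  \<open>op_calculus\<close>, and instantiated twice: with polynomials in B, where density comes
  from Weierstrass approximation, and with simple functions of a projection-valued measure, where
  indicators are present from the start. Keeping pairs of a function and an operator avoids a
  separate proof that the function determines the operator; the isometry yields this. The range s <
  2 comes from the weights. Below m they grow like l / m, and with sigma = s - 1 the dyadic sum then
  converges as a geometric series of ratio 2^(sigma - 1). The same linear growth makes tails small:
  for m = kappa^2 the initial frequencies below kappa'^2 contribute a multiple of kappa'^2 kappa^(2
  (s - 2)), which vanishes as kappa grows with kappa' fixed. All the weights vanish at l = 0, so the
  norm bound takes its low frequencies from the energy. Squared norms lose (1 + 2 H)^2, hence norms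
  lose the single factor 1 + 2 H of the claim.\<close>

definition sq_int :: "real measure \<Rightarrow> (real \<Rightarrow> real) \<Rightarrow> bool" where
  "sq_int M f \<longleftrightarrow> f \<in> borel_measurable M \<and> integrable M (\<lambda>l. (f l)\<^sup>2)"

text \<open>The integral of a non-integrable function is 0 by convention, so this is the L2 seminorm
  only under \<open>sq_int\<close>.\<close>

definition l2 :: "real measure \<Rightarrow> (real \<Rightarrow> real) \<Rightarrow> real" where
  "l2 M f = sqrt (\<integral>l. (f l)\<^sup>2 \<partial>M)"

lemma l2_nonneg [simp]: "0 \<le> l2 M f"
  by (simp add: l2_def)

lemma l2_power2: "(l2 M f)\<^sup>2 = (\<integral>l. (f l)\<^sup>2 \<partial>M)"
  by (simp add: l2_def)

lemma l2_zero [simp]: "l2 M (\<lambda>_. 0) = 0"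
  by (simp add: l2_def)

lemma sq_int_mult:
  assumes "sq_int M f" "sq_int M g"
  shows "integrable M (\<lambda>l. f l * g l)"
proof (rule Bochner_Integration.integrable_bound)
  show "integrable M (\<lambda>l. (f l)\<^sup>2 + (g l)\<^sup>2)"
    using assms by (auto simp: sq_int_def)
  show "(\<lambda>l. f l * g l) \<in> borel_measurable M"
    using assms by (auto simp: sq_int_def)
  have "\<bar>a * b\<bar> \<le> a\<^sup>2 + b\<^sup>2" for a b :: real
    using sum_squares_bound[of a b] sum_squares_bound[of a "-b"] by (auto simp: abs_if)
  then show "AE l in M. norm (f l * g l) \<le> norm ((f l)\<^sup>2 + (g l)\<^sup>2)"
    by simp
qed

lemma sq_int_add:
  assumes "sq_int M f" "sq_int M g"
  shows "sq_int M (\<lambda>l. f l + g l)"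
  using assms sq_int_mult[OF assms] unfolding sq_int_def by (auto simp: power2_sum mult.assoc)

lemma sq_int_scale: "sq_int M f \<Longrightarrow> sq_int M (\<lambda>l. c * f l)"
  unfolding sq_int_def by (auto simp: power_mult_distrib)

lemma sq_int_minus: "sq_int M f \<Longrightarrow> sq_int M (\<lambda>l. - f l)"
  using sq_int_scale[of M f "-1"] by simp

lemma sq_int_diff: "sq_int M f \<Longrightarrow> sq_int M g \<Longrightarrow> sq_int M (\<lambda>l. f l - g l)"
  using sq_int_add[of M f "\<lambda>l. - g l"] sq_int_minus by simp

lemma sq_int_bound:
  assumes "sq_int M f" "g \<in> borel_measurable M" "AE l in M. \<bar>g l\<bar> \<le> \<bar>f l\<bar>"
  shows "sq_int M g"
proof -
  have "AE l in M. norm ((g l)\<^sup>2) \<le> norm ((f l)\<^sup>2)"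
    using assms(3) by eventually_elim (simp add: abs_le_square_iff)
  then show ?thesis
    using assms unfolding sq_int_def by (auto intro: Bochner_Integration.integrable_bound)
qed

text \<open>A quadratic polynomial without negative values has nonpositive discriminant; the minimum
  is at t = H / G. It serves for Cauchy-Schwarz in L2, for the orthogonality of the nearest-point
  difference, and for Cauchy-Schwarz with the form of N.\<close>

lemma quadratic_form_discriminant:
  fixes F G H :: real
  assumes "\<And>t. 0 \<le> F - 2 * t * H + t\<^sup>2 * G" "0 \<le> G"
  shows "H\<^sup>2 \<le> F * G"
proof (cases "G = 0")
  case True
  have "H = 0"
  proof (rule ccontr)
    assume "H \<noteq> 0"
    \<comment> \<open>For G = 0 the polynomial is affine, and this choice of t gives it the value
      -1.\<close>
    then show False
      using assms(1)[of "(F + 1) / (2 * H)"] True by (simp add: field_simps)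
  qed
  then show ?thesis using True by simp
next
  case False
  then have "0 < G" using assms by simp
  then have "0 \<le> G * (F - 2 * (H / G) * H + (H / G)\<^sup>2 * G)"
    using assms(1)[of "H / G"] by simp
  also have "\<dots> = F * G - H\<^sup>2"
    using \<open>0 < G\<close> by (simp add: field_simps power2_eq_square)
  finally show ?thesis by simp
qed

lemma integral_prod_le_l2:
  assumes "sq_int M f" "sq_int M g"
  shows "\<bar>\<integral>l. f l * g l \<partial>M\<bar> \<le> l2 M f * l2 M g"
proof -
  have fg: "integrable M (\<lambda>l. f l * g l)" by (rule sq_int_mult[OF assms])
  have "(\<integral>l. f l * g l \<partial>M)\<^sup>2 \<le> (\<integral>l. (f l)\<^sup>2 \<partial>M) * (\<integral>l. (g l)\<^sup>2 \<partial>M)"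
  proof (rule quadratic_form_discriminant)
    fix t
    have "0 \<le> (\<integral>l. (f l - t * g l)\<^sup>2 \<partial>M)" by simp
    also have "\<dots> = (\<integral>l. (f l)\<^sup>2 - (2 * t) * (f l * g l) + t\<^sup>2 * (g l)\<^sup>2 \<partial>M)"
      by (intro Bochner_Integration.integral_cong) (auto simp: power2_eq_square algebra_simps)
    also have "\<dots> = (\<integral>l. (f l)\<^sup>2 \<partial>M) - 2 * t * (\<integral>l. f l * g l \<partial>M) + t\<^sup>2 * (\<integral>l. (g l)\<^sup>2 \<partial>M)"
      using assms fg unfolding sq_int_def by simp
    finally show "0 \<le> \<dots>" .
  qed simp
  then show ?thesis
    unfolding l2_def by (metis real_sqrt_abs real_sqrt_le_mono real_sqrt_mult)
qed

lemma l2_add: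
  assumes "sq_int M f" "sq_int M g"
  shows "l2 M (\<lambda>l. f l + g l) \<le> l2 M f + l2 M g"
proof -
  have fg: "integrable M (\<lambda>l. f l * g l)" by (rule sq_int_mult[OF assms])
  have "(l2 M (\<lambda>l. f l + g l))\<^sup>2 = (\<integral>l. (f l)\<^sup>2 + (g l)\<^sup>2 + 2 * (f l * g l) \<partial>M)"
    unfolding l2_power2 by (simp add: power2_sum mult.assoc)
  also have "\<dots> = (l2 M f)\<^sup>2 + (l2 M g)\<^sup>2 + 2 * (\<integral>l. f l * g l \<partial>M)"
    using assms fg unfolding sq_int_def l2_power2 by simp
  also have "\<dots> \<le> (l2 M f)\<^sup>2 + (l2 M g)\<^sup>2 + 2 * (l2 M f * l2 M g)"
    using integral_prod_le_l2[OF assms] by linarith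
  also have "\<dots> = (l2 M f + l2 M g)\<^sup>2" by (simp add: power2_sum)
  finally show ?thesis by (rule power2_le_imp_le) simp
qed

lemma l2_scale: "l2 M (\<lambda>l. c * f l) = \<bar>c\<bar> * l2 M f"
  by (simp add: l2_def power_mult_distrib real_sqrt_mult)

lemma l2_minus_commute: "l2 M (\<lambda>l. f l - g l) = l2 M (\<lambda>l. g l - f l)"
  by (simp add: l2_def power2_commute)

lemma l2_triangle:
  assumes "sq_int M f" "sq_int M g" "sq_int M h"
  shows "l2 M (\<lambda>l. f l - h l) \<le> l2 M (\<lambda>l. f l - g l) + l2 M (\<lambda>l. g l - h l)"
  using l2_add[of M "\<lambda>l. f l - g l" "\<lambda>l. g l - h l"] assms by (simp add: sq_int_diff)

lemma l2_mono:
  assumes "sq_int M f" "g \<in> borel_measurable M" "AE l in M. \<bar>g l\<bar> \<le> \<bar>f l\<bar>"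
  shows "l2 M g \<le> l2 M f"
proof -
  have "AE l in M. (g l)\<^sup>2 \<le> (f l)\<^sup>2"
    using assms(3) by eventually_elim (simp add: abs_le_square_iff)
  then show ?thesis
    using assms sq_int_bound[OF assms] unfolding l2_def sq_int_def
    by (auto intro: integral_mono_AE)
qed

lemma l2_dominated_convergence:
  assumes "sq_int M w" "\<And>n. u n \<in> borel_measurable M" "v \<in> borel_measurable M"
    and "AE l in M. (\<lambda>n. u n l) \<longlonglongrightarrow> v l" "\<And>n. AE l in M. \<bar>u n l - v l\<bar> \<le> \<bar>w l\<bar>"
  shows "(\<lambda>n. l2 M (\<lambda>l. u n l - v l)) \<longlonglongrightarrow> 0"
proof -
  have "(\<lambda>n. \<integral>l. (u n l - v l)\<^sup>2 \<partial>M) \<longlonglongrightarrow> (\<integral>l. 0 \<partial>M)"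
  proof (rule integral_dominated_convergence)
    show "integrable M (\<lambda>l. (w l)\<^sup>2)" using assms(1) by (simp add: sq_int_def)
    show "AE l in M. (\<lambda>n. (u n l - v l)\<^sup>2) \<longlonglongrightarrow> 0"
      using assms(4) by eventually_elim (auto intro!: tendsto_eq_intros)
    show "AE l in M. norm ((u n l - v l)\<^sup>2) \<le> (w l)\<^sup>2" for n
      using assms(5)[of n] by eventually_elim (simp add: abs_le_square_iff)
  qed (use assms in auto)
  from tendsto_real_sqrt[OF this] show ?thesis by (simp add: l2_def)
qed

text \<open>Large values are replaced by 0 and not by the bound: the truncation equals f or 0 at
  each point, so its error is dominated by f, also after multiplication by another function, and
  vanishes for large n.\<close>

definition cut_off :: "nat \<Rightarrow> (real \<Rightarrow> real) \<Rightarrow> real \<Rightarrow> real" where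
  "cut_off n f l = (if \<bar>f l\<bar> \<le> real n then f l else 0)"

lemma cut_off_abs_le: "\<bar>cut_off n f l\<bar> \<le> \<bar>f l\<bar>" "\<bar>cut_off n f l\<bar> \<le> real n"
  by (auto simp: cut_off_def)

lemma cut_off_measurable [measurable]:
  assumes [measurable]: "f \<in> borel_measurable M" shows "cut_off n f \<in> borel_measurable M"
proof -
  have "cut_off n f = (\<lambda>l. if \<bar>f l\<bar> \<le> real n then f l else 0)" by (auto simp: cut_off_def)
  then show ?thesis by simp
qed

lemma cut_off_eventually: "\<forall>\<^sub>F n in sequentially. cut_off n f l = f l"
proof -
  obtain N where "\<bar>f l\<bar> \<le> real N" using real_arch_simple by blast
  then have "cut_off n f l = f l" if "N \<le> n" for n using that by (auto simp: cut_off_def)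
  then show ?thesis by (auto simp: eventually_sequentially)
qed

lemma cut_off_tendsto: "(\<lambda>n. cut_off n f l) \<longlonglongrightarrow> f l"
  by (rule tendsto_eventually) (rule cut_off_eventually)

lemma l2_cut_off_mult:
  assumes "f \<in> borel_measurable M" "h \<in> borel_measurable M" "sq_int M (\<lambda>l. f l * h l)"
  shows "(\<lambda>n. l2 M (\<lambda>l. cut_off n f l * h l - f l * h l)) \<longlonglongrightarrow> 0"
proof (rule l2_dominated_convergence)
  show "sq_int M (\<lambda>l. f l * h l)" by fact
  show "AE l in M. (\<lambda>n. cut_off n f l * h l) \<longlonglongrightarrow> f l * h l"
    by (auto intro!: tendsto_intros cut_off_tendsto)
  show "AE l in M. \<bar>cut_off n f l * h l - f l * h l\<bar> \<le> \<bar>f l * h l\<bar>" for n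
    by (auto simp: cut_off_def)
qed (use assms in \<open>auto intro: cut_off_measurable\<close>)

lemma l2_cut_off:
  assumes "sq_int M f"
  shows "(\<lambda>n. l2 M (\<lambda>l. cut_off n f l - f l)) \<longlonglongrightarrow> 0"
  using l2_cut_off_mult[of f M "\<lambda>_. 1"] assms by (simp add: sq_int_def)


lemma indicator_UN_lessThan_Suc:
  assumes "disjoint_family F"
  shows "indicator (\<Union>i<Suc n. F i) = (\<lambda>l. indicator (\<Union>i<n. F i) l + indicator (F n) l :: real)"
proof -
  have "(\<Union>i<n. F i) \<inter> F n = {}"
    using assms by (auto simp: disjoint_family_on_def) (metis IntI emptyE less_irrefl)
  then show ?thesis by (auto simp: fun_eq_iff indicator_def less_Suc_eq)
qed

section \<open>Functional calculus by L2 approximation\<close>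

text \<open>\<open>\<T>\<close> is an algebra of pairs of a function and the corresponding operator, and \<open>M x\<close> is the
  spectral measure of the vector \<open>x\<close>.  For \<open>(f, R) \<in> \<T>\<close> the map \<open>f \<mapsto> R x\<close> is isometric on
  \<open>L\<^sup>2 (M x)\<close>, so that it extends to the closure.\<close>

locale op_algebra =
  fixes \<T> :: "((real \<Rightarrow> real) \<times> ('a::{real_inner,complete_space} \<Rightarrow> 'a)) set"
    and M :: "'a \<Rightarrow> real measure"
  assumes finite_M: "finite_measure (M x)"
    and sets_M [measurable_cong, simp]: "sets (M x) = sets borel"
    and \<T>_measurable: "(f, R) \<in> \<T> \<Longrightarrow> f \<in> borel_measurable borel"
    \<comment> \<open>An almost everywhere bound with K independent of x: polynomials are unbounded
      on the line, but the moment measures live on [0, 1].\<close>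
    and \<T>_bounded: "(f, R) \<in> \<T> \<Longrightarrow> \<exists>K. \<forall>x. AE l in M x. \<bar>f l\<bar> \<le> K"
    and \<T>_add: "(f, R) \<in> \<T> \<Longrightarrow> (g, S) \<in> \<T> \<Longrightarrow> (\<lambda>l. f l + g l, \<lambda>x. R x + S x) \<in> \<T>"
    and \<T>_scale: "(f, R) \<in> \<T> \<Longrightarrow> (\<lambda>l. c * f l, \<lambda>x. c *\<^sub>R R x) \<in> \<T>"
    and \<T>_mult: "(f, R) \<in> \<T> \<Longrightarrow> (g, S) \<in> \<T> \<Longrightarrow> (\<lambda>l. f l * g l, \<lambda>x. R (S x)) \<in> \<T>"
    and \<T>_one: "(\<lambda>_. 1, \<lambda>x. x) \<in> \<T>"
    and \<T>_linear: "(f, R) \<in> \<T> \<Longrightarrow> linear R"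
    and \<T>_sym: "(f, R) \<in> \<T> \<Longrightarrow> inner (R x) y = inner x (R y)"
    and \<T>_inner: "(f, R) \<in> \<T> \<Longrightarrow> inner x (R x) = (\<integral>l. f l \<partial>M x)"
begin

lemma space_M [simp]: "space (M x) = UNIV"
  using sets_eq_imp_space_eq[OF sets_M] by simp

lemma measurable_M [simp]: "f \<in> borel_measurable (M x) \<longleftrightarrow> f \<in> borel_measurable borel"
  by (metis measurable_cong_sets sets_M)

lemma sq_int_bounded:
  assumes "f \<in> borel_measurable borel" "AE l in M x. \<bar>f l\<bar> \<le> K"
  shows "sq_int (M x) f"
proof -
  interpret finite_measure "M x" by (rule finite_M)
  have "AE l in M x. norm ((f l)\<^sup>2) \<le> K\<^sup>2"
    using assms(2)
  proof eventually_elim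
    case (elim l)
    then show ?case using power_mono[of "\<bar>f l\<bar>" K 2] by simp
  qed
  then have "integrable (M x) (\<lambda>l. (f l)\<^sup>2)"
    using assms(1) by (intro integrable_const_bound[where B = "K\<^sup>2"]) auto
  then show ?thesis using assms(1) by (simp add: sq_int_def)
qed

lemma sq_int_bounded': "f \<in> borel_measurable borel \<Longrightarrow> (\<And>l. \<bar>f l\<bar> \<le> K) \<Longrightarrow> sq_int (M x) f"
  by (rule sq_int_bounded) auto

lemma \<T>_sq_int: "(f, R) \<in> \<T> \<Longrightarrow> sq_int (M x) f"
  using \<T>_measurable \<T>_bounded sq_int_bounded by metis

lemma \<T>_zero: "(\<lambda>_. 0, \<lambda>_. 0) \<in> \<T>"
  using \<T>_scale[OF \<T>_one, of 0] by simp

lemma \<T>_diff: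
  assumes "(f, R) \<in> \<T>" "(g, S) \<in> \<T>" shows "(\<lambda>l. f l - g l, \<lambda>x. R x - S x) \<in> \<T>"
  using \<T>_add[OF assms(1) \<T>_scale[OF assms(2), of "-1"]] by simp

text \<open>Symmetry moves one factor R across the inner product, and the pair of f^2 and R composed
  with R lies in \<open>\<T>\<close>. This is the isometry that carries the passage to the
  closure.\<close>

lemma \<T>_norm: assumes "(f, R) \<in> \<T>" shows "norm (R x) = l2 (M x) f"
proof -
  have "(norm (R x))\<^sup>2 = inner x (R (R x))"
    by (simp add: power2_norm_eq_inner \<T>_sym[OF assms])
  also have "\<dots> = (\<integral>l. (f l)\<^sup>2 \<partial>M x)"
    using \<T>_inner[OF \<T>_mult[OF assms assms]] by (simp add: power2_eq_square)
  finally show ?thesis by (simp add: l2_def real_sqrt_unique)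
qed

lemma \<T>_dist:
  assumes "(f, R) \<in> \<T>" "(g, S) \<in> \<T>" shows "norm (R x - S x) = l2 (M x) (\<lambda>l. f l - g l)"
  by (rule \<T>_norm[OF \<T>_diff[OF assms]])

lemma l2_indicator_UN:
  fixes F :: "nat \<Rightarrow> real set"
  assumes "\<And>i. F i \<in> sets borel"
  shows "(\<lambda>n. l2 (M x) (\<lambda>l. indicator (\<Union>i<n. F i) l - indicator (\<Union>i. F i) l)) \<longlonglongrightarrow> 0"
proof (rule l2_dominated_convergence[OF \<T>_sq_int[OF \<T>_one]])
  show "AE l in M x. (\<lambda>n. indicator (\<Union>i<n. F i) l) \<longlonglongrightarrow> (indicator (\<Union>n. F n) l :: real)"
    by (rule AE_I2, rule LIMSEQ_indicator_UN)
  have "(\<Union>i<n. F i) \<in> sets borel" "(\<Union>i. F i) \<in> sets borel" for n using assms by auto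
  then show "indicator (\<Union>i<n. F i) \<in> borel_measurable (M x)"
    "indicator (\<Union>i. F i) \<in> borel_measurable (M x)" for n by auto
qed (auto simp: indicator_def)

text \<open>One pair has to serve all vectors of F simultaneously. This is what later gives
  linearity and symmetry in the vector argument, where several vectors must be approached through
  the same operators.\<close>

definition approximable :: "'a set \<Rightarrow> (real \<Rightarrow> real) \<Rightarrow> bool" where
  "approximable F f \<longleftrightarrow> (\<forall>e>0. \<exists>(g, R)\<in>\<T>. \<forall>x\<in>F. l2 (M x) (\<lambda>l. g l - f l) < e)"

lemma approximable_add:
  assumes f: "approximable F f" "\<And>x. x \<in> F \<Longrightarrow> sq_int (M x) f"
    and g: "approximable F g" "\<And>x. x \<in> F \<Longrightarrow> sq_int (M x) g"
  shows "approximable F (\<lambda>l. f l + g l)"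
  unfolding approximable_def
proof (intro allI impI)
  fix e :: real assume "0 < e"
  then have e2: "0 < e / 2" by simp
  obtain f' R where f': "(f', R) \<in> \<T>" "\<And>x. x \<in> F \<Longrightarrow> l2 (M x) (\<lambda>l. f' l - f l) < e / 2"
    using f(1) e2 unfolding approximable_def by blast
  obtain g' S where g': "(g', S) \<in> \<T>" "\<And>x. x \<in> F \<Longrightarrow> l2 (M x) (\<lambda>l. g' l - g l) < e / 2"
    using g(1) e2 unfolding approximable_def by blast
  have "l2 (M x) (\<lambda>l. (f' l + g' l) - (f l + g l)) < e" if "x \<in> F" for x
  proof -
    have "l2 (M x) (\<lambda>l. (f' l + g' l) - (f l + g l)) = l2 (M x) (\<lambda>l. (f' l - f l) + (g' l - g l))"
      by (simp add: algebra_simps)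
    also have "\<dots> \<le> l2 (M x) (\<lambda>l. f' l - f l) + l2 (M x) (\<lambda>l. g' l - g l)"
      using that f g by (intro l2_add sq_int_diff \<T>_sq_int[OF f'(1)] \<T>_sq_int[OF g'(1)]) auto
    finally show ?thesis using f'(2)[OF that] g'(2)[OF that] by simp
  qed
  then show "\<exists>(h, R)\<in>\<T>. \<forall>x\<in>F. l2 (M x) (\<lambda>l. h l - (f l + g l)) < e"
    using \<T>_add[OF f'(1) g'(1)] by (intro bexI[of _ "(\<lambda>l. f' l + g' l, \<lambda>x. R x + S x)"]) auto
qed

lemma approximable_scale:
  assumes f: "approximable F f"
  shows "approximable F (\<lambda>l. c * f l)"
  unfolding approximable_def
proof (intro allI impI)
  fix e :: real assume "0 < e"
  then have e2: "0 < e / (\<bar>c\<bar> + 1)" by simp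
  obtain f' R where f': "(f', R) \<in> \<T>" "\<And>x. x \<in> F \<Longrightarrow> l2 (M x) (\<lambda>l. f' l - f l) < e / (\<bar>c\<bar> + 1)"
    using f(1) e2 unfolding approximable_def by blast
  have "l2 (M x) (\<lambda>l. c * f' l - c * f l) < e" if "x \<in> F" for x
  proof -
    have "l2 (M x) (\<lambda>l. c * f' l - c * f l) = \<bar>c\<bar> * l2 (M x) (\<lambda>l. f' l - f l)"
      using l2_scale[of "M x" c "\<lambda>l. f' l - f l"] by (simp add: algebra_simps)
    also have "\<dots> \<le> \<bar>c\<bar> * (e / (\<bar>c\<bar> + 1))"
      using f'(2)[OF that] by (intro mult_left_mono) auto
    also have "\<dots> < e" using \<open>0 < e\<close> by (simp add: field_simps)
    finally show ?thesis .
  qed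
  then show "\<exists>(h, R)\<in>\<T>. \<forall>x\<in>F. l2 (M x) (\<lambda>l. h l - c * f l) < e"
    using \<T>_scale[OF f'(1), of c] by (intro bexI[of _ "(\<lambda>l. c * f' l, \<lambda>x. c *\<^sub>R R x)"]) auto
qed

text \<open>Since F is finite, a single index i makes \<open>U i\<close> close to f for all its
  vectors; a pair approximating this \<open>U i\<close> then approximates f.\<close>

lemma approximable_limit:
  assumes F: "finite F" and U: "\<And>i. approximable F (U i)" "\<And>i x. x \<in> F \<Longrightarrow> sq_int (M x) (U i)"
    and f: "\<And>x. x \<in> F \<Longrightarrow> sq_int (M x) f"
    and lim: "\<And>x. x \<in> F \<Longrightarrow> (\<lambda>i. l2 (M x) (\<lambda>l. U i l - f l)) \<longlonglongrightarrow> 0"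
  shows "approximable F f"
  unfolding approximable_def
proof (intro allI impI)
  fix e :: real assume "0 < e"
  then have e2: "0 < e / 2" by simp
  have "\<forall>x\<in>F. \<forall>\<^sub>F i in sequentially. l2 (M x) (\<lambda>l. U i l - f l) < e / 2"
    using lim e2 by (intro ballI order_tendstoD(2)[OF lim e2])
  then have "\<forall>\<^sub>F i in sequentially. \<forall>x\<in>F. l2 (M x) (\<lambda>l. U i l - f l) < e / 2"
    by (rule eventually_ball_finite[OF F])
  then obtain i where i: "\<And>x. x \<in> F \<Longrightarrow> l2 (M x) (\<lambda>l. U i l - f l) < e / 2"
    by (auto simp: eventually_sequentially)
  obtain g R where g: "(g, R) \<in> \<T>" "\<And>x. x \<in> F \<Longrightarrow> l2 (M x) (\<lambda>l. g l - U i l) < e / 2"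
    using U(1)[of i] e2 unfolding approximable_def by blast
  have "l2 (M x) (\<lambda>l. g l - f l) < e" if "x \<in> F" for x
    using l2_triangle[OF \<T>_sq_int[OF g(1)] U(2)[OF that, of i] f[OF that]]
      i[OF that] g(2)[OF that] by linarith
  then show "\<exists>(g, R)\<in>\<T>. \<forall>x\<in>F. l2 (M x) (\<lambda>l. g l - f l) < e"
    using g(1) by blast
qed

end

text \<open>Density is demanded for indicators only; measurable induction extends it to all
  square-integrable functions.\<close>

locale op_calculus = op_algebra +
  assumes \<T>_dense: "finite F \<Longrightarrow> B \<in> sets borel \<Longrightarrow> approximable F (indicator B)"
begin

lemma approximable_nonneg:
  assumes "finite F" "f \<in> borel_measurable borel" "\<And>l. 0 \<le> f l"
  shows "(\<And>x. x \<in> F \<Longrightarrow> sq_int (M x) f) \<Longrightarrow> approximable F f"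
  using assms(2,3)
proof (induction f rule: borel_measurable_induct_real)
  case (set A)
  then show ?case using \<T>_dense[OF assms(1)] by simp
next
  case (mult u c)
  show ?case
  \<comment> \<open>For c = 0 the square integrability of c * u says nothing about u, so the
    induction hypothesis cannot be applied; the zero pair approximates the product exactly.\<close>
  proof (cases "c = 0")
    case True
    then show ?thesis using \<T>_zero by (force simp: approximable_def)
  next
    case False
    have "sq_int (M x) u" if "x \<in> F" for x
      using sq_int_scale[OF mult(5)[OF that], of "1 / c"] False by simp
    then show ?thesis using approximable_scale mult(4) by blast
  qed
next
  case (add u v)
  have m: "u \<in> borel_measurable borel" "v \<in> borel_measurable borel" using add by auto
  have "sq_int (M x) u" if "x \<in> F" for x
    by (rule sq_int_bound[OF add(8)[OF that]]) (use add m in auto)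
  moreover have "sq_int (M x) v" if "x \<in> F" for x
    by (rule sq_int_bound[OF add(8)[OF that]]) (use add m in auto)
  ultimately show ?case using approximable_add add by blast
next
  case (seq U)
  have m: "U i \<in> borel_measurable borel" for i using seq by auto
  have um: "f \<in> borel_measurable borel"
    by (rule borel_measurable_LIMSEQ_real[of borel U]) (use seq m in auto)
  have le: "U i l \<le> f l" for i l
    using seq by (intro incseq_le) (auto simp: incseq_def le_fun_def)
  have ab: "\<bar>U i l - f l\<bar> \<le> \<bar>f l\<bar>" for i l
    using seq(2)[of i l] le[of i l] by linarith
  have sqU: "sq_int (M x) (U i)" if "x \<in> F" for x i
    by (rule sq_int_bound[OF seq(6)[OF that]]) (use m seq(2) order_trans[OF le abs_ge_self] in auto)
  show ?case
  proof (rule approximable_limit[OF assms(1)])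
    show "approximable F (U i)" for i using seq.IH[of i] sqU by blast
    fix x assume x: "x \<in> F"
    show "sq_int (M x) f" "sq_int (M x) (U i)" for i using seq(6) sqU x by auto
    show "(\<lambda>i. l2 (M x) (\<lambda>l. U i l - f l)) \<longlonglongrightarrow> 0"
      by (rule l2_dominated_convergence[OF seq(6)[OF x]]) (use m um seq ab in auto)
  qed
qed

lemma approximable:
  assumes "finite F" "\<And>x. x \<in> F \<Longrightarrow> sq_int (M x) f" "f \<in> borel_measurable borel"
  shows "approximable F f"
proof -
  define p where "p l = max 0 (f l)" for l
  define n where "n l = max 0 (- f l)" for l
  have m: "p \<in> borel_measurable borel" "n \<in> borel_measurable borel"
    unfolding p_def[abs_def] n_def[abs_def] using assms(3) by auto
  have sp: "sq_int (M x) p" "sq_int (M x) n" if "x \<in> F" for x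
    using m by (auto intro!: sq_int_bound[OF assms(2)[OF that]] simp: p_def n_def)
  have "approximable F p" "approximable F n"
    using assms(1) m sp by (auto intro!: approximable_nonneg simp: p_def n_def)
  then have "approximable F (\<lambda>l. p l + (- 1) * n l)"
    using sp by (intro approximable_add approximable_scale sq_int_scale) auto
  moreover have "p l + (- 1) * n l = f l" for l by (auto simp: p_def n_def)
  ultimately show ?thesis by simp
qed

lemma approximating_sequence:
  assumes "finite F" "\<And>x. x \<in> F \<Longrightarrow> sq_int (M x) f" "f \<in> borel_measurable borel"
  obtains g R where "\<And>n. (g n, R n) \<in> \<T>"
    and "\<And>x. x \<in> F \<Longrightarrow> (\<lambda>n. l2 (M x) (\<lambda>l. g n l - f l)) \<longlonglongrightarrow> 0"
proof -
  have "\<exists>G. G \<in> \<T> \<and> (\<forall>x\<in>F. l2 (M x) (\<lambda>l. fst G l - f l) < 1 / real (Suc n))" for n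
  proof -
    have "0 < 1 / real (Suc n)" by simp
    then obtain g R where "(g, R) \<in> \<T>" "\<forall>x\<in>F. l2 (M x) (\<lambda>l. g l - f l) < 1 / real (Suc n)"
      using approximable[OF assms] unfolding approximable_def by blast
    then show ?thesis by (intro exI[of _ "(g, R)"]) simp
  qed
  then have "\<forall>n. \<exists>G. G \<in> \<T> \<and> (\<forall>x\<in>F. l2 (M x) (\<lambda>l. fst G l - f l) < 1 / real (Suc n))" ..
  from choice[OF this] obtain G where
    G: "\<And>n. G n \<in> \<T> \<and> (\<forall>x\<in>F. l2 (M x) (\<lambda>l. fst (G n) l - f l) < 1 / real (Suc n))" by blast
  define g where "g n = fst (G n)" for n
  define R where "R n = snd (G n)" for n
  have g: "(g n, R n) \<in> \<T>" for n using G[of n] by (simp add: g_def R_def)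
  have lt: "l2 (M x) (\<lambda>l. g n l - f l) < 1 / real (Suc n)" if "x \<in> F" for n x
    using G[of n] that by (simp add: g_def)
  have "(\<lambda>n. l2 (M x) (\<lambda>l. g n l - f l)) \<longlonglongrightarrow> 0" if "x \<in> F" for x
  proof (rule Lim_null_comparison)
    show "\<forall>\<^sub>F n in sequentially. norm (l2 (M x) (\<lambda>l. g n l - f l)) \<le> 1 / real (Suc n)"
      using lt[OF that] by (simp add: less_imp_le)
    show "(\<lambda>n. 1 / real (Suc n)) \<longlonglongrightarrow> 0"
      using LIMSEQ_inverse_real_of_nat by (simp add: inverse_eq_divide)
  qed
  with g show thesis by (rule that)
qed

text \<open>The vector z is described by its distances to all R x, so that no approximating sequence
  enters the definition of \<open>\<Phi>\<close>. Density makes such a z unique.\<close>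

definition represents :: "(real \<Rightarrow> real) \<Rightarrow> 'a \<Rightarrow> 'a \<Rightarrow> bool" where
  "represents f x z \<longleftrightarrow> (\<forall>(g, R)\<in>\<T>. norm (R x - z) = l2 (M x) (\<lambda>l. g l - f l))"

definition \<Phi> :: "(real \<Rightarrow> real) \<Rightarrow> 'a \<Rightarrow> 'a" where
  "\<Phi> f x = (THE z. represents f x z)"

lemma represents_tendsto:
  assumes "represents f x z" "\<And>n. (g n, R n) \<in> \<T>" "(\<lambda>n. l2 (M x) (\<lambda>l. g n l - f l)) \<longlonglongrightarrow> 0"
  shows "(\<lambda>n. R n x) \<longlonglongrightarrow> z"
proof -
  have "l2 (M x) (\<lambda>l. g n l - f l) = norm (R n x - z)" for n
    using assms(1) assms(2)[of n] unfolding represents_def by fastforce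
  then have "(\<lambda>n. norm (R n x - z)) \<longlonglongrightarrow> 0" using assms(3) by simp
  then show ?thesis by (simp only: tendsto_norm_zero_iff LIM_zero_iff)
qed

lemma approximating_sequence1:
  assumes f: "sq_int (M x) f"
  obtains g R where "\<And>n. (g n, R n) \<in> \<T>" and "(\<lambda>n. l2 (M x) (\<lambda>l. g n l - f l)) \<longlonglongrightarrow> 0"
proof (rule approximating_sequence[of "{x}" f])
  show "sq_int (M y) f" if "y \<in> {x}" for y using that f by simp
  show "f \<in> borel_measurable borel" using f by (simp add: sq_int_def)
qed (auto intro: that)

lemma represents_unique:
  assumes f: "sq_int (M x) f" and "represents f x z" "represents f x w"
  shows "z = w"
proof -
  obtain g R where "\<And>n. (g n, R n) \<in> \<T>" "(\<lambda>n. l2 (M x) (\<lambda>l. g n l - f l)) \<longlonglongrightarrow> 0"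
    using approximating_sequence1[OF f] by blast
  from represents_tendsto[OF assms(2) this] represents_tendsto[OF assms(3) this]
  show ?thesis by (rule LIMSEQ_unique)
qed

text \<open>By the isometry an L2-convergent sequence of functions gives a Cauchy sequence R n x,
  and completeness provides its limit. The prescribed distances are limits of the distances to R n
  x.\<close>

lemma represents_exists:
  assumes f: "sq_int (M x) f"
  shows "\<exists>z. represents f x z"
proof -
  obtain g R where g: "\<And>n. (g n, R n) \<in> \<T>" and lim: "(\<lambda>n. l2 (M x) (\<lambda>l. g n l - f l)) \<longlonglongrightarrow> 0"
    using approximating_sequence1[OF f] by blast
  have d: "norm (R m x - R n x) \<le> l2 (M x) (\<lambda>l. g m l - f l) + l2 (M x) (\<lambda>l. g n l - f l)" for m n
    using l2_triangle[OF \<T>_sq_int[OF g] f \<T>_sq_int[OF g], of m n]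
    unfolding \<T>_dist[OF g g] by (simp add: l2_minus_commute[of _ f])
  have "Cauchy (\<lambda>n. R n x)"
  proof (rule metric_CauchyI)
    fix e :: real assume "0 < e"
    from order_tendstoD(2)[OF lim half_gt_zero[OF this]]
    obtain N where N: "\<And>n. N \<le> n \<Longrightarrow> l2 (M x) (\<lambda>l. g n l - f l) < e / 2"
      unfolding eventually_sequentially by blast
    have "dist (R m x) (R n x) < e" if "N \<le> m" "N \<le> n" for m n
      unfolding dist_norm using d[of m n] N[OF that(1)] N[OF that(2)] by linarith
    then show "\<exists>N. \<forall>m\<ge>N. \<forall>n\<ge>N. dist (R m x) (R n x) < e" by blast
  qed
  then obtain w where w: "(\<lambda>n. R n x) \<longlonglongrightarrow> w"
    using Cauchy_convergent convergent_def by blast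
  have "norm (S x - w) = l2 (M x) (\<lambda>l. h l - f l)" if h: "(h, S) \<in> \<T>" for h S
  proof -
    have "(\<lambda>n. l2 (M x) (\<lambda>l. h l - g n l)) \<longlonglongrightarrow> l2 (M x) (\<lambda>l. h l - f l)"
    proof (rule LIM_zero_cancel, rule Lim_null_comparison[OF always_eventually lim], rule allI)
      fix n
      show "norm (l2 (M x) (\<lambda>l. h l - g n l) - l2 (M x) (\<lambda>l. h l - f l)) \<le> l2 (M x) (\<lambda>l. g n l - f l)"
        using l2_triangle[OF \<T>_sq_int[OF h] f \<T>_sq_int[OF g], of n]
          l2_triangle[OF \<T>_sq_int[OF h] \<T>_sq_int[OF g] f, of n]
        by (simp add: l2_minus_commute[of _ f] abs_le_iff)
    qed
    moreover have "(\<lambda>n. l2 (M x) (\<lambda>l. h l - g n l)) \<longlonglongrightarrow> norm (S x - w)"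
      unfolding \<T>_dist[OF h g, symmetric] by (intro tendsto_intros w)
    ultimately show ?thesis by (rule LIMSEQ_unique[symmetric])
  qed
  then show ?thesis unfolding represents_def by blast
qed

lemma represents_\<Phi>: assumes "sq_int (M x) f" shows "represents f x (\<Phi> f x)"
  unfolding \<Phi>_def using represents_exists[OF assms] represents_unique[OF assms]
  by (metis theI)

lemma dist_\<T>_\<Phi>:
  "(g, R) \<in> \<T> \<Longrightarrow> sq_int (M x) f \<Longrightarrow> norm (R x - \<Phi> f x) = l2 (M x) (\<lambda>l. g l - f l)"
  using represents_\<Phi> unfolding represents_def by fast

lemma \<Phi>_\<T>: assumes "(g, R) \<in> \<T>" shows "\<Phi> g x = R x"
  using dist_\<T>_\<Phi>[OF assms \<T>_sq_int[OF assms], of x] by simp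

lemma norm_\<Phi>: "sq_int (M x) f \<Longrightarrow> norm (\<Phi> f x) = l2 (M x) f"
  using dist_\<T>_\<Phi>[OF \<T>_zero, of x f] by (simp add: l2_def)

lemma \<T>_tendsto:
  assumes "\<And>n. (g n, R n) \<in> \<T>" "sq_int (M x) f" "(\<lambda>n. l2 (M x) (\<lambda>l. g n l - f l)) \<longlonglongrightarrow> 0"
  shows "(\<lambda>n. R n x) \<longlonglongrightarrow> \<Phi> f x"
  by (rule represents_tendsto[OF represents_\<Phi>[OF assms(2)] assms(1,3)])

lemma operator_sequence:
  assumes "finite F" "\<And>x. x \<in> F \<Longrightarrow> sq_int (M x) f" "f \<in> borel_measurable borel"
  obtains g R where "\<And>n. (g n, R n) \<in> \<T>"
    and "\<And>x. x \<in> F \<Longrightarrow> (\<lambda>n. l2 (M x) (\<lambda>l. g n l - f l)) \<longlonglongrightarrow> 0"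
    and "\<And>x. x \<in> F \<Longrightarrow> (\<lambda>n. R n x) \<longlonglongrightarrow> \<Phi> f x"
proof -
  obtain g R where g: "\<And>n. (g n, R n) \<in> \<T>"
    and l: "\<And>x. x \<in> F \<Longrightarrow> (\<lambda>n. l2 (M x) (\<lambda>l. g n l - f l)) \<longlonglongrightarrow> 0"
    using approximating_sequence[OF assms] by blast
  have "(\<lambda>n. R n x) \<longlonglongrightarrow> \<Phi> f x" if "x \<in> F" for x
    by (rule \<T>_tendsto[OF g assms(2)[OF that] l[OF that]])
  with g l show thesis by (rule that)
qed

lemma operator_sequence1:
  assumes f: "sq_int (M x) f"
  obtains g R where "\<And>n. (g n, R n) \<in> \<T>" and "(\<lambda>n. l2 (M x) (\<lambda>l. g n l - f l)) \<longlonglongrightarrow> 0"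
    and "(\<lambda>n. R n x) \<longlonglongrightarrow> \<Phi> f x"
proof -
  obtain g R where g: "\<And>n. (g n, R n) \<in> \<T>" and l: "(\<lambda>n. l2 (M x) (\<lambda>l. g n l - f l)) \<longlonglongrightarrow> 0"
    using approximating_sequence1[OF f] by blast
  show thesis by (rule that[OF g l \<T>_tendsto[OF g f l]])
qed

lemma \<Phi>_add:
  assumes f: "sq_int (M x) f" and g: "sq_int (M x) g"
  shows "\<Phi> (\<lambda>l. f l + g l) x = \<Phi> f x + \<Phi> g x"
proof -
  obtain u R where u: "\<And>n. (u n, R n) \<in> \<T>" "(\<lambda>n. l2 (M x) (\<lambda>l. u n l - f l)) \<longlonglongrightarrow> 0"
    "(\<lambda>n. R n x) \<longlonglongrightarrow> \<Phi> f x"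
    using operator_sequence1[OF f] by blast
  obtain v S where v: "\<And>n. (v n, S n) \<in> \<T>" "(\<lambda>n. l2 (M x) (\<lambda>l. v n l - g l)) \<longlonglongrightarrow> 0"
    "(\<lambda>n. S n x) \<longlonglongrightarrow> \<Phi> g x"
    using operator_sequence1[OF g] by blast
  have "(\<lambda>n. l2 (M x) (\<lambda>l. (u n l + v n l) - (f l + g l))) \<longlonglongrightarrow> 0"
  proof (rule Lim_null_comparison)
    have "l2 (M x) (\<lambda>l. (u n l + v n l) - (f l + g l))
        \<le> l2 (M x) (\<lambda>l. u n l - f l) + l2 (M x) (\<lambda>l. v n l - g l)" for n
      using l2_add[OF sq_int_diff[OF \<T>_sq_int[OF u(1)] f] sq_int_diff[OF \<T>_sq_int[OF v(1)] g], of n n]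
      by (simp add: add_diff_add)
    then show "\<forall>\<^sub>F n in sequentially. norm (l2 (M x) (\<lambda>l. (u n l + v n l) - (f l + g l)))
        \<le> l2 (M x) (\<lambda>l. u n l - f l) + l2 (M x) (\<lambda>l. v n l - g l)" by simp
    show "(\<lambda>n. l2 (M x) (\<lambda>l. u n l - f l) + l2 (M x) (\<lambda>l. v n l - g l)) \<longlonglongrightarrow> 0"
      using tendsto_add[OF u(2) v(2)] by simp
  qed
  from \<T>_tendsto[OF \<T>_add[OF u(1) v(1)] sq_int_add[OF f g] this]
  show ?thesis by (rule LIMSEQ_unique) (rule tendsto_add[OF u(3) v(3)])
qed

lemma \<Phi>_scale:
  assumes f: "sq_int (M x) f"
  shows "\<Phi> (\<lambda>l. c * f l) x = c *\<^sub>R \<Phi> f x"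
proof -
  obtain u R where u: "\<And>n. (u n, R n) \<in> \<T>" "(\<lambda>n. l2 (M x) (\<lambda>l. u n l - f l)) \<longlonglongrightarrow> 0"
    "(\<lambda>n. R n x) \<longlonglongrightarrow> \<Phi> f x"
    using operator_sequence1[OF f] by blast
  have "(\<lambda>n. l2 (M x) (\<lambda>l. c * u n l - c * f l)) \<longlonglongrightarrow> 0"
    unfolding right_diff_distrib[symmetric] l2_scale by (rule tendsto_mult_right_zero[OF u(2)])
  from \<T>_tendsto[OF \<T>_scale[OF u(1)] sq_int_scale[OF f] this]
  show ?thesis by (rule LIMSEQ_unique) (intro tendsto_intros u(3))
qed

lemma \<Phi>_diff:
  assumes f: "sq_int (M x) f" and g: "sq_int (M x) g"
  shows "\<Phi> (\<lambda>l. f l - g l) x = \<Phi> f x - \<Phi> g x"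
  using \<Phi>_add[OF f sq_int_scale[OF g, of "-1"]] \<Phi>_scale[OF g, of "-1"] by simp

lemma dist_\<Phi>:
  assumes f: "sq_int (M x) f" and g: "sq_int (M x) g"
  shows "norm (\<Phi> f x - \<Phi> g x) = l2 (M x) (\<lambda>l. f l - g l)"
  using \<Phi>_diff[OF assms] norm_\<Phi>[OF sq_int_diff[OF assms]] by simp

text \<open>Polarization of the isometry \<open>norm_\<Phi>\<close>.\<close>

lemma inner_\<Phi>:
  assumes f: "sq_int (M x) f" and g: "sq_int (M x) g"
  shows "inner (\<Phi> f x) (\<Phi> g x) = (\<integral>l. f l * g l \<partial>M x)"
proof -
  have i: "integrable (M x) (\<lambda>l. (f l)\<^sup>2)" "integrable (M x) (\<lambda>l. (g l)\<^sup>2)"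
    "integrable (M x) (\<lambda>l. f l * g l)"
    using f g sq_int_mult[OF f g] by (auto simp: sq_int_def)
  have n: "(norm (\<Phi> h x))\<^sup>2 = (\<integral>l. (h l)\<^sup>2 \<partial>M x)" if "sq_int (M x) h" for h
    using norm_\<Phi>[OF that] by (simp add: l2_power2)
  have "(norm (\<Phi> f x + \<Phi> g x))\<^sup>2 = (\<integral>l. (f l + g l)\<^sup>2 \<partial>M x)"
    using n[OF sq_int_add[OF f g]] \<Phi>_add[OF f g] by simp
  also have "\<dots> = (\<integral>l. (f l)\<^sup>2 + (g l)\<^sup>2 + 2 * (f l * g l) \<partial>M x)"
    by (simp add: power2_sum mult.assoc)
  also have "\<dots> = (norm (\<Phi> f x))\<^sup>2 + (norm (\<Phi> g x))\<^sup>2 + 2 * (\<integral>l. f l * g l \<partial>M x)"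
    using i n[OF f] n[OF g] by simp
  finally show ?thesis
    by (simp add: power2_norm_eq_inner inner_add inner_commute)
qed

lemma \<Phi>_cong_AE:
  assumes "sq_int (M x) f" "g \<in> borel_measurable borel" "AE l in M x. f l = g l"
  shows "\<Phi> g x = \<Phi> f x"
proof -
  have g: "sq_int (M x) g" using assms by (intro sq_int_bound[OF assms(1)]) auto
  have "l2 (M x) (\<lambda>l. g l - f l) \<le> l2 (M x) (\<lambda>_. 0)"
    using assms by (intro l2_mono) (auto simp: sq_int_def)
  then have "norm (\<Phi> g x - \<Phi> f x) \<le> 0" unfolding dist_\<Phi>[OF g assms(1)] by simp
  then show ?thesis by simp
qed

lemma \<Phi>_one: "\<Phi> (\<lambda>_. 1) x = x"
  by (rule \<Phi>_\<T>[OF \<T>_one])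

lemma sq_int_const: "sq_int (M x) (\<lambda>_. c)"
  by (rule sq_int_bounded') auto

lemma \<Phi>_const: "\<Phi> (\<lambda>_. c) x = c *\<^sub>R x"
  using \<Phi>_scale[where f = "\<lambda>_. 1" and c = c, OF sq_int_const] \<Phi>_one by simp

lemma inner_\<Phi>_self: "sq_int (M x) f \<Longrightarrow> inner x (\<Phi> f x) = (\<integral>l. f l \<partial>M x)"
  using inner_\<Phi>[where f = "\<lambda>_. 1" and g = f, OF sq_int_const] \<Phi>_one by simp

lemma norm_eq_l2_one: "norm x = l2 (M x) (\<lambda>_. 1)"
  using norm_\<Phi>[where f = "\<lambda>_. 1", OF sq_int_const] \<Phi>_one by simp

text \<open>One sequence of operators converges at x, y and x + y at once, and each of these
  operators is linear.\<close>

lemma \<Phi>_add_arg: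
  assumes x: "sq_int (M x) f" and y: "sq_int (M y) f" and xy: "sq_int (M (x + y)) f"
  shows "\<Phi> f (x + y) = \<Phi> f x + \<Phi> f y"
proof -
  have s: "sq_int (M v) f" if "v \<in> {x, y, x + y}" for v using that assms by auto
  have fin: "finite {x, y, x + y}" and fm: "f \<in> borel_measurable borel" using x by (auto simp: sq_int_def)
  obtain g R where g: "\<And>n. (g n, R n) \<in> \<T>" "\<And>v. v \<in> {x, y, x + y} \<Longrightarrow> (\<lambda>n. l2 (M v) (\<lambda>l. g n l - f l)) \<longlonglongrightarrow> 0"
    "\<And>v. v \<in> {x, y, x + y} \<Longrightarrow> (\<lambda>n. R n v) \<longlonglongrightarrow> \<Phi> f v"
    by (rule operator_sequence[OF fin s fm]) (assumption, rule that)
  have "R n (x + y) = R n x + R n y" for n by (rule linear_add[OF \<T>_linear[OF g(1)]])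
  then have "(\<lambda>n. R n (x + y)) \<longlonglongrightarrow> \<Phi> f x + \<Phi> f y"
    using tendsto_add[OF g(3) g(3), of x y] by simp
  with g(3)[of "x + y"] show ?thesis by (simp add: LIMSEQ_unique)
qed

lemma \<Phi>_scale_arg:
  assumes x: "sq_int (M x) f" and cx: "sq_int (M (c *\<^sub>R x)) f"
  shows "\<Phi> f (c *\<^sub>R x) = c *\<^sub>R \<Phi> f x"
proof -
  have s: "sq_int (M v) f" if "v \<in> {x, c *\<^sub>R x}" for v using that assms by auto
  have fin: "finite {x, c *\<^sub>R x}" and fm: "f \<in> borel_measurable borel" using x by (auto simp: sq_int_def)
  obtain g R where g: "\<And>n. (g n, R n) \<in> \<T>" "\<And>v. v \<in> {x, c *\<^sub>R x} \<Longrightarrow> (\<lambda>n. l2 (M v) (\<lambda>l. g n l - f l)) \<longlonglongrightarrow> 0"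
    "\<And>v. v \<in> {x, c *\<^sub>R x} \<Longrightarrow> (\<lambda>n. R n v) \<longlonglongrightarrow> \<Phi> f v"
    by (rule operator_sequence[OF fin s fm]) (assumption, rule that)
  have "R n (c *\<^sub>R x) = c *\<^sub>R R n x" for n by (rule linear_scale[OF \<T>_linear[OF g(1)]])
  then have "(\<lambda>n. R n (c *\<^sub>R x)) \<longlonglongrightarrow> c *\<^sub>R \<Phi> f x"
    using tendsto_scaleR[OF tendsto_const g(3), of x c] by simp
  with g(3)[of "c *\<^sub>R x"] show ?thesis by (simp add: LIMSEQ_unique)
qed

lemma \<Phi>_sym:
  assumes x: "sq_int (M x) f" and y: "sq_int (M y) f"
  shows "inner (\<Phi> f x) y = inner x (\<Phi> f y)"
proof -
  have s: "sq_int (M v) f" if "v \<in> {x, y}" for v using that assms by auto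
  have fin: "finite {x, y}" and fm: "f \<in> borel_measurable borel" using x by (auto simp: sq_int_def)
  obtain g R where g: "\<And>n. (g n, R n) \<in> \<T>" "\<And>v. v \<in> {x, y} \<Longrightarrow> (\<lambda>n. l2 (M v) (\<lambda>l. g n l - f l)) \<longlonglongrightarrow> 0"
    "\<And>v. v \<in> {x, y} \<Longrightarrow> (\<lambda>n. R n v) \<longlonglongrightarrow> \<Phi> f v"
    by (rule operator_sequence[OF fin s fm]) (assumption, rule that)
  have "(\<lambda>n. inner (R n x) y) \<longlonglongrightarrow> inner (\<Phi> f x) y" using g(3) by (intro tendsto_intros) simp
  moreover have "(\<lambda>n. inner (R n x) y) \<longlonglongrightarrow> inner x (\<Phi> f y)"
    unfolding \<T>_sym[OF g(1)] using g(3) by (intro tendsto_intros) simp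
  ultimately show ?thesis by (rule LIMSEQ_unique)
qed

end

text \<open>Monotone convergence of the squared truncations. Uniform norm bounds for the truncated
  operators thus become membership in the domain of the full one.\<close>

lemma sq_int_cut_offI:
  assumes f: "f \<in> borel_measurable M"
    and s: "\<And>n. sq_int M (cut_off n f)" and C: "\<And>n. (\<integral>l. (cut_off n f l)\<^sup>2 \<partial>M) \<le> C"
  shows "sq_int M f"
proof -
  have mono: "mono (\<lambda>n. (cut_off n f l)\<^sup>2)" for l
    by (rule monoI) (auto simp: cut_off_def)
  have i: "integrable M (\<lambda>l. (cut_off n f l)\<^sup>2)" for n
    using s by (simp add: sq_int_def)
  have "incseq (\<lambda>n. \<integral>l. (cut_off n f l)\<^sup>2 \<partial>M)"
    using mono by (auto intro!: incseq_SucI integral_mono i simp: mono_def)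
  then obtain L where "(\<lambda>n. \<integral>l. (cut_off n f l)\<^sup>2 \<partial>M) \<longlonglongrightarrow> L"
    using C incseq_convergent by blast
  then have "integrable M (\<lambda>l. (f l)\<^sup>2)"
  proof (rule integrable_monotone_convergence[OF i, rotated 2])
    show "AE l in M. mono (\<lambda>n. (cut_off n f l)\<^sup>2)" by (rule AE_I2, rule mono)
    show "AE l in M. (\<lambda>n. (cut_off n f l)\<^sup>2) \<longlonglongrightarrow> (f l)\<^sup>2"
      by (rule AE_I2, rule tendsto_power, rule cut_off_tendsto)
  qed (use f in simp)
  then show ?thesis using f by (simp add: sq_int_def)
qed

section \<open>Bounded functions, domains of unbounded functions, and composition\<close>

context op_calculus
begin

text \<open>Essential boundedness for all measures \<open>M x\<close> with a common bound is what
  makes the operator bounded. The function 1 / (1 + l), whose operator will be the resolvent, is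
  unbounded near -1 and qualifies only in this sense.\<close>

definition ess_bdd :: "(real \<Rightarrow> real) \<Rightarrow> bool" where
  "ess_bdd f \<longleftrightarrow> f \<in> borel_measurable borel \<and> (\<exists>K. \<forall>x. AE l in M x. \<bar>f l\<bar> \<le> K)"

lemma ess_bddI: "f \<in> borel_measurable borel \<Longrightarrow> (\<And>l. \<bar>f l\<bar> \<le> K) \<Longrightarrow> ess_bdd f"
  by (auto simp: ess_bdd_def intro!: exI[of _ K])

lemma ess_bdd_indicator: "S \<in> sets borel \<Longrightarrow> ess_bdd (indicator S)"
  by (rule ess_bddI[of _ 1]) (auto simp: indicator_def)

lemma ess_bdd_cut_off: "f \<in> borel_measurable borel \<Longrightarrow> ess_bdd (cut_off n f)"
  by (rule ess_bddI[of _ "real n"]) (auto simp: cut_off_def)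

lemma ess_bdd_\<T>: "(f, R) \<in> \<T> \<Longrightarrow> ess_bdd f"
  using \<T>_measurable \<T>_bounded by (simp add: ess_bdd_def)

lemma ess_bdd_sq_int:
  assumes "ess_bdd f" shows "sq_int (M x) f"
proof -
  obtain K where "f \<in> borel_measurable borel" "AE l in M x. \<bar>f l\<bar> \<le> K"
    using assms by (auto simp: ess_bdd_def)
  then show ?thesis by (rule sq_int_bounded)
qed

lemma ess_bdd_obtain:
  assumes "ess_bdd f"
  obtains K where "0 < K" "\<And>x. AE l in M x. \<bar>f l\<bar> \<le> K"
proof -
  obtain K where K: "\<And>x. AE l in M x. \<bar>f l\<bar> \<le> K" using assms by (auto simp: ess_bdd_def)
  have "AE l in M x. \<bar>f l\<bar> \<le> \<bar>K\<bar> + 1" for x using K[of x] by eventually_elim simp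
  then show thesis using that[of "\<bar>K\<bar> + 1"] by auto
qed

lemma
  assumes "g \<in> borel_measurable borel" "AE l in M x. \<bar>g l\<bar> \<le> K" "0 < K" "sq_int (M x) f"
  shows sq_int_bdd_mult: "sq_int (M x) (\<lambda>l. g l * f l)"
    and l2_bdd_mult: "l2 (M x) (\<lambda>l. g l * f l) \<le> K * l2 (M x) f"
proof -
  have fm: "f \<in> borel_measurable borel" using assms by (simp add: sq_int_def)
  have le: "AE l in M x. \<bar>g l * f l\<bar> \<le> \<bar>K * f l\<bar>"
    using assms(2)
  proof eventually_elim
    case (elim l)
    then show ?case using mult_right_mono[of "\<bar>g l\<bar>" K "\<bar>f l\<bar>"] \<open>0 < K\<close> by (simp add: abs_mult)
  qed
  show "sq_int (M x) (\<lambda>l. g l * f l)"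
    by (rule sq_int_bound[OF sq_int_scale[OF assms(4)] _ le]) (use assms fm in auto)
  have "l2 (M x) (\<lambda>l. g l * f l) \<le> l2 (M x) (\<lambda>l. K * f l)"
    by (rule l2_mono[OF sq_int_scale[OF assms(4)] _ le]) (use assms fm in auto)
  then show "l2 (M x) (\<lambda>l. g l * f l) \<le> K * l2 (M x) f"
    using l2_scale[of "M x" K f] \<open>0 < K\<close> by simp
qed

lemma sq_int_ess_bdd_mult:
  assumes "ess_bdd g" "sq_int (M x) f" shows "sq_int (M x) (\<lambda>l. g l * f l)"
proof -
  obtain K where K: "0 < K" "\<And>x. AE l in M x. \<bar>g l\<bar> \<le> K" by (rule ess_bdd_obtain[OF assms(1)]) (rule that)
  show ?thesis by (rule sq_int_bdd_mult[OF _ K(2,1) assms(2)]) (use assms in \<open>simp add: ess_bdd_def\<close>)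
qed

lemma norm_\<Phi>_le:
  assumes "ess_bdd g" "\<And>x. AE l in M x. \<bar>g l\<bar> \<le> K" "0 < K"
  shows "norm (\<Phi> g x) \<le> K * norm x"
  using l2_bdd_mult[where g = g and x = x and K = K and f = "\<lambda>_. 1"] assms sq_int_const norm_eq_l2_one[of x] norm_\<Phi>[OF ess_bdd_sq_int[OF assms(1)]]
  by (simp add: ess_bdd_def)

lemma bounded_linear_\<Phi>:
  assumes "ess_bdd g" shows "bounded_linear (\<Phi> g)"
proof -
  obtain K where K: "0 < K" "\<And>x. AE l in M x. \<bar>g l\<bar> \<le> K" by (rule ess_bdd_obtain[OF assms]) (rule that)
  show ?thesis
    using norm_\<Phi>_le[OF assms K(2,1)] ess_bdd_sq_int[OF assms]
    by (intro bounded_linear_intro[of _ K]) (auto intro: \<Phi>_add_arg \<Phi>_scale_arg simp: mult.commute)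
qed

lemma norm_\<Phi>_cut_off_le:
  assumes "sq_int (M x) f" shows "norm (\<Phi> (cut_off n f) x) \<le> l2 (M x) f"
proof -
  have f: "f \<in> borel_measurable borel" using assms by (simp add: sq_int_def)
  show ?thesis
    unfolding norm_\<Phi>[OF ess_bdd_sq_int[OF ess_bdd_cut_off[OF f]]]
    by (rule l2_mono[OF assms]) (use f cut_off_abs_le in auto)
qed

lemma sq_intI_cut_off:
  assumes f: "f \<in> borel_measurable borel" and C: "\<And>n. norm (\<Phi> (cut_off n f) x) \<le> C"
  shows "sq_int (M x) f"
proof (rule sq_int_cut_offI)
  note b = ess_bdd_sq_int[OF ess_bdd_cut_off[OF f]]
  show "sq_int (M x) (cut_off n f)" for n by (rule b)
  show "(\<integral>l. (cut_off n f l)\<^sup>2 \<partial>M x) \<le> C\<^sup>2" for n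
    using norm_\<Phi>[OF b, of n x] power_mono[OF C norm_ge_zero, of n 2] by (simp add: l2_power2)
qed (use f in simp)

text \<open>The measure of x + y is not a function of those of x and y, so integrals cannot be
  compared directly. The truncations act as bounded linear operators and carry the triangle
  inequality instead.\<close>

lemma
  assumes x: "sq_int (M x) f"
  shows sq_int_arg_add: "sq_int (M y) f \<Longrightarrow> sq_int (M (x + y)) f"
    and sq_int_arg_scale: "sq_int (M (c *\<^sub>R x)) f"
proof -
  have fm: "f \<in> borel_measurable borel" using x by (simp add: sq_int_def)
  note lin = bounded_linear.linear[OF bounded_linear_\<Phi>[OF ess_bdd_cut_off[OF fm]]]
  note le = norm_\<Phi>_cut_off_le
  show "sq_int (M (x + y)) f" if y: "sq_int (M y) f"
  proof (rule sq_intI_cut_off[OF fm])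
    show "norm (\<Phi> (cut_off n f) (x + y)) \<le> l2 (M x) f + l2 (M y) f" for n
      unfolding linear_add[OF lin] using le[OF x, of n] le[OF y, of n] by (rule norm_triangle_mono)
  qed
  show "sq_int (M (c *\<^sub>R x)) f"
  proof (rule sq_intI_cut_off[OF fm])
    show "norm (\<Phi> (cut_off n f) (c *\<^sub>R x)) \<le> \<bar>c\<bar> * l2 (M x) f" for n
      unfolding linear_scale[OF lin] norm_scaleR by (intro mult_left_mono le[OF x]) simp
  qed
qed

lemma sq_int_arg_diff:
  "sq_int (M x) f \<Longrightarrow> sq_int (M y) f \<Longrightarrow> sq_int (M (x - y)) f"
  using sq_int_arg_add[of x f "- y"] sq_int_arg_scale[of y f "-1"] by simp

lemma \<Phi>_diff_arg:
  assumes "sq_int (M x) f" "sq_int (M y) f"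
  shows "\<Phi> f (x - y) = \<Phi> f x - \<Phi> f y"
  using \<Phi>_add_arg[of "x - y" f y] sq_int_arg_diff[OF assms] assms by (simp add: algebra_simps)

text \<open>First stage of multiplicativity, with the outer function in \<open>\<T>\<close>. The
  outer function is then allowed to be bounded for bounded f, f to be unbounded, and finally the
  outer function as well; each stage approximates one factor by those already treated.\<close>

lemma \<T>_comp_\<Phi>:
  assumes g: "(g, R) \<in> \<T>" and f: "sq_int (M x) f"
  shows "R (\<Phi> f x) = \<Phi> (\<lambda>l. g l * f l) x"
proof -
  obtain K where K: "0 < K" "\<And>x. AE l in M x. \<bar>g l\<bar> \<le> K"
    by (rule ess_bdd_obtain[OF ess_bdd_\<T>[OF g]]) (rule that)
  have gm: "g \<in> borel_measurable borel" by (rule \<T>_measurable[OF g])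
  have gf: "sq_int (M x) (\<lambda>l. g l * f l)" by (rule sq_int_bdd_mult[OF gm K(2,1) f])
  obtain u S where u: "\<And>n. (u n, S n) \<in> \<T>" "(\<lambda>n. l2 (M x) (\<lambda>l. u n l - f l)) \<longlonglongrightarrow> 0"
    "(\<lambda>n. S n x) \<longlonglongrightarrow> \<Phi> f x"
    using operator_sequence1[OF f] by blast
  have "(\<lambda>n. l2 (M x) (\<lambda>l. g l * u n l - g l * f l)) \<longlonglongrightarrow> 0"
  proof (rule Lim_null_comparison)
    show "\<forall>\<^sub>F n in sequentially. norm (l2 (M x) (\<lambda>l. g l * u n l - g l * f l)) \<le> K * l2 (M x) (\<lambda>l. u n l - f l)"
      using l2_bdd_mult[OF gm K(2,1) sq_int_diff[OF \<T>_sq_int[OF u(1)] f]]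
      by (simp add: right_diff_distrib)
  qed (rule tendsto_mult_right_zero[OF u(2)])
  from \<T>_tendsto[OF \<T>_mult[OF g u(1)] gf this]
  have 1: "(\<lambda>n. R (S n x)) \<longlonglongrightarrow> \<Phi> (\<lambda>l. g l * f l) x" .
  have R: "R = \<Phi> g" using \<Phi>_\<T>[OF g] by (simp add: fun_eq_iff)
  have "(\<lambda>n. R (S n x)) \<longlonglongrightarrow> R (\<Phi> f x)"
    unfolding R by (rule bounded_linear.tendsto[OF bounded_linear_\<Phi>[OF ess_bdd_\<T>[OF g]] u(3)])
  then show ?thesis using 1 by (rule LIMSEQ_unique)
qed

lemma \<Phi>_tendsto:
  assumes "\<And>n. sq_int (M x) (u n)" "sq_int (M x) v" "(\<lambda>n. l2 (M x) (\<lambda>l. u n l - v l)) \<longlonglongrightarrow> 0"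
  shows "(\<lambda>n. \<Phi> (u n) x) \<longlonglongrightarrow> \<Phi> v x"
proof -
  have "(\<lambda>n. norm (\<Phi> (u n) x - \<Phi> v x)) \<longlonglongrightarrow> 0"
    using assms by (simp add: dist_\<Phi>)
  then show ?thesis by (simp only: tendsto_norm_zero_iff LIM_zero_iff)
qed

text \<open>The approximation of g has to hold at x, to control the products with f in L2, and at
  \<open>\<Phi> f x\<close>, to reach the left-hand side. A finite set of two vectors provides
  both.\<close>

lemma \<Phi>_comp_bdd_bdd:
  assumes g: "ess_bdd g" and f: "ess_bdd f"
  shows "\<Phi> g (\<Phi> f x) = \<Phi> (\<lambda>l. g l * f l) x"
proof -
  obtain K where K: "0 < K" "\<And>x. AE l in M x. \<bar>f l\<bar> \<le> K"
    by (rule ess_bdd_obtain[OF f]) (rule that)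
  have m: "f \<in> borel_measurable borel" "g \<in> borel_measurable borel"
    using f g by (auto simp: ess_bdd_def)
  have fin: "finite {x, \<Phi> f x}" by simp
  obtain u R where u: "\<And>n. (u n, R n) \<in> \<T>"
    and lim: "\<And>v. v \<in> {x, \<Phi> f x} \<Longrightarrow> (\<lambda>n. l2 (M v) (\<lambda>l. u n l - g l)) \<longlonglongrightarrow> 0"
      "\<And>v. v \<in> {x, \<Phi> f x} \<Longrightarrow> (\<lambda>n. R n v) \<longlonglongrightarrow> \<Phi> g v"
    by (rule operator_sequence[OF fin ess_bdd_sq_int[OF g] m(2)]) (rule that)
  have "(\<lambda>n. l2 (M x) (\<lambda>l. u n l * f l - g l * f l)) \<longlonglongrightarrow> 0"
  proof (rule Lim_null_comparison)
    show "\<forall>\<^sub>F n in sequentially. norm (l2 (M x) (\<lambda>l. u n l * f l - g l * f l)) \<le> K * l2 (M x) (\<lambda>l. u n l - g l)"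
      using l2_bdd_mult[OF m(1) K(2,1) sq_int_diff[OF \<T>_sq_int[OF u] ess_bdd_sq_int[OF g]]]
      by (simp add: algebra_simps)
  qed (intro tendsto_mult_right_zero lim(1), simp)
  then have "(\<lambda>n. \<Phi> (\<lambda>l. u n l * f l) x) \<longlonglongrightarrow> \<Phi> (\<lambda>l. g l * f l) x"
    by (intro \<Phi>_tendsto sq_int_ess_bdd_mult ess_bdd_\<T>[OF u] g ess_bdd_sq_int[OF f])
  then show ?thesis
    unfolding \<T>_comp_\<Phi>[OF u ess_bdd_sq_int[OF f], symmetric] by (intro LIMSEQ_unique[OF lim(2)[of "\<Phi> f x"]]) simp_all
qed

lemma \<Phi>_comp_bdd:
  assumes g: "ess_bdd g" and f: "sq_int (M x) f"
  shows "\<Phi> g (\<Phi> f x) = \<Phi> (\<lambda>l. g l * f l) x"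
proof -
  have m: "f \<in> borel_measurable borel" "g \<in> borel_measurable borel"
    using f g by (auto simp: sq_int_def ess_bdd_def)
  have b: "ess_bdd (cut_off n f)" for n by (rule ess_bdd_cut_off[OF m(1)])
  have "(\<lambda>n. \<Phi> (cut_off n f) x) \<longlonglongrightarrow> \<Phi> f x"
    by (rule \<Phi>_tendsto[OF ess_bdd_sq_int[OF b] f l2_cut_off[OF f]])
  then have 1: "(\<lambda>n. \<Phi> g (\<Phi> (cut_off n f) x)) \<longlonglongrightarrow> \<Phi> g (\<Phi> f x)"
    by (rule bounded_linear.tendsto[OF bounded_linear_\<Phi>[OF g]])
  have gf: "sq_int (M x) (\<lambda>l. g l * f l)" by (rule sq_int_ess_bdd_mult[OF g f])
  have "(\<lambda>n. l2 (M x) (\<lambda>l. cut_off n f l * g l - f l * g l)) \<longlonglongrightarrow> 0"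
    using gf m by (intro l2_cut_off_mult) (auto simp: mult.commute)
  then have "(\<lambda>n. \<Phi> (\<lambda>l. g l * cut_off n f l) x) \<longlonglongrightarrow> \<Phi> (\<lambda>l. g l * f l) x"
    by (intro \<Phi>_tendsto sq_int_ess_bdd_mult[OF g] ess_bdd_sq_int[OF b] f) (simp add: mult.commute)
  with 1 show ?thesis
    unfolding \<Phi>_comp_bdd_bdd[OF g b] using LIMSEQ_unique by blast
qed

lemma measure_eq_norm: "S \<in> sets borel \<Longrightarrow> measure (M x) S = (norm (\<Phi> (indicator S) x))\<^sup>2"
proof -
  assume S: "S \<in> sets borel"
  interpret finite_measure "M x" by (rule finite_M)
  have "(norm (\<Phi> (indicator S) x))\<^sup>2 = (\<integral>l. (indicator S l)\<^sup>2 \<partial>M x)"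
    using norm_\<Phi>[OF ess_bdd_sq_int[OF ess_bdd_indicator[OF S]]] by (simp add: l2_power2)
  also have "\<dots> = (\<integral>l. indicator S l \<partial>M x)"
    by (intro Bochner_Integration.integral_cong) (auto simp: indicator_def)
  finally show ?thesis using S by simp
qed

text \<open>The mass of S is the squared norm of the projection of \<open>\<Phi> f x\<close> to S,
  and projecting multiplies f by the indicator of S. Consequently the domain of g at
  \<open>\<Phi> f x\<close> can be read off from g * f at x.\<close>

lemma M_\<Phi>:
  assumes f: "sq_int (M x) f"
  shows "M (\<Phi> f x) = density (M x) (\<lambda>l. ennreal ((f l)\<^sup>2))"
proof (rule measure_eqI)
  fix S assume "S \<in> sets (M (\<Phi> f x))"
  then have S: "S \<in> sets borel" by simp
  interpret finite_measure "M (\<Phi> f x)" by (rule finite_M)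
  have fm: "f \<in> borel_measurable borel" using f by (simp add: sq_int_def)
  note b = ess_bdd_indicator[OF S]
  have i: "integrable (M x) (\<lambda>l. (indicator S l * f l)\<^sup>2)"
    using sq_int_ess_bdd_mult[OF b f] by (simp add: sq_int_def)
  have "measure (M (\<Phi> f x)) S = (\<integral>l. (indicator S l * f l)\<^sup>2 \<partial>M x)"
    using norm_\<Phi>[OF sq_int_ess_bdd_mult[OF b f]]
    by (simp add: measure_eq_norm[OF S] \<Phi>_comp_bdd[OF b f] l2_power2)
  then have "emeasure (M (\<Phi> f x)) S = (\<integral>\<^sup>+l. ennreal ((indicator S l * f l)\<^sup>2) \<partial>M x)"
    using nn_integral_eq_integral[OF i] by (simp add: emeasure_eq_measure)
  also have "\<dots> = (\<integral>\<^sup>+l. ennreal ((f l)\<^sup>2) * indicator S l \<partial>M x)"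
    by (intro nn_integral_cong) (auto simp: indicator_def)
  also have "\<dots> = emeasure (density (M x) (\<lambda>l. ennreal ((f l)\<^sup>2))) S"
    using S fm by (intro emeasure_density[symmetric]) auto
  finally show "emeasure (M (\<Phi> f x)) S = emeasure (density (M x) (\<lambda>l. ennreal ((f l)\<^sup>2))) S" .
qed simp

lemma nn_integral_M_\<Phi>:
  assumes f: "sq_int (M x) f" and g: "g \<in> borel_measurable borel"
  shows "(\<integral>\<^sup>+l. g l \<partial>M (\<Phi> f x)) = (\<integral>\<^sup>+l. ennreal ((f l)\<^sup>2) * g l \<partial>M x)"
  using f g unfolding M_\<Phi>[OF f] by (intro nn_integral_density) (auto simp: sq_int_def)

lemma sq_int_\<Phi>_iff:
  assumes f: "sq_int (M x) f" and g: "g \<in> borel_measurable borel"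
  shows "sq_int (M (\<Phi> f x)) g \<longleftrightarrow> sq_int (M x) (\<lambda>l. g l * f l)"
proof -
  have "integrable (M (\<Phi> f x)) (\<lambda>l. (g l)\<^sup>2) \<longleftrightarrow> integrable (M x) (\<lambda>l. (f l)\<^sup>2 *\<^sub>R (g l)\<^sup>2)"
    unfolding M_\<Phi>[OF f] using f g by (intro integrable_density) (auto simp: sq_int_def)
  then show ?thesis
    using f g by (auto simp: sq_int_def power_mult_distrib mult.commute)
qed

lemma \<Phi>_comp:
  assumes f: "sq_int (M x) f" and gf: "sq_int (M x) (\<lambda>l. g l * f l)" and g: "g \<in> borel_measurable borel"
  shows "\<Phi> g (\<Phi> f x) = \<Phi> (\<lambda>l. g l * f l) x"
proof -
  have fm: "f \<in> borel_measurable borel" using f by (simp add: sq_int_def)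
  have sg: "sq_int (M (\<Phi> f x)) g" using sq_int_\<Phi>_iff[OF f g] gf by simp
  have b: "ess_bdd (cut_off n g)" for n by (rule ess_bdd_cut_off[OF g])
  have "(\<lambda>n. \<Phi> (cut_off n g) (\<Phi> f x)) \<longlonglongrightarrow> \<Phi> g (\<Phi> f x)"
    by (rule \<Phi>_tendsto[OF ess_bdd_sq_int[OF b] sg l2_cut_off[OF sg]])
  moreover have "(\<lambda>n. \<Phi> (\<lambda>l. cut_off n g l * f l) x) \<longlonglongrightarrow> \<Phi> (\<lambda>l. g l * f l) x"
    by (intro \<Phi>_tendsto sq_int_ess_bdd_mult[OF b] f gf l2_cut_off_mult) (use fm g in auto)
  ultimately show ?thesis
    unfolding \<Phi>_comp_bdd[OF b f] using LIMSEQ_unique by blast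
qed

end

section \<open>The calculus of a projection-valued measure\<close>

text \<open>Products are not generators: closure under them follows from multiplicativity of E on
  intersections, and the inductions over the set keep linear cases only.\<close>

inductive_set simple_calculus ::
    "(real set \<Rightarrow> 'a \<Rightarrow> 'a::real_vector) \<Rightarrow> ((real \<Rightarrow> real) \<times> ('a \<Rightarrow> 'a)) set"
  for E where
    ind: "S \<in> sets borel \<Longrightarrow> (indicator S, E S) \<in> simple_calculus E"
  | add: "(f, R) \<in> simple_calculus E \<Longrightarrow> (g, S) \<in> simple_calculus E \<Longrightarrow>
      (\<lambda>l. f l + g l, \<lambda>x. R x + S x) \<in> simple_calculus E"
  | scale: "(f, R) \<in> simple_calculus E \<Longrightarrow> (\<lambda>l. c * f l, \<lambda>x. c *\<^sub>R R x) \<in> simple_calculus E"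

locale pvm =
  fixes E :: "real set \<Rightarrow> 'a \<Rightarrow> 'a::{real_inner,complete_space}"
  assumes pvm: "projection_valued_measure E"
begin

lemma E_linear: "S \<in> sets borel \<Longrightarrow> linear (E S)"
  using pvm by (auto simp: projection_valued_measure_def bounded_linear.linear)

lemma E_sym: "S \<in> sets borel \<Longrightarrow> inner (E S x) y = inner x (E S y)"
  using pvm unfolding projection_valued_measure_def by blast

lemma E_Int: "S \<in> sets borel \<Longrightarrow> T \<in> sets borel \<Longrightarrow> E (S \<inter> T) x = E S (E T x)"
  using pvm unfolding projection_valued_measure_def by blast

lemma E_UNIV: "E UNIV x = x"
  using pvm by (auto simp: projection_valued_measure_def)

lemma E_sums: "range F \<subseteq> sets borel \<Longrightarrow> disjoint_family F \<Longrightarrow> (\<lambda>n. E (F n) x) sums E (\<Union>n. F n) x"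
  using pvm unfolding projection_valued_measure_def by blast

lemma E_empty: "E {} x = 0"
proof -
  have "(\<lambda>n::nat. E {} x) sums E (\<Union>n::nat. {}) x"
    by (rule E_sums) (auto simp: disjoint_family_on_def)
  then show ?thesis using sums_summable summable_const_iff by blast
qed

lemma inner_E: "S \<in> sets borel \<Longrightarrow> inner x (E S x) = (norm (E S x))\<^sup>2"
  using E_Int[of S S x] E_sym[of S x "E S x"] by (simp add: power2_norm_eq_inner)

lemma sets_scalar_measure [simp]: "sets (scalar_measure E x) = sets borel"
proof -
  have "sigma_sets UNIV (sets (borel::real measure)) = sets borel"
    using sets.sigma_sets_eq[of "borel::real measure"] by simp
  then show ?thesis by (simp add: scalar_measure_def)
qed

lemma emeasure_scalar_measure:
  assumes "S \<in> sets borel"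
  shows "emeasure (scalar_measure E x) S = ennreal (inner x (E S x))"
proof (rule emeasure_measure_of[OF scalar_measure_def])
  show "positive (sets (scalar_measure E x)) (\<lambda>S. ennreal (inner x (E S x)))"
    by (simp add: positive_def E_empty)
  show "countably_additive (sets (scalar_measure E x)) (\<lambda>S. ennreal (inner x (E S x)))"
  proof (rule countably_additiveI)
    fix F :: "nat \<Rightarrow> real set"
    assume F: "range F \<subseteq> sets (scalar_measure E x)" "disjoint_family F"
    then have Fb: "F i \<in> sets borel" for i by auto
    have "(\<lambda>n. E (F n) x) sums E (\<Union>n. F n) x" using F by (intro E_sums) auto
    then have "(\<lambda>n. inner x (E (F n) x)) sums inner x (E (\<Union>n. F n) x)"
      by (rule bounded_linear.sums[OF bounded_linear_inner_right])
    then show "(\<Sum>i. ennreal (inner x (E (F i) x))) = ennreal (inner x (E (\<Union> (range F)) x))"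
      using Fb by (intro suminf_ennreal_eq) (auto simp: inner_E)
  qed
qed (use assms in auto)

lemma simple_calculus_mult:
  assumes "(f, R) \<in> simple_calculus E" "(g, S) \<in> simple_calculus E"
  shows "(\<lambda>l. f l * g l, \<lambda>x. R (S x)) \<in> simple_calculus E"
  using assms
proof (induction f R)
  case (ind A)
  show ?case using ind(2)
  proof (induction g S)
    case (ind B)
    have "(\<lambda>l. indicator A l * indicator B l) = (indicator (A \<inter> B) :: real \<Rightarrow> real)"
      by (auto simp: fun_eq_iff indicator_def)
    moreover have "(\<lambda>x. E A (E B x)) = E (A \<inter> B)"
      using E_Int \<open>A \<in> sets borel\<close> ind by auto
    ultimately show ?case
      using simple_calculus.ind[of "A \<inter> B" E] \<open>A \<in> sets borel\<close> ind by auto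
  next
    case (add f R g S)
    have "(\<lambda>x. E A (R x + S x)) = (\<lambda>x. E A (R x) + E A (S x))"
      using linear_add[OF E_linear] ind by auto
    then show ?case using simple_calculus.add[OF add.IH] by (simp add: distrib_left)
  next
    case (scale f R c)
    have "(\<lambda>x. E A (c *\<^sub>R R x)) = (\<lambda>x. c *\<^sub>R E A (R x))"
      using linear_scale[OF E_linear] ind by auto
    then show ?case using simple_calculus.scale[OF scale.IH, of c] by (simp add: mult.left_commute)
  qed
next
  case (add f R g' S')
  then show ?case
    using simple_calculus.add[OF add.IH(1)[OF add.prems] add.IH(2)[OF add.prems]]
    by (simp add: distrib_right)
next
  case (scale f R c)
  then show ?case
    using simple_calculus.scale[OF scale.IH[OF scale.prems], of c] by (simp add: mult.assoc)
qed

lemma measurable_scalar_measure: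
  "f \<in> borel_measurable (scalar_measure E x) \<longleftrightarrow> f \<in> borel_measurable borel"
  by (rule arg_cong[where f = "\<lambda>A. f \<in> A"], rule measurable_cong_sets) auto

lemma finite_scalar_measure: "finite_measure (scalar_measure E x)"
  using sets_eq_imp_space_eq[OF sets_scalar_measure]
  by (intro finite_measureI) (simp add: emeasure_scalar_measure)

lemma simple_calculus_bounded:
  "(f, R) \<in> simple_calculus E \<Longrightarrow> f \<in> borel_measurable borel \<and> (\<exists>K. \<forall>l. \<bar>f l\<bar> \<le> K)"
proof (induction f R rule: simple_calculus.induct)
  case (ind S)
  then show ?case by (auto simp: indicator_def intro!: exI[of _ 1])
next
  case (add f R g S)
  then obtain K L where "\<And>l. \<bar>f l\<bar> \<le> K" "\<And>l. \<bar>g l\<bar> \<le> L" by auto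
  then have "\<bar>f l + g l\<bar> \<le> K + L" for l by (metis abs_triangle_ineq add_mono order_trans)
  then show ?case using add.IH by auto
next
  case (scale f R c)
  then obtain K where "\<And>l. \<bar>f l\<bar> \<le> K" by auto
  then have "\<bar>c * f l\<bar> \<le> \<bar>c\<bar> * K" for l by (simp add: abs_mult mult_left_mono)
  then show ?case using scale.IH by auto
qed

lemma simple_calculus_integrable:
  assumes "(f, R) \<in> simple_calculus E" shows "integrable (scalar_measure E x) f"
proof -
  interpret finite_measure "scalar_measure E x" by (rule finite_scalar_measure)
  obtain K where "\<And>l. \<bar>f l\<bar> \<le> K" using simple_calculus_bounded[OF assms] by auto
  then show ?thesis
    using simple_calculus_bounded[OF assms] by (intro integrable_const_bound[where B = K]) (auto simp: measurable_scalar_measure)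
qed

sublocale op_algebra "simple_calculus E" "scalar_measure E"
proof (rule op_algebra.intro)
  show "finite_measure (scalar_measure E x)" for x by (rule finite_scalar_measure)
  fix f g R S assume f: "(f, R) \<in> simple_calculus E"
  show "f \<in> borel_measurable borel" using simple_calculus_bounded[OF f] by blast
  show "\<exists>K. \<forall>x. AE l in scalar_measure E x. \<bar>f l\<bar> \<le> K"
    using simple_calculus_bounded[OF f] by auto
  show "(\<lambda>l. c * f l, \<lambda>x. c *\<^sub>R R x) \<in> simple_calculus E" for c
    by (rule simple_calculus.scale[OF f])
  show "linear R" using f
    by (induction f R rule: simple_calculus.induct)
      (auto simp: E_linear intro: linear_compose_add linear_compose_scale_right)
  show "inner (R x) y = inner x (R y)" for x y using f
    by (induction f R rule: simple_calculus.induct) (auto simp: E_sym inner_add)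
  show "inner x (R x) = (\<integral>l. f l \<partial>scalar_measure E x)" for x using f
  proof (induction f R rule: simple_calculus.induct)
    case (ind S)
    interpret finite_measure "scalar_measure E x" by (rule finite_scalar_measure)
    have "measure (scalar_measure E x) S = inner x (E S x)"
      using emeasure_scalar_measure[OF ind, of x] inner_E[OF ind] by (simp add: measure_def)
    then show ?case using ind by simp
  next
    case (add f R g S)
    then show ?case using simple_calculus_integrable by (simp add: inner_add_right)
  qed simp
  assume g: "(g, S) \<in> simple_calculus E"
  show "(\<lambda>l. f l + g l, \<lambda>x. R x + S x) \<in> simple_calculus E"
    by (rule simple_calculus.add[OF f g])
  show "(\<lambda>l. f l * g l, \<lambda>x. R (S x)) \<in> simple_calculus E"
    by (rule simple_calculus_mult[OF f g])
next
  have "(indicator UNIV, E UNIV) = ((\<lambda>_. 1) :: real \<Rightarrow> real, \<lambda>x. x)"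
    by (auto simp: fun_eq_iff E_UNIV)
  then show "(\<lambda>_. 1, \<lambda>x. x) \<in> simple_calculus E"
    using simple_calculus.ind[of UNIV E] by simp
qed simp

sublocale op_calculus "simple_calculus E" "scalar_measure E"
proof
  fix F :: "'a set" and B :: "real set" assume "B \<in> sets borel"
  then show "approximable F (indicator B)"
    using simple_calculus.ind[of B E] unfolding approximable_def
    by (intro allI impI bexI[of _ "(indicator B, E B)"]) auto
qed

lemma pvm_dom_eq: "f \<in> borel_measurable borel \<Longrightarrow> pvm_dom E f = {x. sq_int (scalar_measure E x) f}"
  by (simp add: pvm_dom_def sq_int_def)

text \<open>The projections of u to the sets where |f| is at most n lie in the domain and converge
  to u, so u is orthogonal to itself.\<close>

lemma pvm_dom_dense:
  assumes f: "f \<in> borel_measurable borel" and u: "\<And>y. y \<in> pvm_dom E f \<Longrightarrow> inner u y = 0"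
  shows "u = 0"
proof -
  define A where "A n = {l. \<bar>f l\<bar> \<le> real n}" for n
  have A: "A n \<in> sets borel" for n unfolding A_def using f by measurable
  note b = ess_bdd_indicator[OF A]
  have "\<Phi> (indicator (A n)) u \<in> pvm_dom E f" for n
    unfolding pvm_dom_eq[OF f] mem_Collect_eq sq_int_\<Phi>_iff[OF ess_bdd_sq_int[OF b] f]
    using f A by (intro sq_int_bounded'[of _ "real n"]) (auto simp: A_def indicator_def)
  then have 0: "inner u (\<Phi> (indicator (A n)) u) = 0" for n by (rule u)
  have "(\<lambda>n. l2 (scalar_measure E u) (\<lambda>l. indicator (A n) l - 1)) \<longlonglongrightarrow> 0"
  proof (rule l2_dominated_convergence[OF sq_int_const[of u 1]])
    show "AE l in scalar_measure E u. (\<lambda>n. indicator (A n) l) \<longlonglongrightarrow> (1::real)"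
    proof (rule AE_I2, rule tendsto_eventually)
      fix l
      obtain N where "\<bar>f l\<bar> \<le> real N" using real_arch_simple by blast
      then have "indicator (A n) l = (1::real)" if "N \<le> n" for n using that by (auto simp: A_def)
      then show "\<forall>\<^sub>F n in sequentially. indicator (A n) l = (1::real)"
        by (auto simp: eventually_sequentially)
    qed
  qed (use A in \<open>auto simp: indicator_def\<close>)
  then have "(\<lambda>n. \<Phi> (indicator (A n)) u) \<longlonglongrightarrow> \<Phi> (\<lambda>_. 1) u"
    by (intro \<Phi>_tendsto ess_bdd_sq_int[OF b] sq_int_const)
  then have "(\<lambda>n. inner u (\<Phi> (indicator (A n)) u)) \<longlonglongrightarrow> inner u u"
    unfolding \<Phi>_one by (intro tendsto_intros)
  then show ?thesis unfolding 0 by (simp add: LIMSEQ_const_iff)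
qed

text \<open>Polarization shows that \<open>\<Phi> f x\<close> satisfies the weak description, and
  density of the domain shows that no other vector does.\<close>

lemma pvm_integral_eq:
  assumes f: "sq_int (scalar_measure E x) f"
  shows "pvm_integral E f x = \<Phi> f x"
  unfolding pvm_integral_def
proof (rule the_equality)
  have fm: "f \<in> borel_measurable borel" using f by (simp add: sq_int_def)
  show *: "\<forall>y\<in>pvm_dom E f. inner (\<Phi> f x) y =
     ((\<integral>l. f l \<partial>scalar_measure E (x + y)) - (\<integral>l. f l \<partial>scalar_measure E (x - y))) / 4"
  proof
    fix y assume "y \<in> pvm_dom E f"
    then have y: "sq_int (scalar_measure E y) f" by (simp add: pvm_dom_eq fm)
    have "(\<integral>l. f l \<partial>scalar_measure E (x + y)) = inner (x + y) (\<Phi> f x + \<Phi> f y)"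
      using inner_\<Phi>_self[OF sq_int_arg_add[OF f y]] \<Phi>_add_arg[OF f y sq_int_arg_add[OF f y]] by simp
    moreover have "(\<integral>l. f l \<partial>scalar_measure E (x - y)) = inner (x - y) (\<Phi> f x - \<Phi> f y)"
      using inner_\<Phi>_self[OF sq_int_arg_diff[OF f y]] \<Phi>_diff_arg[OF f y] by simp
    ultimately show "inner (\<Phi> f x) y =
     ((\<integral>l. f l \<partial>scalar_measure E (x + y)) - (\<integral>l. f l \<partial>scalar_measure E (x - y))) / 4"
      using \<Phi>_sym[OF f y] by (simp add: inner_add inner_diff inner_commute)
  qed
  fix z assume z: "\<forall>y\<in>pvm_dom E f. inner z y =
     ((\<integral>l. f l \<partial>scalar_measure E (x + y)) - (\<integral>l. f l \<partial>scalar_measure E (x - y))) / 4"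
  have "z - \<Phi> f x = 0"
    using * z by (intro pvm_dom_dense[OF fm]) (metis eq_iff_diff_eq_0 inner_diff_left)
  then show "z = \<Phi> f x" by simp
qed

end

section \<open>The Hausdorff moment problem\<close>

text \<open>The model is d k l = integral of b^k (1 - b)^l. The recursion then says b + (1 - b) = 1,
  and the sum is the expansion of (b + (1 - b))^n under the integral.\<close>

lemma binomial_weights_sum:
  fixes d :: "nat \<Rightarrow> nat \<Rightarrow> real"
  assumes "\<And>k l. d k l = d (Suc k) l + d k (Suc l)"
  shows "(\<Sum>k\<le>n. real (n choose k) * d k (n - k)) = d 0 0"
  using assms
proof (induction n arbitrary: d)
  case (Suc n)
  have "(\<Sum>k\<le>Suc n. real (Suc n choose k) * d k (Suc n - k))
      = d 0 (Suc n) + (\<Sum>k\<le>n. real (Suc n choose Suc k) * d (Suc k) (n - k))"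
    by (subst sum.atMost_Suc_shift) simp
  also have "(\<Sum>k\<le>n. real (Suc n choose Suc k) * d (Suc k) (n - k))
      = (\<Sum>k\<le>n. real (n choose k) * d (Suc k) (n - k)) + (\<Sum>k\<le>n. real (n choose Suc k) * d (Suc k) (n - k))"
    by (simp add: sum.distrib algebra_simps)
  also have "d 0 (Suc n) + ((\<Sum>k\<le>n. real (n choose k) * d (Suc k) (n - k))
        + (\<Sum>k\<le>n. real (n choose Suc k) * d (Suc k) (n - k)))
      = (\<Sum>k\<le>n. real (n choose k) * d (Suc k) (n - k)) + (\<Sum>k\<le>Suc n. real (n choose k) * d k (Suc n - k))"
  proof -
    have "(\<Sum>k\<le>Suc n. real (n choose k) * d k (Suc n - k))
        = d 0 (Suc n) + (\<Sum>k\<le>n. real (n choose Suc k) * d (Suc k) (n - k))"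
      by (subst sum.atMost_Suc_shift) simp
    then show ?thesis by linarith
  qed
  also have "(\<Sum>k\<le>Suc n. real (n choose k) * d k (Suc n - k)) = (\<Sum>k\<le>n. real (n choose k) * d k (Suc (n - k)))"
    by (auto simp: Suc_diff_le)
  also have "(\<Sum>k\<le>n. real (n choose k) * d (Suc k) (n - k)) = d (Suc 0) 0"
    by (rule Suc.IH) (rule Suc.prems)
  also have "(\<Sum>k\<le>n. real (n choose k) * d k (Suc (n - k))) = d 0 (Suc 0)"
    by (rule Suc.IH) (rule Suc.prems)
  also have "d (Suc 0) 0 + d 0 (Suc 0) = d 0 0" by (rule Suc.prems[symmetric])
  finally show ?case .
next
  case 0
  show ?case by simp
qed

text \<open>Induction on j. The identity (n+1 choose k+1) (k+1) / (n+1) = (n choose k) absorbs one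
  power of the node and replaces d by its shift \<open>d'\<close>, whose moment of order j is that
  of d of order j + 1. What remains is the shift of the nodes from k / n to (k+1) / (n+1).\<close>

lemma bernstein_moments_tendsto:
  fixes d :: "nat \<Rightarrow> nat \<Rightarrow> real"
  assumes "\<And>k l. d k l = d (Suc k) l + d k (Suc l)" "\<And>k l. 0 \<le> d k l"
  shows "(\<lambda>n. \<Sum>k\<le>n. real (n choose k) * d k (n - k) * (real k / real n) ^ j) \<longlonglongrightarrow> d j 0"
  using assms
proof (induction j arbitrary: d)
  case 0
  show ?case using binomial_weights_sum[of d, OF 0(1)] by simp
next
  case (Suc j)
  define d' where "d' k l = d (Suc k) l" for k l
  have d': "\<And>k l. d' k l = d' (Suc k) l + d' k (Suc l)" "\<And>k l. 0 \<le> d' k l"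
    unfolding d'_def by (rule Suc.prems(1), rule Suc.prems(2))
  define w where "w n k = real (n choose k) * d' k (n - k)" for n k
  have w0: "0 \<le> w n k" for n k by (simp add: w_def d'(2))
  have wsum: "(\<Sum>k\<le>n. w n k) = d' 0 0" for n
    unfolding w_def by (rule binomial_weights_sum[of d', OF d'(1)])
  have step: "(\<Sum>k\<le>Suc n. real (Suc n choose k) * d k (Suc n - k) * (real k / real (Suc n)) ^ Suc j)
      = (\<Sum>k\<le>n. w n k * (real (Suc k) / real (Suc n)) ^ j)" for n
  proof -
    have c: "real (Suc n choose Suc k) * (real (Suc k) / real (Suc n)) = real (n choose k)" for k
    proof -
      have "real (Suc k) * real (Suc n choose Suc k) = real (Suc n) * real (n choose k)"
        by (metis Suc_times_binomial of_nat_mult)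
      then show ?thesis by (simp add: field_simps)
    qed
    have "(\<Sum>k\<le>Suc n. real (Suc n choose k) * d k (Suc n - k) * (real k / real (Suc n)) ^ Suc j)
      = (\<Sum>k\<le>n. real (Suc n choose Suc k) * d (Suc k) (n - k) * (real (Suc k) / real (Suc n)) ^ Suc j)"
      by (subst sum.atMost_Suc_shift) simp
    also have "\<dots> = (\<Sum>k\<le>n. (real (Suc n choose Suc k) * (real (Suc k) / real (Suc n))) * d' k (n - k)
        * (real (Suc k) / real (Suc n)) ^ j)"
      by (intro sum.cong) (auto simp: d'_def)
    finally show ?thesis unfolding c w_def .
  qed
  \<comment> \<open>The two nodes lie in [0, 1] and differ by (n - k) / (n (n + 1)), and taking the
    j-th power multiplies the distance by at most j.\<close>
  have close: "\<bar>(real (Suc k) / real (Suc n)) ^ j - (real k / real n) ^ j\<bar> \<le> real j / real (Suc n)"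
    if "k \<le> n" "0 < n" for k n
  proof -
    have "norm ((real (Suc k) / real (Suc n)) ^ j - (real k / real n) ^ j)
        \<le> j * norm (real (Suc k) / real (Suc n) - real k / real n)"
      using that by (intro norm_power_diff) auto
    moreover have "real (Suc k) / real (Suc n) - real k / real n = (real n - real k) / real n / real (Suc n)"
      using that by (simp add: field_simps)
    moreover have "\<bar>(real n - real k) / real n / real (Suc n)\<bar> \<le> 1 / real (Suc n)"
    proof -
      have "0 \<le> (real n - real k) / real n" "(real n - real k) / real n \<le> 1"
        using that by (auto simp: divide_le_eq_1)
      then show ?thesis by (simp only: abs_divide abs_of_nonneg of_nat_0_le_iff divide_right_mono)
    qed
    ultimately have "norm ((real (Suc k) / real (Suc n)) ^ j - (real k / real n) ^ j) \<le> j * (1 / real (Suc n))"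
      by (metis mult_left_mono of_nat_0_le_iff order_trans real_norm_def)
    then show ?thesis by simp
  qed
  have "(\<lambda>n. (\<Sum>k\<le>n. w n k * (real (Suc k) / real (Suc n)) ^ j) - (\<Sum>k\<le>n. w n k * (real k / real n) ^ j)) \<longlonglongrightarrow> 0"
  proof (rule Lim_null_comparison)
    show "\<forall>\<^sub>F n in sequentially. norm ((\<Sum>k\<le>n. w n k * (real (Suc k) / real (Suc n)) ^ j)
        - (\<Sum>k\<le>n. w n k * (real k / real n) ^ j)) \<le> d' 0 0 * real j * (1 / real (Suc n))"
      using eventually_gt_at_top[of 0]
    proof eventually_elim
      case (elim n)
      have "norm ((\<Sum>k\<le>n. w n k * (real (Suc k) / real (Suc n)) ^ j) - (\<Sum>k\<le>n. w n k * (real k / real n) ^ j))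
          = \<bar>\<Sum>k\<le>n. w n k * ((real (Suc k) / real (Suc n)) ^ j - (real k / real n) ^ j)\<bar>"
        by (simp add: sum_subtractf right_diff_distrib)
      also have "\<dots> \<le> (\<Sum>k\<le>n. \<bar>w n k * ((real (Suc k) / real (Suc n)) ^ j - (real k / real n) ^ j)\<bar>)"
        by (rule sum_abs)
      also have "\<dots> \<le> (\<Sum>k\<le>n. w n k * (real j / real (Suc n)))"
        using close elim w0 unfolding abs_mult by (intro sum_mono mult_mono) auto
      also have "\<dots> = d' 0 0 * real j * (1 / real (Suc n))"
        unfolding sum_distrib_right[symmetric] wsum by simp
      finally show ?case .
    qed
    show "(\<lambda>n. d' 0 0 * real j * (1 / real (Suc n))) \<longlonglongrightarrow> 0"
      using LIMSEQ_inverse_real_of_nat by (intro tendsto_mult_right_zero) (simp add: inverse_eq_divide)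
  qed
  from tendsto_add[OF this Suc.IH[of d', OF d']]
  have "(\<lambda>n. \<Sum>k\<le>n. w n k * (real (Suc k) / real (Suc n)) ^ j) \<longlonglongrightarrow> d' j 0"
    by (simp add: w_def)
  then show ?case unfolding step[symmetric] d'_def by (rule LIMSEQ_offset[where k = 1, simplified])
qed

text \<open>The measures with mass \<open>(n choose k) d k (n - k)\<close> at \<open>k / n\<close> have moments converging to
  \<open>d j 0\<close>, and Helly's theorem provides a limit point.\<close>

lemma hausdorff_moment:
  fixes d :: "nat \<Rightarrow> nat \<Rightarrow> real"
  assumes rec: "\<And>k l. d k l = d (Suc k) l + d k (Suc l)" and nn: "\<And>k l. 0 \<le> d k l" and 1: "d 0 0 = 1"
  shows "\<exists>M. prob_space M \<and> sets M = sets borel \<and> (AE l in M. 0 \<le> l \<and> l \<le> 1) \<and>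
    (\<forall>j. (\<integral>l. l ^ j \<partial>M) = d j 0)"
proof -
  define w where "w n k = real (n choose k) * d k (n - k)" for n k
  have w0: "0 \<le> w n k" for n k by (simp add: w_def nn)
  define P where "P n = point_measure {..n} (\<lambda>k. ennreal (w n k))" for n
  define \<nu> where "\<nu> n = distr (P n) borel (\<lambda>k. real k / real n)" for n
  have Pm [measurable]: "(\<lambda>k. real k / real n) \<in> borel_measurable (P m)" for n m
    by (simp add: P_def measurable_point_measure_eq1)
  have psP: "prob_space (P n)" for n
  proof (rule prob_spaceI)
    have "emeasure (P n) (space (P n)) = (\<Sum>k\<le>n. ennreal (w n k))"
      by (simp add: P_def space_point_measure emeasure_point_measure_finite)
    also have "\<dots> = ennreal (\<Sum>k\<le>n. w n k)" using w0 by simp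
    also have "(\<Sum>k\<le>n. w n k) = 1" unfolding w_def using binomial_weights_sum[of d, OF rec] 1 by simp
    finally show "emeasure (P n) (space (P n)) = 1" by simp
  qed
  have rd: "real_distribution (\<nu> n)" for n
    unfolding \<nu>_def by (rule prob_space.real_distribution_distr[OF psP Pm])
  have int: "(\<integral>l. f l \<partial>\<nu> n) = (\<Sum>k\<le>n. w n k * f (real k / real n))"
    if [measurable]: "f \<in> borel_measurable borel" for n and f :: "real \<Rightarrow> real"
    unfolding \<nu>_def
    by (subst integral_distr) (auto simp: P_def lebesgue_integral_point_measure_finite w0)
  have "tight \<nu>"
    unfolding tight_def
  proof (intro conjI allI impI rd)
    fix e :: real assume "0 < e"
    \<comment> \<open>The interval is open on the left, so it starts below 0 in order to contain the
      node 0; for n = 0 the only node is 0 / 0 = 0.\<close>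
    have "measure (\<nu> n) {-1<..1} = 1" for n
    proof -
      interpret P: prob_space "P n" by (rule psP)
      have "measure (\<nu> n) {-1<..1} = measure (P n) ((\<lambda>k. real k / real n) -` {-1<..1} \<inter> space (P n))"
        unfolding \<nu>_def by (rule measure_distr) auto
      also have "(\<lambda>k. real k / real n) -` {-1<..1} \<inter> space (P n) = space (P n)"
        by (auto simp: P_def space_point_measure divide_le_eq_1) (smt (verit) divide_nonneg_nonneg of_nat_0_le_iff)
      finally show ?thesis by (simp add: P.prob_space)
    qed
    then show "\<exists>a b. a < b \<and> (\<forall>n. 1 - e < measure (\<nu> n) {a<..b})"
      using \<open>0 < e\<close> by (intro exI[of _ "-1"] exI[of _ 1]) auto
  qed
  from tight_imp_convergent_subsubsequence[OF this strict_mono_id]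
  obtain r N where r: "strict_mono r" and N: "real_distribution N" and conv: "weak_conv_m (\<nu> \<circ> id \<circ> r) N"
    by blast
  \<comment> \<open>Weak convergence tests bounded continuous functions only, so the powers are
    taken after clamping to [0, 1], which moves no node. The final measure is the image of N under
    c; this places it on [0, 1] without locating the support of N.\<close>
  define c :: "real \<Rightarrow> real" where "c l = max 0 (min 1 l)" for l
  have c: "isCont (\<lambda>l. c l ^ j) l" for j l
    unfolding c_def by (intro continuous_intros)
  have cm [measurable]: "c \<in> borel_measurable borel" unfolding c_def[abs_def] by measurable
  have c01: "0 \<le> c l" "c l \<le> 1" for l by (auto simp: c_def)
  have mom: "(\<integral>l. c l ^ j \<partial>N) = d j 0" for j
  proof -
    have "(\<lambda>n. \<integral>l. c l ^ j \<partial>(\<nu> \<circ> id \<circ> r) n) \<longlonglongrightarrow> (\<integral>l. c l ^ j \<partial>N)"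
      using c01 by (intro weak_conv_imp_integral_bdd_continuous_conv[OF _ N conv, where B = 1])
        (auto intro: rd c power_le_one simp: power_abs)
    moreover have "(\<lambda>n. \<integral>l. c l ^ j \<partial>\<nu> n) = (\<lambda>n. \<Sum>k\<le>n. w n k * (real k / real n) ^ j)"
    proof
      fix n
      have "c (real k / real n) = real k / real n" if "k \<le> n" for k
        using that by (cases "n = 0") (auto simp: c_def min_def max_def field_simps)
      then show "(\<integral>l. c l ^ j \<partial>\<nu> n) = (\<Sum>k\<le>n. w n k * (real k / real n) ^ j)"
        by (subst int) (auto intro!: sum.cong)
    qed
    then have "(\<lambda>n. \<integral>l. c l ^ j \<partial>\<nu> n) \<longlonglongrightarrow> d j 0"
      using bernstein_moments_tendsto[of d j, OF rec nn] by (simp add: w_def)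
    from LIMSEQ_subseq_LIMSEQ[OF this r] have "(\<lambda>n. \<integral>l. c l ^ j \<partial>(\<nu> \<circ> id \<circ> r) n) \<longlonglongrightarrow> d j 0"
      by (simp add: o_def)
    ultimately show ?thesis using LIMSEQ_unique by blast
  qed
  interpret N: real_distribution N by (rule N)
  have "prob_space (distr N borel c)" by (rule N.prob_space_distr) simp
  moreover have "AE l in distr N borel c. 0 \<le> l \<and> l \<le> 1"
    using c01 by (subst AE_distr_iff) auto
  moreover have "(\<integral>l. l ^ j \<partial>distr N borel c) = d j 0" for j
    using mom by (subst integral_distr) auto
  ultimately show ?thesis by (intro exI[of _ "distr N borel c"]) auto
qed

section \<open>The resolvent of a nonnegative self-adjoint operator\<close>

text \<open>A sequence in S minimizing the distance to x is Cauchy by the parallelogram law, and x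
  minus its limit is orthogonal to S.\<close>

lemma orthogonal_vector_exists:
  fixes S :: "'a::{real_inner,complete_space} set"
  assumes S: "subspace S" "closed S" and x: "x \<notin> S"
  shows "\<exists>y. y \<noteq> 0 \<and> (\<forall>v\<in>S. inner v y = 0)"
proof -
  define d where "d = infdist x S"
  have ne: "S \<noteq> {}" using subspace_0[OF S(1)] by auto
  have d: "d \<le> norm (x - v)" if "v \<in> S" for v
    using infdist_le[OF that, of x] by (simp add: d_def dist_norm)
  have d0: "0 \<le> d" by (simp add: d_def infdist_nonneg)
  have "\<exists>v\<in>S. (norm (x - v))\<^sup>2 < d\<^sup>2 + 1 / real (Suc n)" for n
  proof (rule ccontr)
    assume "\<not> ?thesis"
    then have "sqrt (d\<^sup>2 + 1 / real (Suc n)) \<le> dist x v" if "v \<in> S" for v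
      using that by (intro real_le_lsqrt) (auto simp: dist_norm not_less)
    then have "sqrt (d\<^sup>2 + 1 / real (Suc n)) \<le> d"
      unfolding d_def infdist_notempty[OF ne] using ne by (intro cINF_greatest) auto
    then have "d\<^sup>2 + 1 / real (Suc n) \<le> d\<^sup>2"
      using d0 by (simp add: real_sqrt_le_iff' sqrt_le_D)
    then show False by simp
  qed
  then obtain v where v: "\<And>n. v n \<in> S" "\<And>n. (norm (x - v n))\<^sup>2 < d\<^sup>2 + 1 / real (Suc n)"
    by metis
  have par: "(norm (v m - v n))\<^sup>2 \<le> 2 / real (Suc m) + 2 / real (Suc n)" for m n
  proof -
    have "(1/2) *\<^sub>R (v m + v n) \<in> S"
      using v(1) S(1) by (intro subspace_scale subspace_add)
    then have "d\<^sup>2 \<le> (norm (x - (1/2) *\<^sub>R (v m + v n)))\<^sup>2"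
      using d d0 by (intro power_mono) auto
    also have "\<dots> = (1/2) * (norm (x - v m))\<^sup>2 + (1/2) * (norm (x - v n))\<^sup>2 - (1/4) * (norm (v m - v n))\<^sup>2"
      by (simp add: power2_norm_eq_inner inner_diff inner_add inner_commute algebra_simps)
    finally show ?thesis using v(2)[of m] v(2)[of n] by linarith
  qed
  have "Cauchy v"
  proof (rule metric_CauchyI)
    fix e :: real assume "0 < e"
    have "(\<lambda>n. 1 / real (Suc n)) \<longlonglongrightarrow> 0" using LIMSEQ_inverse_real_of_nat by (simp add: inverse_eq_divide)
    moreover have "0 < e\<^sup>2 / 4" using \<open>0 < e\<close> by simp
    ultimately have "\<forall>\<^sub>F n in sequentially. 1 / real (Suc n) < e\<^sup>2 / 4" by (rule order_tendstoD)
    then obtain N where N: "\<And>n. N \<le> n \<Longrightarrow> 1 / real (Suc n) < e\<^sup>2 / 4"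
      unfolding eventually_sequentially by blast
    have "dist (v m) (v n) < e" if "N \<le> m" "N \<le> n" for m n
    proof -
      have "(norm (v m - v n))\<^sup>2 < e\<^sup>2"
        using par[of m n] N[OF that(1)] N[OF that(2)] by linarith
      then show ?thesis using \<open>0 < e\<close> by (simp add: dist_norm power2_less_imp_less)
    qed
    then show "\<exists>N. \<forall>m\<ge>N. \<forall>n\<ge>N. dist (v m) (v n) < e" by blast
  qed
  then obtain u where u: "v \<longlonglongrightarrow> u" using Cauchy_convergent convergent_def by blast
  have uS: "u \<in> S" using closed_sequentially[OF S(2)] v(1) u by blast
  have "(norm (x - u))\<^sup>2 \<le> d\<^sup>2"
  proof (rule LIMSEQ_le)
    show "(\<lambda>n. (norm (x - v n))\<^sup>2) \<longlonglongrightarrow> (norm (x - u))\<^sup>2" by (intro tendsto_intros u)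
    have "(\<lambda>n. d\<^sup>2 + inverse (real (Suc n))) \<longlonglongrightarrow> d\<^sup>2 + 0"
      by (intro tendsto_add tendsto_const LIMSEQ_inverse_real_of_nat)
    then show "(\<lambda>n. d\<^sup>2 + 1 / real (Suc n)) \<longlonglongrightarrow> d\<^sup>2" by (simp add: inverse_eq_divide)
    show "\<exists>N. \<forall>n\<ge>N. (norm (x - v n))\<^sup>2 \<le> d\<^sup>2 + 1 / real (Suc n)" using v(2) less_imp_le by blast
  qed
  define y where "y = x - u"
  have "inner v y = 0" if "v \<in> S" for v
  proof -
    \<comment> \<open>Minimality of |y| along the line u + t v makes -2 t <y, v> + t^2 |v|^2
      nonnegative for all t: the discriminant lemma with constant term 0.\<close>
    have "(inner y v)\<^sup>2 \<le> 0 * (norm v)\<^sup>2"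
    proof (rule quadratic_form_discriminant)
      fix t
      have "d \<le> norm (x - (u + t *\<^sub>R v))"
        by (intro d subspace_add[OF S(1)] subspace_scale[OF S(1)] uS that)
      then have "d\<^sup>2 \<le> (norm (x - (u + t *\<^sub>R v)))\<^sup>2" using d0 by (intro power_mono)
      moreover have "x - (u + t *\<^sub>R v) = y - t *\<^sub>R v" by (simp add: y_def)
      ultimately have "(norm y)\<^sup>2 \<le> (norm (y - t *\<^sub>R v))\<^sup>2"
        using \<open>(norm (x - u))\<^sup>2 \<le> d\<^sup>2\<close> unfolding y_def by (metis order_trans)
      also have "\<dots> = (norm y)\<^sup>2 - 2 * t * inner y v + t\<^sup>2 * (norm v)\<^sup>2"
        by (simp add: power2_norm_eq_inner inner_diff inner_commute power2_eq_square[of t] algebra_simps)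
      finally show "0 \<le> 0 - 2 * t * inner y v + t\<^sup>2 * (norm v)\<^sup>2" by simp
    qed simp
    then show ?thesis by (simp add: inner_commute)
  qed
  moreover have "y \<noteq> 0" using x uS by (auto simp: y_def)
  ultimately show ?thesis by blast
qed

lemma nonneg_selfadjoint_sym:
  assumes "nonneg_selfadjoint A" "x \<in> fst A" "y \<in> fst A"
  shows "inner (snd A x) y = inner x (snd A y)"
proof -
  have "(y, snd A y) \<in> adjoint_graph A"
    using assms by (auto simp: nonneg_selfadjoint_def selfadjoint_def op_graph_def)
  then show ?thesis using assms(2) by (simp add: adjoint_graph_def)
qed

lemma
  assumes "nonneg_selfadjoint A"
  shows nonneg_selfadjoint_subspace: "subspace (fst A)"
    and nonneg_selfadjoint_add: "u \<in> fst A \<Longrightarrow> v \<in> fst A \<Longrightarrow> snd A (u + v) = snd A u + snd A v"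
    and nonneg_selfadjoint_scale: "u \<in> fst A \<Longrightarrow> snd A (c *\<^sub>R u) = c *\<^sub>R snd A u"
    and nonneg_selfadjoint_inner: "u \<in> fst A \<Longrightarrow> 0 \<le> inner u (snd A u)"
  using assms by (auto simp: nonneg_selfadjoint_def selfadjoint_def linear_op_def)

lemma adjoint_graphD:
  assumes "nonneg_selfadjoint A" "(y, z) \<in> adjoint_graph A"
  shows "y \<in> fst A" "snd A y = z"
  using assms by (auto simp: nonneg_selfadjoint_def selfadjoint_def op_graph_def)

text \<open>The range of 1 + A is closed, because 1 + A does not decrease norms and the graph of A,
  being an adjoint graph, is closed. A vector u orthogonal to the range has (u, -u) in the adjoint
  graph, so A u = -u, and nonnegativity forces u = 0.\<close>

lemma nonneg_selfadjoint_resolvent: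
  fixes A :: "('a::{real_inner,complete_space}) lin_op"
  assumes A: "nonneg_selfadjoint A"
  shows "\<exists>x\<in>fst A. x + snd A x = y"
proof -
  note sub = nonneg_selfadjoint_subspace[OF A] and Ladd = nonneg_selfadjoint_add[OF A]
    and Lscale = nonneg_selfadjoint_scale[OF A] and pos = nonneg_selfadjoint_inner[OF A]
  define R where "R = (\<lambda>u. u + snd A u) ` fst A"
  have subR: "subspace R"
    unfolding subspace_def
  proof (intro conjI ballI allI)
    have "0 \<in> fst A" using sub by (rule subspace_0)
    moreover have "snd A 0 = 0" using Lscale[of 0 0] subspace_0[OF sub] by simp
    ultimately show "0 \<in> R" unfolding R_def by force
    show "u + v \<in> R" if uv: "u \<in> R" "v \<in> R" for u v
    proof -
      obtain u' v' where "u' \<in> fst A" "u = u' + snd A u'" "v' \<in> fst A" "v = v' + snd A v'"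
        using uv unfolding R_def by blast
      then have "u' + v' \<in> fst A" "u + v = (u' + v') + snd A (u' + v')"
        using subspace_add[OF sub] Ladd by (auto simp: algebra_simps)
      then show ?thesis unfolding R_def by blast
    qed
    show "c *\<^sub>R u \<in> R" if u: "u \<in> R" for c u
    proof -
      obtain u' where "u' \<in> fst A" "u = u' + snd A u'" using u unfolding R_def by blast
      then have "c *\<^sub>R u' \<in> fst A" "c *\<^sub>R u = c *\<^sub>R u' + snd A (c *\<^sub>R u')"
        using subspace_scale[OF sub] Lscale by (auto simp: algebra_simps)
      then show ?thesis unfolding R_def by blast
    qed
  qed
  have contr: "norm (u - v) \<le> norm ((u + snd A u) - (v + snd A v))" if uv: "u \<in> fst A" "v \<in> fst A" for u v
  proof -
    have w: "u - v \<in> fst A" by (rule subspace_diff[OF sub uv])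
    have "snd A (u - v) = snd A u - snd A v"
      using Ladd[OF w uv(2)] by (simp add: algebra_simps)
    then have eq: "(u + snd A u) - (v + snd A v) = (u - v) + snd A (u - v)" by simp
    have "(norm (u - v))\<^sup>2 \<le> inner (u - v) ((u - v) + snd A (u - v))"
      using pos[OF w] by (simp add: inner_add_right power2_norm_eq_inner)
    also have "\<dots> \<le> norm (u - v) * norm ((u - v) + snd A (u - v))"
      by (rule norm_cauchy_schwarz)
    finally show ?thesis unfolding eq
      by (metis linorder_not_le mult_le_cancel_left_pos norm_ge_zero order.trans power2_eq_square order_less_le)
  qed
  have clR: "closed R"
  proof (unfold closed_sequential_limits, intro allI impI, elim conjE)
    fix f l assume f: "\<forall>n. f n \<in> R" and l: "f \<longlonglongrightarrow> l"
    then obtain g where g: "\<And>n. g n \<in> fst A" "\<And>n. f n = g n + snd A (g n)"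
      unfolding R_def image_iff by metis
    have "Cauchy g"
    proof (rule metric_CauchyI)
      fix e :: real assume "0 < e"
      have "Cauchy f" using l by (rule LIMSEQ_imp_Cauchy)
      from metric_CauchyD[OF this \<open>0 < e\<close>] obtain N where N: "\<forall>m\<ge>N. \<forall>n\<ge>N. dist (f m) (f n) < e" by blast
      have "dist (g m) (g n) \<le> dist (f m) (f n)" for m n
        using contr[OF g(1) g(1), of m n] by (simp add: dist_norm g(2))
      then show "\<exists>N. \<forall>m\<ge>N. \<forall>n\<ge>N. dist (g m) (g n) < e" using N order_le_less_trans by blast
    qed
    then obtain x where x: "g \<longlonglongrightarrow> x" using Cauchy_convergent convergent_def by blast
    have "(x, l - x) \<in> adjoint_graph A"
      unfolding adjoint_graph_def
    proof (clarsimp)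
      fix v assume v: "v \<in> fst A"
      have "(\<lambda>n. inner v (f n - g n)) \<longlonglongrightarrow> inner v (l - x)" by (intro tendsto_intros l x)
      moreover have "inner v (f n - g n) = inner (snd A v) (g n)" for n
        using nonneg_selfadjoint_sym[OF A v g(1)] g(2) by simp
      moreover have "(\<lambda>n. inner (snd A v) (g n)) \<longlonglongrightarrow> inner (snd A v) x" by (intro tendsto_intros x)
      ultimately show "inner (snd A v) x = inner v (l - x)" using LIMSEQ_unique by simp
    qed
    from adjoint_graphD[OF A this] have "x \<in> fst A" "l = x + snd A x" by auto
    then show "l \<in> R" unfolding R_def by blast
  qed
  have "y \<in> R"
  proof (rule ccontr)
    assume "y \<notin> R"
    from orthogonal_vector_exists[OF subR clR this]
    obtain u where u: "u \<noteq> 0" "\<And>v. v \<in> R \<Longrightarrow> inner v u = 0" by blast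
    have "(u, - u) \<in> adjoint_graph A"
      unfolding adjoint_graph_def
    proof (clarsimp)
      fix v assume "v \<in> fst A"
      then have "inner (v + snd A v) u = 0" by (intro u) (auto simp: R_def)
      then show "inner (snd A v) u = - inner v u" by (simp add: inner_add_left)
    qed
    from adjoint_graphD[OF A this] pos[of u] have "inner u u \<le> 0" by simp
    moreover have "0 < inner u u" using u(1) by (rule inner_gt_zero_iff[THEN iffD2])
    ultimately show False by linarith
  qed
  then show ?thesis unfolding R_def by blast
qed

section \<open>The spectral measure of a positive contraction\<close>

text \<open>Strong countable additivity comes from L2 convergence of the indicators of finite
  unions; it makes the image of the moment calculus a projection-valued measure.\<close>

lemma (in op_calculus) \<Phi>_indicator_sums:
  fixes F :: "nat \<Rightarrow> real set"
  assumes F: "range F \<subseteq> sets borel" "disjoint_family F"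
  shows "(\<lambda>n. \<Phi> (indicator (F n)) x) sums \<Phi> (indicator (\<Union>n. F n)) x"
proof -
  have Fb: "F n \<in> sets borel" "(\<Union>i<n. F i) \<in> sets borel" "(\<Union>n. F n) \<in> sets borel" for n
    using F by auto
  have part: "(\<Sum>i<n. \<Phi> (indicator (F i)) x) = \<Phi> (indicator (\<Union>i<n. F i)) x" for n
  proof (induction n)
    case 0
    show ?case using \<Phi>_const[of 0 x] by simp
  next
    case (Suc n)
    show ?case
      using Suc.IH Fb by (simp add: indicator_UN_lessThan_Suc[OF F(2)] \<Phi>_add ess_bdd_sq_int ess_bdd_indicator)
  qed
  have "(\<lambda>n. \<Phi> (indicator (\<Union>i<n. F i)) x) \<longlonglongrightarrow> \<Phi> (indicator (\<Union>n. F n)) x"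
    by (rule \<Phi>_tendsto[OF _ _ l2_indicator_UN]) (use Fb in \<open>auto intro: ess_bdd_sq_int ess_bdd_indicator\<close>)
  then show ?thesis by (simp add: sums_def part)
qed

section \<open>Polynomials in a positive contraction and their moment measures\<close>

inductive_set poly_calculus :: "('a \<Rightarrow> 'a::real_vector) \<Rightarrow> ((real \<Rightarrow> real) \<times> ('a \<Rightarrow> 'a)) set"
  for B where
    one: "(\<lambda>_. 1, \<lambda>x. x) \<in> poly_calculus B"
  | var: "(f, R) \<in> poly_calculus B \<Longrightarrow> (\<lambda>l. l * f l, \<lambda>x. B (R x)) \<in> poly_calculus B"
  | add: "(f, R) \<in> poly_calculus B \<Longrightarrow> (g, S) \<in> poly_calculus B \<Longrightarrow>
      (\<lambda>l. f l + g l, \<lambda>x. R x + S x) \<in> poly_calculus B"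
  | scale: "(f, R) \<in> poly_calculus B \<Longrightarrow> (\<lambda>l. c * f l, \<lambda>x. c *\<^sub>R R x) \<in> poly_calculus B"

text \<open>The inequality says B^2 <= B as forms. It contains 0 <= B, since <B x, B x> is
  nonnegative, and hence encodes 0 <= B <= 1.\<close>

locale pos_contraction =
  fixes B :: "'a \<Rightarrow> 'a::{real_inner,complete_space}"
  assumes lin: "linear B" and sym: "inner (B x) y = inner x (B y)"
    and contraction: "inner (B x) (B x) \<le> inner x (B x)"
begin

definition C :: "'a \<Rightarrow> 'a" where "C x = x - B x"

lemma C_sym: "inner (C x) y = inner x (C y)"
  by (simp add: C_def inner_diff sym)

lemma B_C: "B (C x) = C (B x)"
  by (simp add: C_def linear_diff[OF lin])

lemma B_C_pow: "B ((C ^^ n) x) = (C ^^ n) (B x)"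
  by (induction n arbitrary: x) (auto simp: B_C)

lemma B_pow_C: "(B ^^ k) (C x) = C ((B ^^ k) x)"
  by (induction k arbitrary: x) (auto simp: B_C)

text \<open>B and C are symmetric and commute, so two equal factors can be moved to the two sides of
  the form. This reduces both exponents below 2 and leaves the forms of 1, B, C and B C, the last
  one being the contraction inequality. These are the nonnegativity conditions of the Hausdorff
  problem.\<close>

lemma bernstein_form_nonneg: "0 \<le> inner x ((B ^^ k) ((C ^^ n) x))"
proof -
  have shiftB: "inner x ((B ^^ Suc (Suc k)) ((C ^^ n) x)) = inner (B x) ((B ^^ k) ((C ^^ n) (B x)))" for k n x
  proof -
    have "(B ^^ Suc (Suc k)) z = B ((B ^^ k) (B z))" for z by (simp add: funpow_swap1)
    then show ?thesis by (simp only: sym[symmetric, of x] B_C_pow)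
  qed
  have shiftC: "inner x ((B ^^ k) ((C ^^ Suc (Suc n)) x)) = inner (C x) ((B ^^ k) ((C ^^ n) (C x)))" for k n x
  proof -
    have "(C ^^ Suc (Suc n)) x = C ((C ^^ n) (C x))" by (simp add: funpow_swap1)
    then show ?thesis by (simp only: B_pow_C C_sym[symmetric, of x])
  qed
  have B0: "0 \<le> inner x (B x)" for x
    using contraction[of x] inner_ge_zero[of "B x"] by linarith
  have base: "0 \<le> inner x ((B ^^ k) ((C ^^ n) x))" if "k < 2" for k n x
    using that
  proof (induction n arbitrary: x rule: less_induct)
    case (less n)
    show ?case
    proof (cases "n < 2")
      case True
      have "(norm (B x))\<^sup>2 \<le> (norm x)\<^sup>2"
        using contraction[of x] norm_cauchy_schwarz[of x "B x"]
        by (smt (verit) mult_le_cancel_right norm_ge_zero power2_eq_square power2_norm_eq_inner power_mono)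
      moreover have "inner x (B x) \<le> (norm x)\<^sup>2"
        using norm_cauchy_schwarz[of x "B x"] calculation
        by (smt (verit) mult_left_mono norm_ge_zero power2_eq_square power2_le_imp_le)
      ultimately have C0: "0 \<le> inner x (C x)" by (simp add: C_def inner_diff power2_norm_eq_inner)
      have BC0: "0 \<le> inner x (B (C x))"
        using contraction[of x] by (simp add: C_def linear_diff[OF lin] inner_diff sym)
      have "k = 0 \<or> k = 1" "n = 0 \<or> n = 1" using less.prems True by auto
      then show ?thesis using B0 C0 BC0 by auto
    next
      case False
      then obtain m where m: "n = Suc (Suc m)" by (metis add_2_eq_Suc le_Suc_ex not_less)
      show ?thesis unfolding m shiftC using less m by auto
    qed
  qed
  show ?thesis
  proof (induction k arbitrary: x rule: less_induct)
    case (less k)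
    show ?case
    proof (cases "k < 2")
      case True
      then show ?thesis by (rule base)
    next
      case False
      then obtain m where m: "k = Suc (Suc m)" by (metis add_2_eq_Suc le_Suc_ex not_less)
      show ?thesis unfolding m shiftB using less m by auto
    qed
  qed
qed

lemma moment_measure_exists:
  "\<exists>N. finite_measure N \<and> sets N = sets borel \<and> (AE l in N. 0 \<le> l \<and> l \<le> 1) \<and>
    (\<forall>k. (\<integral>l. l ^ k \<partial>N) = inner x ((B ^^ k) x))"
proof (cases "x = 0")
  case True
  have "finite_measure (null_measure borel :: real measure)"
    by (intro finite_measureI) simp
  moreover have "(\<integral>l. l ^ k \<partial>(null_measure borel :: real measure)) = 0" for k
    by simp
  moreover have "AE l in (null_measure borel :: real measure). 0 \<le> l \<and> l \<le> 1"
    by (rule AE_I'[of UNIV]) (auto simp: null_sets_def)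
  ultimately show ?thesis using True by (intro exI[of _ "null_measure borel"]) auto
next
  case False
  \<comment> \<open>Division by |x|^2 gives the total mass 1 that the moment theorem asks for; the
    density \<open>N'\<close> multiplies it back.\<close>
  define d where "d k n = inner x ((B ^^ k) ((C ^^ n) x)) / (norm x)\<^sup>2" for k n
  have "d k l = d (Suc k) l + d k (Suc l)" for k l
  proof -
    have "(B ^^ k) ((C ^^ l) x) = (B ^^ k) (B ((C ^^ l) x) + C ((C ^^ l) x))" by (simp add: C_def)
    also have "\<dots> = (B ^^ k) (B ((C ^^ l) x)) + (B ^^ k) (C ((C ^^ l) x))"
      by (induction k) (auto simp: linear_add[OF lin])
    also have "\<dots> = (B ^^ Suc k) ((C ^^ l) x) + (B ^^ k) ((C ^^ Suc l) x)"
      by (simp add: funpow_swap1)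
    finally show ?thesis
      unfolding d_def by (simp only: inner_add_right add_divide_distrib)
  qed
  moreover have "0 \<le> d k n" for k n unfolding d_def using bernstein_form_nonneg by simp
  moreover have "d 0 0 = 1" using False by (simp add: d_def power2_norm_eq_inner)
  ultimately obtain N where N: "prob_space N" "sets N = sets borel" "AE l in N. 0 \<le> l \<and> l \<le> 1"
    "\<And>j. (\<integral>l. l ^ j \<partial>N) = d j 0"
    using hausdorff_moment[of d] by blast
  interpret prob_space N by (rule N(1))
  define N' where "N' = density N (\<lambda>_. ennreal ((norm x)\<^sup>2))"
  have "finite_measure N'"
    unfolding N'_def using emeasure_space_1
    by (intro finite_measureI) (simp add: emeasure_density_const ennreal_mult_eq_top_iff)
  moreover have "sets N' = sets borel" by (simp add: N'_def N(2))
  moreover have "AE l in N'. 0 \<le> l \<and> l \<le> 1"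
    unfolding N'_def using N(3) by (subst AE_density) auto
  moreover have "(\<integral>l. l ^ k \<partial>N') = inner x ((B ^^ k) x)" for k
  proof -
    have [measurable_cong]: "sets N = sets borel" by (rule N(2))
    have "(\<integral>l. l ^ k \<partial>N') = (\<integral>l. (norm x)\<^sup>2 *\<^sub>R l ^ k \<partial>N)"
      unfolding N'_def by (intro integral_density) auto
    also have "\<dots> = (norm x)\<^sup>2 * d k 0" using N(4) by simp
    finally show ?thesis using False by (simp add: d_def)
  qed
  ultimately show ?thesis by blast
qed

definition moment_measure :: "'a \<Rightarrow> real measure" where
  "moment_measure x = (SOME N. finite_measure N \<and> sets N = sets borel \<and> (AE l in N. 0 \<le> l \<and> l \<le> 1) \<and>
    (\<forall>k. (\<integral>l. l ^ k \<partial>N) = inner x ((B ^^ k) x)))"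

lemma
  shows finite_moment_measure: "finite_measure (moment_measure x)"
    and sets_moment_measure [simp, measurable_cong]: "sets (moment_measure x) = sets borel"
    and AE_moment_measure: "AE l in moment_measure x. 0 \<le> l \<and> l \<le> 1"
    and moments: "(\<integral>l. l ^ k \<partial>moment_measure x) = inner x ((B ^^ k) x)"
  using someI_ex[OF moment_measure_exists[of x]] unfolding moment_measure_def by auto

lemma poly_calculus_bounded:
  "(f, R) \<in> poly_calculus B \<Longrightarrow>
    f \<in> borel_measurable borel \<and> (\<exists>K\<ge>0. \<forall>l. 0 \<le> l \<longrightarrow> l \<le> 1 \<longrightarrow> \<bar>f l\<bar> \<le> K)"
proof (induction f R rule: poly_calculus.induct)
  case one
  show ?case by (auto intro!: exI[of _ 1])
next
  case (var f R)
  then obtain K where K: "0 \<le> K" "\<And>l. 0 \<le> l \<Longrightarrow> l \<le> 1 \<Longrightarrow> \<bar>f l\<bar> \<le> K" by auto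
  have "\<bar>l * f l\<bar> \<le> K" if "0 \<le> l" "l \<le> 1" for l
    using K(2)[OF that] mult_mono[of "\<bar>l\<bar>" 1 "\<bar>f l\<bar>" K] that by (simp add: abs_mult)
  then show ?case using var K by auto
next
  case (add f R g S)
  then obtain K L where K: "0 \<le> K" "\<And>l. 0 \<le> l \<Longrightarrow> l \<le> 1 \<Longrightarrow> \<bar>f l\<bar> \<le> K"
    and L: "0 \<le> L" "\<And>l. 0 \<le> l \<Longrightarrow> l \<le> 1 \<Longrightarrow> \<bar>g l\<bar> \<le> L" by auto
  have "\<bar>f l + g l\<bar> \<le> K + L" if "0 \<le> l" "l \<le> 1" for l
    using K(2)[OF that] L(2)[OF that] by linarith
  then show ?case using add K L by (intro conjI exI[of _ "K + L"]) auto
next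
  case (scale f R c)
  then obtain K where K: "0 \<le> K" "\<And>l. 0 \<le> l \<Longrightarrow> l \<le> 1 \<Longrightarrow> \<bar>f l\<bar> \<le> K" by auto
  have "\<bar>c * f l\<bar> \<le> \<bar>c\<bar> * K" if "0 \<le> l" "l \<le> 1" for l
    using K(2)[OF that] by (simp add: abs_mult mult_left_mono)
  then show ?case using scale K by (intro conjI exI[of _ "\<bar>c\<bar> * K"]) auto
qed

lemma poly_calculus_linear: "(f, R) \<in> poly_calculus B \<Longrightarrow> linear R"
proof (induction f R rule: poly_calculus.induct)
  case one
  show ?case by (rule linear_id[unfolded id_def])
next
  case (var f R)
  then show ?case using linear_compose[OF var.IH lin] by (simp add: o_def)
qed (auto intro: linear_compose_add linear_compose_scale_right)

lemma poly_calculus_commute: "(f, R) \<in> poly_calculus B \<Longrightarrow> R (B x) = B (R x)"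
  by (induction f R rule: poly_calculus.induct) (auto simp: linear_add[OF lin] linear_scale[OF lin])

lemma poly_calculus_integrable:
  assumes "(f, R) \<in> poly_calculus B"
  shows "integrable (moment_measure x) (\<lambda>l. l ^ k * f l)"
proof -
  interpret finite_measure "moment_measure x" by (rule finite_moment_measure)
  obtain K where K: "0 \<le> K" "\<And>l. 0 \<le> l \<Longrightarrow> l \<le> 1 \<Longrightarrow> \<bar>f l\<bar> \<le> K"
    and [measurable]: "f \<in> borel_measurable borel"
    using poly_calculus_bounded[OF assms] by auto
  have "AE l in moment_measure x. norm (l ^ k * f l) \<le> K"
    using AE_moment_measure
  proof eventually_elim
    case (elim l)
    then have "\<bar>l ^ k\<bar> * \<bar>f l\<bar> \<le> 1 * K"
      using K(2)[of l] by (intro mult_mono) (auto simp: power_abs intro: power_le_one)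
    then show ?case by (simp add: abs_mult)
  qed
  then show ?thesis by (intro integrable_const_bound[where B = K]) auto
qed

text \<open>The free power of B makes the induction close: a factor l of the polynomial is traded
  for one more power. The calculus uses the case k = 0.\<close>

lemma poly_calculus_inner:
  "(f, R) \<in> poly_calculus B \<Longrightarrow> inner x ((B ^^ k) (R x)) = (\<integral>l. l ^ k * f l \<partial>moment_measure x)"
proof (induction f R arbitrary: k rule: poly_calculus.induct)
  case one
  show ?case by (simp add: moments)
next
  case (var f R)
  have "inner x ((B ^^ Suc k) (R x)) = (\<integral>l. l ^ Suc k * f l \<partial>moment_measure x)" by (rule var.IH)
  then show ?case by (simp add: funpow_swap1 mult.left_commute mult.assoc)
next
  case (add f R g S)
  have "(B ^^ k) (R x + S x) = (B ^^ k) (R x) + (B ^^ k) (S x)"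
    by (induction k) (auto simp: linear_add[OF lin])
  then show ?case
    using add.IH[of k] poly_calculus_integrable[OF add.hyps(1)] poly_calculus_integrable[OF add.hyps(2)]
    by (simp add: inner_add_right distrib_left)
next
  case (scale f R c)
  have "(B ^^ k) (c *\<^sub>R R x) = c *\<^sub>R (B ^^ k) (R x)"
    by (induction k) (auto simp: linear_scale[OF lin])
  then show ?case using scale.IH[of k] by (simp add: mult.left_commute)
qed

lemma poly_calculus_mult:
  assumes "(f, R) \<in> poly_calculus B" "(g, S) \<in> poly_calculus B"
  shows "(\<lambda>l. f l * g l, \<lambda>x. R (S x)) \<in> poly_calculus B"
  using assms(1)
proof (induction f R rule: poly_calculus.induct)
  case one
  show ?case using assms(2) by simp
next
  case (var f R)
  then show ?case using poly_calculus.var[OF var.IH] by (simp add: mult.assoc)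
next
  case (add f R f' R')
  then show ?case using poly_calculus.add[OF add.IH] by (simp add: distrib_right)
next
  case (scale f R c)
  then show ?case using poly_calculus.scale[OF scale.IH, of c] by (simp add: mult.assoc)
qed

sublocale op_algebra "poly_calculus B" moment_measure
proof (rule op_algebra.intro)
  show "finite_measure (moment_measure x)" for x by (rule finite_moment_measure)
  show "(\<lambda>_. 1, \<lambda>x. x) \<in> poly_calculus B" by (rule poly_calculus.one)
  fix f g R S assume f: "(f, R) \<in> poly_calculus B"
  show "f \<in> borel_measurable borel" using poly_calculus_bounded[OF f] by blast
  show "\<exists>K. \<forall>x. AE l in moment_measure x. \<bar>f l\<bar> \<le> K"
  proof -
    obtain K where K: "\<And>l. 0 \<le> l \<Longrightarrow> l \<le> 1 \<Longrightarrow> \<bar>f l\<bar> \<le> K"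
      using poly_calculus_bounded[OF f] by auto
    have "AE l in moment_measure x. \<bar>f l\<bar> \<le> K" for x
      using AE_moment_measure by eventually_elim (use K in auto)
    then show ?thesis by blast
  qed
  show "(\<lambda>l. c * f l, \<lambda>x. c *\<^sub>R R x) \<in> poly_calculus B" for c
    by (rule poly_calculus.scale[OF f])
  show "linear R" by (rule poly_calculus_linear[OF f])
  show "inner (R x) y = inner x (R y)" for x y using f
  proof (induction f R arbitrary: x y rule: poly_calculus.induct)
    case (var f R)
    then show ?case using poly_calculus_commute[OF var.hyps] by (simp add: sym)
  qed (auto simp: inner_add)
  show "inner x (R x) = (\<integral>l. f l \<partial>moment_measure x)" for x
    using poly_calculus_inner[OF f, of x 0] by simp
  assume g: "(g, S) \<in> poly_calculus B"
  show "(\<lambda>l. f l + g l, \<lambda>x. R x + S x) \<in> poly_calculus B"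
    by (rule poly_calculus.add[OF f g])
  show "(\<lambda>l. f l * g l, \<lambda>x. R (S x)) \<in> poly_calculus B"
    by (rule poly_calculus_mult[OF f g])
qed simp

section \<open>Density of the polynomials in L2 of the moment measures\<close>

definition is_poly :: "(real \<Rightarrow> real) \<Rightarrow> bool" where
  "is_poly f \<longleftrightarrow> (\<exists>R. (f, R) \<in> poly_calculus B)"

lemma is_poly_const: "is_poly (\<lambda>_. c)"
  using poly_calculus.scale[OF poly_calculus.one, where c = c] by (auto simp: is_poly_def)

lemma is_poly_id: "is_poly (\<lambda>l. l)"
  using poly_calculus.var[OF poly_calculus.one] by (auto simp: is_poly_def)

lemma is_poly_add: "is_poly f \<Longrightarrow> is_poly g \<Longrightarrow> is_poly (\<lambda>l. f l + g l)"
  using poly_calculus.add by (auto simp: is_poly_def) blast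

lemma is_poly_mult: "is_poly f \<Longrightarrow> is_poly g \<Longrightarrow> is_poly (\<lambda>l. f l * g l)"
  using poly_calculus_mult by (auto simp: is_poly_def) blast

lemma is_poly_power: "is_poly f \<Longrightarrow> is_poly (\<lambda>l. f l ^ n)"
  by (induction n) (auto intro: is_poly_const is_poly_mult)

lemma is_poly_sum: "(\<And>i. i \<in> I \<Longrightarrow> is_poly (f i)) \<Longrightarrow> is_poly (\<lambda>l. \<Sum>i\<in>I. f i l)"
  by (induction I rule: infinite_finite_induct) (auto intro: is_poly_const is_poly_add)

lemma is_poly_Bernstein: "is_poly (Bernstein n k)"
proof -
  have "is_poly (\<lambda>l. 1 - l)"
    using is_poly_add[OF is_poly_const[of 1] is_poly_mult[OF is_poly_const[of "-1"] is_poly_id]] by simp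
  then show ?thesis
    unfolding Bernstein_def[abs_def]
    by (intro is_poly_mult is_poly_power is_poly_const is_poly_id)
qed

text \<open>Weierstrass approximation with uniform error d on [0, 1]. The measure of x has total
  mass |x|^2, so the L2 error is at most d |x|, and K bounds |x| on F.\<close>

lemma approximable_continuous:
  assumes F: "finite F" and f: "continuous_on {0..1} f" "f \<in> borel_measurable borel"
  shows "approximable F f"
  unfolding approximable_def
proof (intro allI impI)
  fix e :: real assume "0 < e"
  define K where "K = (\<Sum>x\<in>F. norm x)"
  have K: "norm x \<le> K" if "x \<in> F" for x
    unfolding K_def using F that by (intro member_le_sum) auto
  have "0 \<le> K" unfolding K_def by (rule sum_nonneg) simp
  define d where "d = e / (K + 1)"
  have d: "0 < d" "d * K < e" using \<open>0 < e\<close> \<open>0 \<le> K\<close> by (auto simp: d_def field_simps)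
  obtain N where N: "\<And>x. x \<in> {0..1} \<Longrightarrow> \<bar>f x - (\<Sum>k\<le>N. f (real k / real N) * Bernstein N k x)\<bar> < d"
    using Bernstein_Weierstrass[OF f(1) d(1)] by blast
  define p where "p x = (\<Sum>k\<le>N. f (real k / real N) * Bernstein N k x)" for x
  have "is_poly p"
    unfolding p_def[abs_def] by (intro is_poly_sum is_poly_mult is_poly_const is_poly_Bernstein)
  then obtain R where R: "(p, R) \<in> poly_calculus B" by (auto simp: is_poly_def)
  have "l2 (moment_measure x) (\<lambda>l. p l - f l) < e" if x: "x \<in> F" for x
  proof -
    have "AE l in moment_measure x. \<bar>p l - f l\<bar> \<le> \<bar>d * 1\<bar>"
      using AE_moment_measure[of x]
    proof eventually_elim
      case (elim l)
      then show ?case using N[of l] d(1) by (auto simp: p_def)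
    qed
    then have "l2 (moment_measure x) (\<lambda>l. p l - f l) \<le> l2 (moment_measure x) (\<lambda>l. d * 1)"
      using f(2) \<T>_measurable[OF R]
      by (intro l2_mono sq_int_scale[OF \<T>_sq_int[OF \<T>_one]]) auto
    also have "\<dots> = d * norm x"
      using l2_scale[of "moment_measure x" d "\<lambda>_. 1"] \<T>_norm[OF \<T>_one, of x] d by simp
    also have "\<dots> \<le> d * K" using K[OF x] d by (intro mult_left_mono) auto
    finally show ?thesis using d by simp
  qed
  then show "\<exists>(g, R)\<in>poly_calculus B. \<forall>x\<in>F. l2 (moment_measure x) (\<lambda>l. g l - f l) < e"
    using R by blast
qed

lemma sq_int_le_one:
  assumes "f \<in> borel_measurable borel" "\<And>l. \<bar>f l\<bar> \<le> 1" shows "sq_int (moment_measure x) f"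
  by (rule sq_int_bound[OF \<T>_sq_int[OF \<T>_one]]) (use assms in auto)

text \<open>The functions \<open>g n\<close> are 1 up to a and fall linearly to 0 on an interval of
  length 1 / n, so they converge to the indicator at every point, including a.\<close>

lemma approximable_atMost:
  assumes F: "finite F"
  shows "approximable F (indicator {..a})"
proof -
  define g where "g n l = max 0 (min 1 (1 - real n * (l - a)))" for n l
  have gm: "g n \<in> borel_measurable borel" for n unfolding g_def[abs_def] by measurable
  have g1: "\<bar>g n l\<bar> \<le> 1" for n l by (auto simp: g_def)
  have i1: "\<bar>indicator {..a} l :: real\<bar> \<le> 1" for l by (auto simp: indicator_def)
  have lim: "(\<lambda>n. g n l) \<longlonglongrightarrow> indicator {..a} l" for l
  proof (rule tendsto_eventually)
    show "\<forall>\<^sub>F n in sequentially. g n l = indicator {..a} l"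
    proof (cases "l \<le> a")
      case True
      then have "g n l = 1" for n by (auto simp: g_def min_def max_def mult_nonneg_nonpos)
      then show ?thesis using True by simp
    next
      case False
      obtain N where N: "1 / (l - a) \<le> real N" using real_arch_simple by blast
      have "g n l = 0" if "N \<le> n" for n
      proof -
        have "1 / (l - a) \<le> real n" using N that by simp
        then have "1 \<le> real n * (l - a)" using False by (simp add: divide_le_eq)
        then show ?thesis by (auto simp: g_def)
      qed
      then show ?thesis using False by (auto simp: eventually_sequentially)
    qed
  qed
  have ab: "\<bar>g n l - indicator {..a} l\<bar> \<le> \<bar>1\<bar>" for n l
    by (auto simp: g_def indicator_def)
  show ?thesis
  proof (rule approximable_limit[OF F])
    show "approximable F (g n)" for n
    proof (rule approximable_continuous[OF F _ gm])
      show "continuous_on {0..1} (g n)" unfolding g_def[abs_def] by (intro continuous_intros)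
    qed
    show "sq_int (moment_measure x) (g n)" for x n by (rule sq_int_le_one[OF gm g1])
    show "sq_int (moment_measure x) (indicator {..a})" for x by (rule sq_int_le_one[OF _ i1]) simp
    show "(\<lambda>n. l2 (moment_measure x) (\<lambda>l. g n l - indicator {..a} l)) \<longlonglongrightarrow> 0" for x
      by (rule l2_dominated_convergence[OF \<T>_sq_int[OF \<T>_one]]) (use gm lim ab in auto)
  qed
qed

text \<open>Dynkin's pi-lambda argument from closed half-lines, which are stable under intersection
  and generate the Borel sets.\<close>

lemma approximable_indicator:
  assumes F: "finite F" and S: "S \<in> sets borel"
  shows "approximable F (indicator S)"
proof -
  have borel: "sets borel = sigma_sets UNIV (range (\<lambda>a::real. {..a}))"
    by (subst borel_eq_atMost) simp
  have sq: "sq_int (moment_measure x) (indicator T)" if "T \<in> sets borel" for x T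
    by (rule sq_int_le_one) (use that in \<open>auto simp: indicator_def\<close>)
  have "Int_stable (range (\<lambda>a::real. {..a}))"
    by (auto simp: Int_stable_def)
  moreover have "range (\<lambda>a::real. {..a}) \<subseteq> Pow UNIV" by simp
  moreover have "S \<in> sigma_sets UNIV (range (\<lambda>a::real. {..a}))" using S borel by simp
  ultimately show ?thesis
  proof (induction rule: sigma_sets_induct_disjoint)
    case (basic A)
    then show ?case using approximable_atMost[OF F] by auto
  next
    case empty
    have "approximable F (\<lambda>l. 0 * indicator {..0} l)"
      by (rule approximable_scale[OF approximable_atMost[OF F]])
    then show ?case by simp
  next
    case (compl A)
    have A: "A \<in> sets borel" using compl(1) borel by simp
    have "approximable F (\<lambda>_. 1)" by (rule approximable_continuous[OF F]) auto
    then have "approximable F (\<lambda>l. 1 + (- 1) * indicator A l)"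
      using compl(2) A by (intro approximable_add approximable_scale sq_int_scale sq \<T>_sq_int[OF \<T>_one])
    moreover have "(\<lambda>l. 1 + (- 1) * indicator A l) = (indicator (UNIV - A) :: real \<Rightarrow> real)"
      by (auto simp: fun_eq_iff indicator_def)
    ultimately show ?case by simp
  next
    case (union A)
    have Ab: "A i \<in> sets borel" for i using union(2) borel by blast
    have Un: "(\<Union>i<n. A i) \<in> sets borel" "(\<Union>i. A i) \<in> sets borel" for n using Ab by auto
    show ?case
    proof (rule approximable_limit[OF F])
      show "approximable F (indicator (\<Union>i<n. A i))" for n
      proof (induction n)
        case 0
        have "approximable F (\<lambda>l. 0 * indicator {..0} l)"
          by (rule approximable_scale[OF approximable_atMost[OF F]])
        then show ?case by simp
      next
        case (Suc n)
        show ?case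
          unfolding indicator_UN_lessThan_Suc[OF union(1)]
          by (rule approximable_add[OF Suc sq[OF Un(1)] union(3) sq[OF Ab]])
      qed
      show "sq_int (moment_measure x) (indicator (\<Union>i<n. A i))" for x n by (rule sq[OF Un(1)])
      show "sq_int (moment_measure x) (indicator (\<Union>i. A i))" for x by (rule sq[OF Un(2)])
      show "(\<lambda>n. l2 (moment_measure x) (\<lambda>l. indicator (\<Union>i<n. A i) l - indicator (\<Union>i. A i) l)) \<longlonglongrightarrow> 0" for x
        by (rule l2_indicator_UN[OF Ab])
    qed
  qed
qed

sublocale op_calculus "poly_calculus B" moment_measure
  by unfold_locales (rule approximable_indicator)

end

section \<open>The spectral theorem for nonnegative self-adjoint operators\<close>

text \<open>\<open>\<beta>\<close> is the inverse of \<open>l \<mapsto> 1 / (1 + l)\<close>: the spectral measure of \<open>A\<close> is the image of that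
  of \<open>B = (1 + A)\<^sup>-\<^sup>1\<close>.  The identity \<open>1 / (1 + \<beta> b) = b\<close> holds for \<open>b = 0\<close> too, by the
  convention \<open>1 / 0 = 0\<close>.\<close>

definition \<beta> :: "real \<Rightarrow> real" where "\<beta> b = 1 / b - 1"

lemma \<beta>_inverse: "1 / (1 + \<beta> b) = b"
  by (simp add: \<beta>_def)

lemma \<beta>_measurable [measurable]: "\<beta> \<in> borel_measurable borel"
  unfolding \<beta>_def[abs_def] by measurable

lemma \<beta>_vimage: "S \<in> sets borel \<Longrightarrow> \<beta> -` S \<in> sets borel"
  using measurable_sets[OF \<beta>_measurable] by simp

context pos_contraction
begin

definition image_pvm :: "real set \<Rightarrow> 'a \<Rightarrow> 'a" where
  "image_pvm S x = \<Phi> (indicator (\<beta> -` S)) x"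

lemma image_pvm: "projection_valued_measure image_pvm"
  unfolding projection_valued_measure_def
proof (intro conjI ballI allI impI)
  fix S T :: "real set" and x y assume S: "S \<in> sets borel"
  note bS = ess_bdd_indicator[OF \<beta>_vimage[OF S]]
  have "image_pvm S = \<Phi> (indicator (\<beta> -` S))" by (simp add: fun_eq_iff image_pvm_def)
  then show "bounded_linear (image_pvm S)" using bounded_linear_\<Phi>[OF bS] by simp
  show "inner (image_pvm S x) y = inner x (image_pvm S y)"
    unfolding image_pvm_def by (intro \<Phi>_sym ess_bdd_sq_int bS)
  assume T: "T \<in> sets borel"
  note bT = ess_bdd_indicator[OF \<beta>_vimage[OF T]]
  have "(\<lambda>l. indicator (\<beta> -` S) l * indicator (\<beta> -` T) l) = (indicator (\<beta> -` (S \<inter> T)) :: real \<Rightarrow> real)"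
    by (auto simp: fun_eq_iff indicator_def)
  then show "image_pvm (S \<inter> T) x = image_pvm S (image_pvm T x)"
    unfolding image_pvm_def by (simp add: \<Phi>_comp_bdd_bdd[OF bS bT])
next
  have "(indicator UNIV :: real \<Rightarrow> real) = (\<lambda>_. 1)" by (simp add: fun_eq_iff)
  then show "image_pvm UNIV x = x" for x by (simp add: image_pvm_def \<Phi>_one)
next
  fix F :: "nat \<Rightarrow> real set" and x
  assume F: "range F \<subseteq> sets borel \<and> disjoint_family F"
  have "(\<lambda>n. \<Phi> (indicator (\<beta> -` F n)) x) sums \<Phi> (indicator (\<Union>n. \<beta> -` F n)) x"
    using F by (intro \<Phi>_indicator_sums) (auto intro: \<beta>_vimage simp: disjoint_family_on_def)
  then show "(\<lambda>n. image_pvm (F n) x) sums image_pvm (\<Union>n. F n) x"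
    by (simp add: image_pvm_def vimage_UN)
qed

sublocale P: pvm image_pvm
  by (rule pvm.intro) (rule image_pvm)

lemma scalar_measure_image_pvm: "scalar_measure image_pvm x = distr (moment_measure x) borel \<beta>"
proof (rule measure_eqI)
  fix S assume "S \<in> sets (scalar_measure image_pvm x)"
  then have S: "S \<in> sets borel" by simp
  interpret finite_measure "moment_measure x" by (rule finite_moment_measure)
  have "emeasure (scalar_measure image_pvm x) S = ennreal ((norm (image_pvm S x))\<^sup>2)"
    by (simp add: P.emeasure_scalar_measure[OF S] P.inner_E[OF S])
  also have "(norm (image_pvm S x))\<^sup>2 = measure (moment_measure x) (\<beta> -` S)"
    unfolding image_pvm_def by (rule measure_eq_norm[OF \<beta>_vimage[OF S], symmetric])
  finally show "emeasure (scalar_measure image_pvm x) S = emeasure (distr (moment_measure x) borel \<beta>) S"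
    using S by (simp add: emeasure_distr emeasure_eq_measure)
qed simp

lemma inv_ess_bdd: "P.ess_bdd (\<lambda>l. 1 / (1 + l))"
  unfolding P.ess_bdd_def
proof (intro conjI exI allI)
  show "(\<lambda>l::real. 1 / (1 + l)) \<in> borel_measurable borel" by measurable
  show "AE l in scalar_measure image_pvm x. \<bar>1 / (1 + l)\<bar> \<le> 1" for x
    unfolding scalar_measure_image_pvm
    by (subst AE_distr_iff) (use AE_moment_measure[of x] in \<open>auto simp: \<beta>_inverse\<close>)
qed

text \<open>Both operators are symmetric and have the same quadratic form, namely the first moment.
  Their difference D is symmetric with zero form, and evaluating the form at D x + x leaves 2 |D
  x|^2 = 0.\<close>

lemma P_inv_eq: "P.\<Phi> (\<lambda>l. 1 / (1 + l)) x = B x"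
proof -
  define D where "D x = P.\<Phi> (\<lambda>l. 1 / (1 + l)) x - B x" for x
  have linD: "linear D"
    unfolding D_def[abs_def]
    by (intro linear_compose_sub lin bounded_linear.linear[OF P.bounded_linear_\<Phi>[OF inv_ess_bdd]])
  have symD: "inner (D x) y = inner x (D y)" for x y
    using P.\<Phi>_sym[OF P.ess_bdd_sq_int[OF inv_ess_bdd] P.ess_bdd_sq_int[OF inv_ess_bdd]]
    by (simp add: D_def inner_diff sym)
  have D0: "inner x (D x) = 0" for x
  proof -
    have "inner x (P.\<Phi> (\<lambda>l. 1 / (1 + l)) x) = (\<integral>l. 1 / (1 + l) \<partial>scalar_measure image_pvm x)"
      by (rule P.inner_\<Phi>_self[OF P.ess_bdd_sq_int[OF inv_ess_bdd]])
    also have "\<dots> = (\<integral>l. l \<partial>moment_measure x)"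
      unfolding scalar_measure_image_pvm by (subst integral_distr) (auto simp: \<beta>_inverse)
    also have "\<dots> = inner x (B x)" using moments[of x 1] by simp
    finally show ?thesis by (simp add: D_def inner_diff)
  qed
  have "inner (D x + x) (D (D x + x)) = inner (D x) (D (D x)) + inner x (D x) + 2 * inner (D x) (D x)"
    by (simp add: linear_add[OF linD] inner_add inner_commute symD[of x "D x", symmetric])
  then have "inner (D x) (D x) = 0" unfolding D0 by simp
  then show ?thesis by (simp add: D_def)
qed

end

theorem spectral_measure_exists:
  fixes A :: "('a::{real_inner,complete_space}) lin_op"
  assumes A: "nonneg_selfadjoint A"
  shows "\<exists>E. is_spectral_measure A E"
proof -
  note sub = nonneg_selfadjoint_subspace[OF A] and Ladd = nonneg_selfadjoint_add[OF A]
    and Lscale = nonneg_selfadjoint_scale[OF A] and pos = nonneg_selfadjoint_inner[OF A]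
  define B where "B y = (SOME x. x \<in> fst A \<and> x + snd A x = y)" for y
  have B: "B y \<in> fst A" "B y + snd A (B y) = y" for y
    using someI_ex[of "\<lambda>x. x \<in> fst A \<and> x + snd A x = y"] nonneg_selfadjoint_resolvent[OF A, of y]
    unfolding B_def by blast+
  have inj: "u = 0" if "u \<in> fst A" "u + snd A u = 0" for u
  proof -
    have "0 = inner u (u + snd A u)" using that(2) by simp
    also have "\<dots> = inner u u + inner u (snd A u)" by (rule inner_add_right)
    finally have "inner u u \<le> 0" using pos[OF that(1)] by linarith
    then show ?thesis using inner_gt_zero_iff[of u] by (meson not_less)
  qed
  have uniq: "u = B y" if "u \<in> fst A" "u + snd A u = y" for u y
  proof -
    have d: "u - B y \<in> fst A" by (rule subspace_diff[OF sub that(1) B(1)])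
    have "snd A (u - B y) = snd A u - snd A (B y)"
      using Ladd[OF d B(1)[of y]] by (simp add: algebra_simps)
    moreover have "u + snd A u = B y + snd A (B y)" using that(2) B(2) by simp
    ultimately have "(u - B y) + snd A (u - B y) = 0" by (metis add_diff_add diff_self)
    from inj[OF d this] show ?thesis by simp
  qed
  have linB: "linear B"
  proof (rule linearI)
    fix u v c
    have "(B u + B v) + snd A (B u + B v) = (B u + snd A (B u)) + (B v + snd A (B v))"
      by (simp add: Ladd[OF B(1) B(1)] algebra_simps)
    then show "B (u + v) = B u + B v"
      using subspace_add[OF sub B(1) B(1), of u v] B(2) by (intro uniq[symmetric]) auto
    have "(c *\<^sub>R B u) + snd A (c *\<^sub>R B u) = c *\<^sub>R (B u + snd A (B u))"
      by (simp add: Lscale[OF B(1)] algebra_simps)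
    then show "B (c *\<^sub>R u) = c *\<^sub>R B u"
      using subspace_scale[OF sub B(1), of c u] B(2) by (intro uniq[symmetric]) auto
  qed
  have symB: "inner (B x) y = inner x (B y)" for x y
  proof -
    have "inner (B x) y = inner (B x) (B y + snd A (B y))" using B(2) by simp
    also have "\<dots> = inner (B x + snd A (B x)) (B y)"
      using nonneg_selfadjoint_sym[OF A B(1) B(1), of x y] by (simp add: inner_add)
    finally show ?thesis using B(2) by simp
  qed
  have "inner (B x) (B x) \<le> inner x (B x)" for x
  proof -
    have "inner x (B x) = inner (B x + snd A (B x)) (B x)" using B(2) by simp
    then show ?thesis using pos[OF B(1), of x] by (simp add: inner_add inner_commute)
  qed
  with linB symB interpret pos_contraction B by (rule pos_contraction.intro)
  let ?\<mu> = "scalar_measure image_pvm"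
  let ?r = "\<lambda>l::real. 1 / (1 + l)"
  note r = P.ess_bdd_sq_int[OF inv_ess_bdd]
  have rm: "?r \<in> borel_measurable borel" by measurable
  have B0: "x = 0" if "B x = 0" for x
  proof -
    have "B x + snd A (B x) = x" by (rule B(2))
    moreover have "snd A 0 = 0" using Lscale[OF subspace_0[OF sub], of 0] by simp
    ultimately show ?thesis using that by simp
  qed
  \<comment> \<open>The point -1 is the image of b = 0 under \<open>\<beta>\<close>, so its mass
    would come from the kernel of B, which is trivial. At l = -1 the convention 1 / 0 = 0 makes the
    product with the indicator vanish.\<close>
  have AE: "AE l in ?\<mu> y. l \<noteq> -1" for y
  proof -
    have b: "P.ess_bdd (indicator {-1})" by (rule P.ess_bdd_indicator) simp
    have "(\<lambda>l. ?r l * indicator {-1} l) = (\<lambda>_. 0)" by (auto simp: fun_eq_iff indicator_def)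
    then have "B (P.\<Phi> (indicator {-1}) y) = P.\<Phi> (\<lambda>_. 0) y"
      using P.\<Phi>_comp_bdd_bdd[OF inv_ess_bdd b, of y] P_inv_eq by simp
    then have "B (P.\<Phi> (indicator {-1}) y) = 0" using P.\<Phi>_const[of 0 y] by simp
    then have "P.\<Phi> (indicator {-1}) y = 0" by (rule B0)
    then have "measure (?\<mu> y) {-1} = 0" using P.measure_eq_norm[of "{-1}" y] by simp
    then have "emeasure (?\<mu> y) {-1} = 0"
      by (simp add: finite_measure.emeasure_eq_measure[OF P.finite_M])
    then show ?thesis by (intro AE_I[where N = "{-1}"]) auto
  qed
  have dom: "x \<in> fst A \<and> P.\<Phi> (\<lambda>l. l) x = snd A x" if x: "sq_int (?\<mu> x) (\<lambda>l. l)" for x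
  proof -
    \<comment> \<open>The vector y stands for (1 + A) x computed in the calculus. Applying B
      recovers x, which therefore lies in the range of B, that is, in the domain of A.\<close>
    define y where "y = P.\<Phi> (\<lambda>l. 1 + l) x"
    have s: "sq_int (?\<mu> x) (\<lambda>l. 1 + l)" by (rule sq_int_add[OF P.sq_int_const x])
    have y: "y = x + P.\<Phi> (\<lambda>l. l) x"
      unfolding y_def using P.\<Phi>_add[OF P.sq_int_const x, of 1] P.\<Phi>_one by simp
    have "B y = P.\<Phi> ?r y" by (rule P_inv_eq[symmetric])
    also have "\<dots> = P.\<Phi> (\<lambda>l. ?r l * (1 + l)) x"
      unfolding y_def by (rule P.\<Phi>_comp_bdd[OF inv_ess_bdd s])
    also have "\<dots> = P.\<Phi> (\<lambda>_. 1) x"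
    proof (rule P.\<Phi>_cong_AE[OF P.sq_int_const])
      show "AE l in ?\<mu> x. 1 = ?r l * (1 + l)"
        using AE[of x] by eventually_elim (simp add: divide_simps; linarith)
    qed measurable
    finally have "x = B y" using P.\<Phi>_one by simp
    then have "x \<in> fst A" "x + snd A x = y" using B[of y] by simp_all
    then show ?thesis using y by simp
  qed
  have dom': "sq_int (?\<mu> x) (\<lambda>l. l)" if x: "x \<in> fst A" for x
  proof -
    have xB: "x = P.\<Phi> ?r (x + snd A x)" unfolding P_inv_eq by (rule uniq[OF x refl])
    \<comment> \<open>As x is the resolvent of x + A x, its membership in the domain of l reduces to
      l / (1 + l) = 1 - 1 / (1 + l), a bounded function almost everywhere.\<close>
    have "sq_int (?\<mu> (x + snd A x)) (\<lambda>l. l * ?r l)"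
    proof (rule sq_int_bound[OF sq_int_diff[OF P.sq_int_const[of _ 1] r]])
      show "AE l in ?\<mu> (x + snd A x). \<bar>l * ?r l\<bar> \<le> \<bar>1 - ?r l\<bar>"
        using AE[of "x + snd A x"]
      proof eventually_elim
        case (elim l)
        then have "l * ?r l = 1 - ?r l" by (simp add: field_simps)
        then show ?case by simp
      qed
    qed simp
    then show ?thesis using P.sq_int_\<Phi>_iff[OF r, of "\<lambda>l. l" "x + snd A x"] xB by simp
  qed
  have "is_spectral_measure A image_pvm"
    unfolding is_spectral_measure_def
    using image_pvm dom dom' by (auto simp: P.pvm_dom_eq P.pvm_integral_eq)
  then show ?thesis using exI[of "is_spectral_measure A" image_pvm] by simp
qed

section \<open>The functional calculus of A and the Sobolev norms\<close>

locale nonneg_op =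
  fixes A :: "('a::{real_inner,complete_space}) lin_op"
  assumes nonneg: "nonneg_selfadjoint A"
begin

lemma is_spectral_measure: "is_spectral_measure A (spectral_measure A)"
  unfolding spectral_measure_def by (rule someI_ex[OF spectral_measure_exists[OF nonneg]])

sublocale pvm "spectral_measure A"
  using is_spectral_measure by (intro pvm.intro) (simp add: is_spectral_measure_def)

abbreviation \<mu> :: "'a \<Rightarrow> real measure" where "\<mu> x \<equiv> scalar_measure (spectral_measure A) x"

text \<open>Projecting x to [-n, 0) gives a vector of the domain of A whose form is the integral of
  l over this set. It is nonnegative by hypothesis while the integrand is negative there, so the set
  has measure 0.\<close>

lemma AE_spectrum: "AE l in \<mu> x. 0 \<le> l"
proof -
  have "AE l in \<mu> x. \<not> (- real n \<le> l \<and> l < 0)" for n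
  proof -
    let ?S = "{- real n..<0}"
    let ?i = "indicator ?S :: real \<Rightarrow> real"
    have b: "ess_bdd ?i" by (rule ess_bdd_indicator) simp
    have bl: "ess_bdd (\<lambda>l. l * ?i l)"
      by (rule ess_bddI[of _ "real n"]) (auto simp: indicator_def)
    define y where "y = \<Phi> ?i x"
    have ys: "sq_int (\<mu> y) (\<lambda>l. l)"
      unfolding y_def using sq_int_\<Phi>_iff[OF ess_bdd_sq_int[OF b], of "\<lambda>l. l" x] ess_bdd_sq_int[OF bl] by simp
    then have yA: "y \<in> fst A" "\<Phi> (\<lambda>l. l) y = snd A y"
      using is_spectral_measure by (auto simp: is_spectral_measure_def pvm_dom_eq pvm_integral_eq[symmetric])
    then have "0 \<le> inner y (\<Phi> (\<lambda>l. l) y)"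
      using nonneg by (auto simp: nonneg_selfadjoint_def)
    also have "\<Phi> (\<lambda>l. l) y = \<Phi> (\<lambda>l. l * ?i l) x"
      unfolding y_def by (rule \<Phi>_comp[OF ess_bdd_sq_int[OF b] ess_bdd_sq_int[OF bl]]) simp
    also have "inner y \<dots> = (\<integral>l. ?i l * (l * ?i l) \<partial>\<mu> x)"
      unfolding y_def by (rule inner_\<Phi>[OF ess_bdd_sq_int[OF b] ess_bdd_sq_int[OF bl]])
    finally have "0 \<le> (\<integral>l. ?i l * (l * ?i l) \<partial>\<mu> x)" .
    moreover have nn: "AE l in \<mu> x. 0 \<le> - (?i l * (l * ?i l))"
      by (auto simp: indicator_def)
    moreover have int: "integrable (\<mu> x) (\<lambda>l. ?i l * (l * ?i l))"
      by (rule sq_int_mult[OF ess_bdd_sq_int[OF b] ess_bdd_sq_int[OF bl]])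
    ultimately have "(\<integral>l. - (?i l * (l * ?i l)) \<partial>\<mu> x) = 0"
      using integral_nonneg_AE[OF nn] by simp
    then have "AE l in \<mu> x. - (?i l * (l * ?i l)) = 0"
      using integral_nonneg_eq_0_iff_AE[OF Bochner_Integration.integrable_minus[OF int] nn] by simp
    then show ?thesis by eventually_elim (auto simp: indicator_def split: if_splits)
  qed
  then have "AE l in \<mu> x. \<forall>n. \<not> (- real n \<le> l \<and> l < 0)"
    by (subst AE_all_countable) blast
  then show ?thesis
  proof eventually_elim
    case (elim l)
    obtain n where "- l \<le> real n" using real_arch_simple by blast
    then show ?case using elim[rule_format, of n] by linarith
  qed
qed

lemma fun_dom_eq: "f \<in> borel_measurable borel \<Longrightarrow> fun_dom A f = {x. sq_int (\<mu> x) f}"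
  unfolding fun_dom_def by (rule pvm_dom_eq)

lemma fun_op_eq: "sq_int (\<mu> x) f \<Longrightarrow> fun_op A f x = \<Phi> f x"
  unfolding fun_op_def by (rule pvm_integral_eq)

lemma Hs_weight_measurable [measurable]: "Hs_weight s \<in> borel_measurable borel"
  unfolding Hs_weight_def[abs_def] by measurable

lemma Hs_weight_power2: "0 \<le> l \<Longrightarrow> (Hs_weight s l)\<^sup>2 = (1 + l) powr s"
  by (simp add: Hs_weight_def power2_eq_square powr_add[symmetric])

lemma Hs_weight_zero: "0 \<le> l \<Longrightarrow> Hs_weight 0 l = 1"
  by (simp add: Hs_weight_def)

lemma Hs_eq: "Hs A s = {x. sq_int (\<mu> x) (Hs_weight s)}"
  unfolding Hs_def by (rule fun_dom_eq) measurable

text \<open>With the nonnegative integral, weights can be compared, added and summed as infinite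
  series without integrability conditions.\<close>

lemma Hs_norm_power2:
  assumes "x \<in> Hs A s"
  shows "ennreal ((Hs_norm A s x)\<^sup>2) = (\<integral>\<^sup>+l. ennreal ((1 + l) powr s) \<partial>\<mu> x)"
proof -
  have x: "sq_int (\<mu> x) (Hs_weight s)" using assms by (simp add: Hs_eq)
  have "(Hs_norm A s x)\<^sup>2 = (\<integral>l. (Hs_weight s l)\<^sup>2 \<partial>\<mu> x)"
    using norm_\<Phi>[OF x] by (simp add: Hs_norm_def Hs_coord_def fun_op_eq[OF x] l2_power2)
  then have "ennreal ((Hs_norm A s x)\<^sup>2) = (\<integral>\<^sup>+l. ennreal ((Hs_weight s l)\<^sup>2) \<partial>\<mu> x)"
    using x nn_integral_eq_integral[of "\<mu> x" "\<lambda>l. (Hs_weight s l)\<^sup>2"] by (simp add: sq_int_def)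
  also have "\<dots> = (\<integral>\<^sup>+l. ennreal ((1 + l) powr s) \<partial>\<mu> x)"
  proof (rule nn_integral_cong_AE)
    show "AE l in \<mu> x. ennreal ((Hs_weight s l)\<^sup>2) = ennreal ((1 + l) powr s)"
      using AE_spectrum[of x] by eventually_elim (simp add: Hs_weight_power2)
  qed
  finally show ?thesis .
qed

lemma sq_int_Hs_weight_zero: "sq_int (\<mu> x) (Hs_weight 0)"
proof (rule sq_int_bound[OF sq_int_const[of x 1]])
  show "AE l in \<mu> x. \<bar>Hs_weight 0 l\<bar> \<le> \<bar>1\<bar>"
    using AE_spectrum[of x] by eventually_elim (simp add: Hs_weight_zero)
qed simp

text \<open>This turns the $H^0$ clauses of solutions, which occur for s = 1 and s = 2, into
  statements in X itself. Since 0 powr 0 = 0, the weight is 0 at l = -1, and the equality with 1 is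
  taken on the spectrum.\<close>

lemma Hs_coord_zero: "Hs_coord A 0 x = x"
proof -
  have "\<Phi> (Hs_weight 0) x = \<Phi> (\<lambda>_. 1) x"
  proof (rule \<Phi>_cong_AE[OF sq_int_const])
    show "AE l in \<mu> x. 1 = Hs_weight 0 l"
      using AE_spectrum[of x] by eventually_elim (simp add: Hs_weight_zero)
  qed simp
  then show ?thesis
    by (simp add: Hs_coord_def fun_op_eq[OF sq_int_Hs_weight_zero] \<Phi>_one)
qed

lemma sqrt_dom_eq: "sqrt_dom A = {x. sq_int (\<mu> x) sqrt}"
  unfolding sqrt_dom_def by (rule fun_dom_eq) measurable

lemma sqrt_op_eq: "x \<in> sqrt_dom A \<Longrightarrow> sqrt_op A x = \<Phi> sqrt x"
  unfolding sqrt_op_def sqrt_dom_eq by (simp add: fun_op_eq)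

end

section \<open>Conserved quantities of the Kirchhoff equation\<close>

lemma vector_derivative_quotient:
  assumes "(f has_vector_derivative f') (at t)"
  shows "((\<lambda>s. (f s - f t) /\<^sub>R (s - t)) \<longlongrightarrow> f') (at t)"
proof -
  have "((\<lambda>s. ((f s - f t) - (s - t) *\<^sub>R f') /\<^sub>R norm (s - t)) \<longlongrightarrow> 0) (at t)"
    using assms by (simp add: has_vector_derivative_def has_derivative_at_within)
  then have "((\<lambda>s. norm (((f s - f t) - (s - t) *\<^sub>R f') /\<^sub>R norm (s - t))) \<longlongrightarrow> 0) (at t)"
    by (rule tendsto_norm_zero)
  moreover have "\<forall>\<^sub>F s in at t. norm (((f s - f t) - (s - t) *\<^sub>R f') /\<^sub>R norm (s - t))
      = norm ((f s - f t) /\<^sub>R (s - t) - f')"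
    unfolding eventually_at_filter
  proof (rule always_eventually, intro allI impI)
    fix s :: real assume "s \<noteq> t"
    then have "(f s - f t) /\<^sub>R (s - t) - f' = ((f s - f t) - (s - t) *\<^sub>R f') /\<^sub>R (s - t)"
      by (simp add: scaleR_right_diff_distrib)
    then show "norm (((f s - f t) - (s - t) *\<^sub>R f') /\<^sub>R norm (s - t)) = norm ((f s - f t) /\<^sub>R (s - t) - f')"
      by simp
  qed
  ultimately have "((\<lambda>s. norm ((f s - f t) /\<^sub>R (s - t) - f')) \<longlongrightarrow> 0) (at t)"
    using tendsto_cong by fast
  then show ?thesis by (simp only: tendsto_norm_zero_iff LIM_zero_iff)
qed

text \<open>Symmetry of \<open>q \<mapsto> z\<close> gives
  \<open>\<langle>q s, z s\<rangle> - \<langle>q t, z t\<rangle> = \<langle>q s - q t, z s + z t\<rangle>\<close>, so that continuity of \<open>z\<close> suffices.\<close>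

lemma symmetric_form_derivative:
  fixes q z :: "real \<Rightarrow> 'a::real_inner"
  assumes I: "open I" "t \<in> I" and q: "(q has_vector_derivative p) (at t)" and z: "isCont z t"
    and sym: "\<And>s. s \<in> I \<Longrightarrow> inner (q s) (z t) = inner (z s) (q t)"
  shows "((\<lambda>s. inner (q s) (z s)) has_real_derivative 2 * inner p (z t)) (at t)"
  unfolding has_field_derivative_iff
proof -
  have "((\<lambda>s. inner ((q s - q t) /\<^sub>R (s - t)) (z s + z t)) \<longlongrightarrow> inner p (z t + z t)) (at t)"
    using z by (intro tendsto_intros vector_derivative_quotient[OF q]) (simp add: isCont_def)
  moreover have "\<forall>\<^sub>F s in at t. inner ((q s - q t) /\<^sub>R (s - t)) (z s + z t)
      = (inner (q s) (z s) - inner (q t) (z t)) / (s - t)"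
    using eventually_at_in_open[OF I]
  proof eventually_elim
    case (elim s)
    then have "inner (q s) (z t) = inner (z s) (q t)" using sym by simp
    then show ?case
      by (simp add: inner_diff inner_add inner_commute divide_inverse mult.commute algebra_simps)
  qed
  ultimately have "((\<lambda>s. (inner (q s) (z s) - inner (q t) (z t)) / (s - t)) \<longlongrightarrow> inner p (z t + z t)) (at t)"
    using tendsto_cong by fast
  then show "((\<lambda>s. (inner (q s) (z s) - inner (q t) (z t)) / (s - t)) \<longlongrightarrow> 2 * inner p (z t)) (at t)"
    by (simp add: inner_add_right)
qed

lemma has_real_derivative_inner:
  assumes "(f has_vector_derivative f') (at t)" "(g has_vector_derivative g') (at t)"
  shows "((\<lambda>s. inner (f s) (g s)) has_real_derivative (inner (f t) g' + inner f' (g t))) (at t)"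
  unfolding has_real_derivative_iff_has_vector_derivative
  by (rule bounded_bilinear.has_vector_derivative[OF bounded_bilinear_inner assms])

text \<open>With \<open>z = A q\<close> and \<open>N = A (A + m)\<^sup>-\<^sup>1\<close> this is the generating function of the
  conserved quantities.  Its \<open>t\<close>-derivative is a multiple of \<open>c\<^sup>2 (1 - \<langle>q, A q\<rangle>) - c = 0\<close>.\<close>

definition generating_fun :: "('a \<Rightarrow> 'a::real_inner) \<Rightarrow> real \<Rightarrow> real \<Rightarrow> 'a \<Rightarrow> 'a \<Rightarrow> real" where
  "generating_fun N m c q p =
     (1 - m * inner q (N q)) * (c + inner p (N p)) + m * (inner q (N p))\<^sup>2"

text \<open>The hypothesis on N z is N A = A - m N applied to q. It expresses all derivatives by the
  bounded forms U, V, P and by <q, z> and <p, z>. The terms with <p, z> cancel between the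
  derivatives of c and P, those with U and P cancel as well, and only the relation between c and Q
  remains.\<close>

lemma kirchhoff_conserved:
  fixes q p z :: "real \<Rightarrow> 'a::real_inner" and c :: "real \<Rightarrow> real"
  assumes I: "convex I"
    and q: "\<And>t. t \<in> I \<Longrightarrow> (q has_vector_derivative p t) (at t)"
    and p: "\<And>t. t \<in> I \<Longrightarrow> (p has_vector_derivative - ((c t)\<^sup>2 *\<^sub>R z t)) (at t)"
    and c: "\<And>t. t \<in> I \<Longrightarrow> (c has_real_derivative 2 * (c t)\<^sup>2 * inner (p t) (z t)) (at t)"
    and N: "bounded_linear N" "\<And>x y. inner (N x) y = inner x (N y)"
    and Nz: "\<And>t. t \<in> I \<Longrightarrow> N (z t) = z t - m *\<^sub>R N (q t)"
    and cQ: "\<And>t. t \<in> I \<Longrightarrow> c t * (1 - inner (q t) (z t)) = 1"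
    and st: "s \<in> I" "t \<in> I"
  shows "generating_fun N m (c s) (q s) (p s) = generating_fun N m (c t) (q t) (p t)"
proof -
  note Nv = bounded_linear.has_vector_derivative[OF N(1)]
  have "\<exists>C. \<forall>t\<in>I. generating_fun N m (c t) (q t) (p t) = C"
  proof (rule has_field_derivative_zero_constant[OF I], rule has_field_derivative_at_within)
    fix t assume t: "t \<in> I"
    define U where "U = inner (q t) (N (q t))"
    define V where "V = inner (q t) (N (p t))"
    define P where "P = inner (p t) (N (p t))"
    define Q where "Q = inner (q t) (z t)"
    have V': "inner (p t) (N (q t)) = V" unfolding V_def by (metis N(2) inner_commute)
    have Nlin: "N (- (a *\<^sub>R x)) = - (a *\<^sub>R N x)" for a x
      using linear_scale[OF bounded_linear.linear[OF N(1)], of "- a" x] by simp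
    have dU: "((\<lambda>t. inner (q t) (N (q t))) has_real_derivative 2 * V) (at t)"
      using has_real_derivative_inner[OF q[OF t] Nv[OF q[OF t]]] by (simp add: V' V_def[symmetric])
    have "inner (q t) (N (z t)) = Q - m * U"
      by (simp add: Nz[OF t] inner_diff_right Q_def U_def)
    then have dV: "((\<lambda>t. inner (q t) (N (p t))) has_real_derivative P - (c t)\<^sup>2 * (Q - m * U)) (at t)"
      using has_real_derivative_inner[OF q[OF t] Nv[OF p[OF t]]] by (simp add: Nlin P_def)
    have "inner (z t) (N (p t)) = inner (p t) (z t) - m * V"
      unfolding V_def N(2)[symmetric] by (simp only: Nz[OF t] inner_diff_left inner_scaleR_left inner_commute[of "z t" "p t"])
    then have dP: "((\<lambda>t. inner (p t) (N (p t))) has_real_derivative - 2 * (c t)\<^sup>2 * (inner (p t) (z t) - m * V)) (at t)"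
      using has_real_derivative_inner[OF p[OF t] Nv[OF p[OF t]]]
      by (simp add: Nlin N(2)[symmetric, of "p t" "z t"] inner_commute[of "N (p t)" "z t"] mult.assoc)
    have "c t * (c t * (1 - Q)) = c t" using cQ[OF t] by (simp add: Q_def)
    then have cc: "(c t)\<^sup>2 * Q = (c t)\<^sup>2 - c t" by (simp add: power2_eq_square algebra_simps)
    have "((\<lambda>t. generating_fun N m (c t) (q t) (p t)) has_real_derivative
        (- m * (2 * V)) * (c t + P)
        + (1 - m * U) * (2 * (c t)\<^sup>2 * inner (p t) (z t) - 2 * (c t)\<^sup>2 * (inner (p t) (z t) - m * V))
        + m * (2 * V * (P - (c t)\<^sup>2 * (Q - m * U)))) (at t)"
      unfolding generating_fun_def
      by (rule derivative_eq_intros dU dV dP c[OF t] refl)+ (simp add: U_def V_def P_def power2_eq_square algebra_simps)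
    moreover have "(- m * (2 * V)) * (c t + P)
        + (1 - m * U) * (2 * (c t)\<^sup>2 * inner (p t) (z t) - 2 * (c t)\<^sup>2 * (inner (p t) (z t) - m * V))
        + m * (2 * V * (P - (c t)\<^sup>2 * (Q - m * U))) = 2 * m * V * ((c t)\<^sup>2 - c t - (c t)\<^sup>2 * Q)"
      by (simp add: algebra_simps)
    ultimately show "((\<lambda>t. generating_fun N m (c t) (q t) (p t)) has_real_derivative 0) (at t)"
      by (simp add: cc)
  qed
  then show "generating_fun N m (c s) (q s) (p s) = generating_fun N m (c t) (q t) (p t)"
    using st by metis
qed

lemma kirchhoff_energy:
  fixes p z :: "real \<Rightarrow> 'a::real_inner" and c :: "real \<Rightarrow> real"
  assumes I: "convex I"
    and p: "\<And>t. t \<in> I \<Longrightarrow> (p has_vector_derivative - ((c t)\<^sup>2 *\<^sub>R z t)) (at t)"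
    and c: "\<And>t. t \<in> I \<Longrightarrow> (c has_real_derivative 2 * (c t)\<^sup>2 * inner (p t) (z t)) (at t)"
    and st: "s \<in> I" "t \<in> I"
  shows "inner (p s) (p s) + c s = inner (p t) (p t) + c t"
proof -
  have "\<exists>C. \<forall>t\<in>I. inner (p t) (p t) + c t = C"
  proof (rule has_field_derivative_zero_constant[OF I], rule has_field_derivative_at_within)
    fix t assume t: "t \<in> I"
    have "((\<lambda>t. inner (p t) (p t) + c t) has_real_derivative
        (inner (p t) (- ((c t)\<^sup>2 *\<^sub>R z t)) + inner (- ((c t)\<^sup>2 *\<^sub>R z t)) (p t)) + 2 * (c t)\<^sup>2 * inner (p t) (z t)) (at t)"
      by (intro DERIV_add has_real_derivative_inner p c t)
    then show "((\<lambda>t. inner (p t) (p t) + c t) has_real_derivative 0) (at t)"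
      by (simp add: inner_commute)
  qed
  then show "inner (p s) (p s) + c s = inner (p t) (p t) + c t"
    using st by metis
qed

text \<open>Here 1 - m U = 1 / c + D, and expanding G leaves 1 + c D + P / c plus the remainder D P
  + m <q, N p>^2. Dropping the nonnegative remainder gives the lower bound. Cauchy-Schwarz bounds it
  by (D + m U) P = Q P, and 1 / c + Q = 1 turns P / c + Q P into P.\<close>

lemma generating_fun_bounds:
  assumes "0 < m" "1 \<le> c" "c * (1 - Q) = 1" and D: "D = Q - m * U" "0 \<le> D" and "0 \<le> P"
    and U: "U = inner q (N q)" and P: "P = inner p (N p)" and V: "(inner q (N p))\<^sup>2 \<le> U * P"
  shows "c * D + P / c \<le> generating_fun N m c q p - 1" "generating_fun N m c q p - 1 \<le> c * D + P"
proof -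
  define v where "v = (inner q (N p))\<^sup>2"
  have cQ: "1 - Q = 1 / c" using assms(2,3) by (simp add: field_simps)
  have "1 - m * U = 1 / c + D" using D cQ by simp
  then have G: "generating_fun N m c q p = (1 / c + D) * (c + P) + m * v"
    by (simp add: generating_fun_def U P v_def)
  also have "\<dots> = 1 + (c * D + P / c) + (D * P + m * v)"
    using assms(2) by (simp add: field_simps)
  finally have G': "generating_fun N m c q p = 1 + (c * D + P / c) + (D * P + m * v)" .
  have "0 \<le> D * P + m * v" using assms by (simp add: v_def)
  then show "c * D + P / c \<le> generating_fun N m c q p - 1" using G' by simp
  have "m * v \<le> m * (U * P)" using V assms(1) by (simp add: v_def)
  then have "P / c + (D * P + m * v) \<le> P * (1 / c + D + m * U)"
    by (simp add: algebra_simps)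
  also have "1 / c + D + m * U = 1" using D cQ by simp
  finally show "generating_fun N m c q p - 1 \<le> c * D + P" using G' by simp
qed

section \<open>Solutions and the resolvent weights\<close>

text \<open>The symbol of N. It is set to 0 for negative l, where l + m may vanish, so that its
  bounds hold on the whole line.\<close>

definition yosida :: "real \<Rightarrow> real \<Rightarrow> real" where
  "yosida m l = (if 0 \<le> l then l / (l + m) else 0)"

lemma yosida_measurable [measurable]: "yosida m \<in> borel_measurable borel"
  unfolding yosida_def[abs_def] by measurable

lemma yosida_bounds: "0 < m \<Longrightarrow> 0 \<le> yosida m l \<and> yosida m l \<le> 1"
  by (auto simp: yosida_def)

context nonneg_op
begin

text \<open>\<open>weighted w (q, p)\<close> is \<open>\<langle>A\<^sup>1\<^sup>/\<^sup>2 q, w(A) A\<^sup>1\<^sup>/\<^sup>2 q\<rangle> + \<langle>p, w(A) p\<rangle>\<close>.\<close>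

definition weighted :: "(real \<Rightarrow> ennreal) \<Rightarrow> 'a \<times> 'a \<Rightarrow> ennreal" where
  "weighted w = (\<lambda>(q, p). (\<integral>\<^sup>+l. w l \<partial>\<mu> (sqrt_op A q)) + (\<integral>\<^sup>+l. w l \<partial>\<mu> p))"

lemma op_form_eq:
  assumes "sq_int (\<mu> q) sqrt" "sq_int (\<mu> q) (\<lambda>l. l)"
  shows "op_form A q = inner q (\<Phi> (\<lambda>l. l) q)"
proof -
  have "op_form A q = (\<integral>l. (sqrt l)\<^sup>2 \<partial>\<mu> q)"
    using norm_\<Phi>[OF assms(1)] assms(1)
    by (simp add: op_form_def sqrt_op_eq sqrt_dom_eq l2_power2)
  also have "\<dots> = (\<integral>l. l \<partial>\<mu> q)"
  proof (rule integral_cong_AE)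
    show "AE l in \<mu> q. (sqrt l)\<^sup>2 = l" using AE_spectrum by eventually_elim simp
  qed auto
  also have "\<dots> = inner q (\<Phi> (\<lambda>l. l) q)" by (rule inner_\<Phi>_self[OF assms(2), symmetric])
  finally show ?thesis .
qed

context
  fixes m :: real
  assumes m: "0 < m"
begin

lemma yosida_ess_bdd: "ess_bdd (yosida m)"
  using yosida_bounds[OF m] by (intro ess_bddI[of _ 1]) auto

lemma yosida_sym: "inner (\<Phi> (yosida m) x) y = inner x (\<Phi> (yosida m) y)"
  by (intro \<Phi>_sym ess_bdd_sq_int yosida_ess_bdd)

lemma yosida_form: "ennreal (inner x (\<Phi> (yosida m) x)) = (\<integral>\<^sup>+l. ennreal (yosida m l) \<partial>\<mu> x)"
proof -
  have i: "integrable (\<mu> x) (yosida m)"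
    using sq_int_mult[OF sq_int_const ess_bdd_sq_int[OF yosida_ess_bdd], of x 1] by simp
  show ?thesis
    unfolding inner_\<Phi>_self[OF ess_bdd_sq_int[OF yosida_ess_bdd]]
    using yosida_bounds[OF m] by (intro nn_integral_eq_integral[symmetric] i) auto
qed

lemma yosida_form_nonneg: "0 \<le> inner x (\<Phi> (yosida m) x)"
  unfolding inner_\<Phi>_self[OF ess_bdd_sq_int[OF yosida_ess_bdd]]
  using yosida_bounds[OF m] by (intro integral_nonneg_AE) auto

lemma yosida_Cauchy_Schwarz:
  "(inner x (\<Phi> (yosida m) y))\<^sup>2 \<le> inner x (\<Phi> (yosida m) x) * inner y (\<Phi> (yosida m) y)"
proof (rule quadratic_form_discriminant)
  fix t
  note lin = bounded_linear.linear[OF bounded_linear_\<Phi>[OF yosida_ess_bdd]]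
  have "0 \<le> inner (x - t *\<^sub>R y) (\<Phi> (yosida m) (x - t *\<^sub>R y))" by (rule yosida_form_nonneg)
  also have "\<dots> = inner x (\<Phi> (yosida m) x) - 2 * t * inner x (\<Phi> (yosida m) y)
      + t\<^sup>2 * inner y (\<Phi> (yosida m) y)"
    using yosida_sym[of x y]
    by (simp add: linear_diff[OF lin] linear_scale[OF lin] inner_diff inner_commute power2_eq_square[of t] algebra_simps)
  finally show "0 \<le> \<dots>" .
qed (rule yosida_form_nonneg)

text \<open>On the spectrum l^2 / (l + m) = l - m l / (l + m). This supplies the hypothesis on N z
  in \<open>kirchhoff_conserved\<close>.\<close>

lemma yosida_A:
  assumes q: "sq_int (\<mu> q) (\<lambda>l. l)"
  shows "\<Phi> (yosida m) (\<Phi> (\<lambda>l. l) q) = \<Phi> (\<lambda>l. l) q - m *\<^sub>R \<Phi> (yosida m) q"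
proof -
  note y = ess_bdd_sq_int[OF yosida_ess_bdd, of q]
  have "\<Phi> (yosida m) (\<Phi> (\<lambda>l. l) q) = \<Phi> (\<lambda>l. yosida m l * l) q"
    by (rule \<Phi>_comp_bdd[OF yosida_ess_bdd q])
  also have "\<dots> = \<Phi> (\<lambda>l. l - m * yosida m l) q"
  proof (rule \<Phi>_cong_AE[OF sq_int_diff[OF q sq_int_scale[OF y]]])
    show "AE l in \<mu> q. l - m * yosida m l = yosida m l * l"
      using AE_spectrum[of q]
    proof eventually_elim
      case (elim l)
      then show ?case using m by (simp add: yosida_def field_simps)
    qed
  qed measurable
  also have "\<dots> = \<Phi> (\<lambda>l. l) q - m *\<^sub>R \<Phi> (yosida m) q"
    unfolding \<Phi>_diff[OF q sq_int_scale[OF y]] \<Phi>_scale[OF y] ..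
  finally show ?thesis .
qed

text \<open>The same splitting of l^2 / (l + m), now read as D = Q - m U for
  \<open>generating_fun_bounds\<close>.\<close>

lemma yosida_sqrt:
  assumes q: "sq_int (\<mu> q) (\<lambda>l. l)" and sq: "sq_int (\<mu> q) sqrt"
  shows "inner (\<Phi> sqrt q) (\<Phi> (yosida m) (\<Phi> sqrt q)) = inner q (\<Phi> (\<lambda>l. l) q) - m * inner q (\<Phi> (yosida m) q)"
proof -
  note y = ess_bdd_sq_int[OF yosida_ess_bdd, of q]
  have "inner (\<Phi> sqrt q) (\<Phi> (yosida m) (\<Phi> sqrt q)) = (\<integral>l. sqrt l * (yosida m l * sqrt l) \<partial>\<mu> q)"
    unfolding \<Phi>_comp_bdd[OF yosida_ess_bdd sq]
    by (rule inner_\<Phi>[OF sq sq_int_ess_bdd_mult[OF yosida_ess_bdd sq]])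
  also have "\<dots> = (\<integral>l. yosida m l * l \<partial>\<mu> q)"
  proof (rule integral_cong_AE)
    show "AE l in \<mu> q. sqrt l * (yosida m l * sqrt l) = yosida m l * l"
      using AE_spectrum[of q] by eventually_elim (simp add: mult.left_commute)
  qed auto
  also have "\<dots> = inner (\<Phi> (yosida m) q) (\<Phi> (\<lambda>l. l) q)"
    by (rule inner_\<Phi>[OF y q, symmetric])
  finally show ?thesis
    unfolding yosida_sym yosida_A[OF q] by (simp add: inner_diff_right)
qed

end

text \<open>For s = 2 the vector A^(1/2) q lies in $H^1$, and l <= (1 + l)^(1/2) l^(1/2) on the
  spectrum puts q into the domain of A.\<close>

lemma solution_regularity:
  assumes sol: "K_minus_solution_inf A I q p" and t: "t \<in> I"
  shows "sq_int (\<mu> (q t)) sqrt" "sq_int (\<mu> (q t)) (\<lambda>l. l)" "op_form A (q t) < 1"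
proof -
  have "K_minus_solution A 2 I q p" using sol by (simp add: K_minus_solution_inf_def)
  then have *: "q t \<in> sqrt_dom A" "sqrt_op A (q t) \<in> Hs A 1" "op_form A (q t) < 1"
    using t by (auto simp: K_minus_solution_def phase_space_def)
  show sq: "sq_int (\<mu> (q t)) sqrt" using * by (simp add: sqrt_dom_eq)
  show "op_form A (q t) < 1" by fact
  have "sq_int (\<mu> (\<Phi> sqrt (q t))) (Hs_weight 1)"
    using * by (simp add: Hs_eq sqrt_op_eq)
  then have "sq_int (\<mu> (q t)) (\<lambda>l. Hs_weight 1 l * sqrt l)"
    using sq_int_\<Phi>_iff[OF sq] by simp
  then show "sq_int (\<mu> (q t)) (\<lambda>l. l)"
  proof (rule sq_int_bound)
    show "AE l in \<mu> (q t). \<bar>l\<bar> \<le> \<bar>Hs_weight 1 l * sqrt l\<bar>"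
      using AE_spectrum[of "q t"]
    proof eventually_elim
      case (elim l)
      then have "l = sqrt l * sqrt l" by simp
      also have "\<dots> \<le> sqrt (1 + l) * sqrt l" using elim by (intro mult_right_mono) auto
      finally show ?case using elim by (simp add: Hs_weight_def powr_half_sqrt)
    qed
  qed simp
qed

text \<open>Continuity of A q is not among the clauses of a solution. It is extracted from the
  continuous derivative -c^2 A q of p by multiplying with (1 - <q, A q>)^2, which is continuous
  because A^(1/2) q is.\<close>

lemma solution_equations:
  assumes sol: "K_minus_solution_inf A I q p" and t: "t \<in> I" and I: "open I"
  shows "(q has_vector_derivative p t) (at t)"
    and "(p has_vector_derivative - ((c_minus A (q t))\<^sup>2 *\<^sub>R \<Phi> (\<lambda>l. l) (q t))) (at t)"
    and "isCont (\<lambda>t. \<Phi> (\<lambda>l. l) (q t)) t"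
proof -
  have 1: "K_minus_solution A 1 I q p" and 2: "K_minus_solution A 2 I q p"
    using sol by (simp_all add: K_minus_solution_inf_def)
  show "(q has_vector_derivative p t) (at t)" using 1 t by (simp add: K_minus_solution_def)
  have img: "Hs_coord_of_image A 0 (q s) = \<Phi> (\<lambda>l. l) (q s)" if "s \<in> I" for s
  proof -
    note q = solution_regularity(2)[OF sol that]
    have AE: "AE l in \<mu> (q s). l = Hs_weight 0 l * l"
      using AE_spectrum by eventually_elim (simp add: Hs_weight_zero)
    have m: "(\<lambda>l. Hs_weight 0 l * l) \<in> borel_measurable borel" by measurable
    have "sq_int (\<mu> (q s)) (\<lambda>l. Hs_weight 0 l * l)"
      by (rule sq_int_bound[OF q]) (use AE m in auto)
    then have "Hs_coord_of_image A 0 (q s) = \<Phi> (\<lambda>l. Hs_weight 0 l * l) (q s)"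
      by (simp add: Hs_coord_of_image_def fun_op_eq)
    also have "\<dots> = \<Phi> (\<lambda>l. l) (q s)" by (rule \<Phi>_cong_AE[OF q m AE])
    finally show ?thesis .
  qed
  have C1: "Hs_C1_on A 0 I p (\<lambda>t. - ((c_minus A (q t))\<^sup>2 *\<^sub>R Hs_coord_of_image A 0 (q t)))"
    using 2 by (simp add: K_minus_solution_def)
  then show "(p has_vector_derivative - ((c_minus A (q t))\<^sup>2 *\<^sub>R \<Phi> (\<lambda>l. l) (q t))) (at t)"
    using t img by (simp add: Hs_C1_on_def Hs_coord_zero)
  have cont: "continuous_on I (\<lambda>t. - ((c_minus A (q t))\<^sup>2 *\<^sub>R Hs_coord_of_image A 0 (q t)))"
    using C1 by (simp add: Hs_C1_on_def)
  have r: "continuous_on I (\<lambda>t. sqrt_op A (q t))"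
    using 1 by (simp add: K_minus_solution_def Hs_continuous_on_def Hs_coord_zero)
  have inv: "continuous_on I (\<lambda>t. (1 - op_form A (q t))\<^sup>2)"
    unfolding op_form_def by (intro continuous_intros r)
  have "continuous_on I (\<lambda>t. - ((1 - op_form A (q t))\<^sup>2 *\<^sub>R - ((c_minus A (q t))\<^sup>2 *\<^sub>R Hs_coord_of_image A 0 (q t))))"
    by (intro continuous_intros inv cont)
  moreover have "- ((1 - op_form A (q t))\<^sup>2 *\<^sub>R - ((c_minus A (q t))\<^sup>2 *\<^sub>R Hs_coord_of_image A 0 (q t)))
      = \<Phi> (\<lambda>l. l) (q t)" if "t \<in> I" for t
    using solution_regularity(3)[OF sol that] img[OF that]
    by (simp add: c_minus_def power_divide)
  ultimately have "continuous_on I (\<lambda>t. \<Phi> (\<lambda>l. l) (q t))"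
    by (simp cong: continuous_on_cong)
  then show "isCont (\<lambda>t. \<Phi> (\<lambda>l. l) (q t)) t"
    using I t by (simp add: continuous_on_eq_continuous_at)
qed

text \<open>Because Q / (1 - Q) = c - 1. Thus 1 + 2 H is the conserved quantity of
  \<open>kirchhoff_energy\<close>, and it bounds c at all times.\<close>

lemma H_minus_eq:
  assumes "op_form A q < 1"
  shows "1 + 2 * H_minus A (q, p) = inner p p + c_minus A q"
  using assms by (simp add: H_minus_def c_minus_def field_simps)

lemma c_minus_ge_one: "op_form A q < 1 \<Longrightarrow> 1 \<le> c_minus A q"
  by (simp add: c_minus_def op_form_def)

text \<open>For the constant weight the energy takes the place of G: as c Q = c - 1, the quantity c
  Q + |p|^2 is conserved.\<close>

lemma
  assumes sol: "K_minus_solution_inf A I q p" and I: "open_interval I" "0 \<in> I" "t \<in> I"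
  shows solution_yosida: "0 < m \<Longrightarrow> weighted (\<lambda>l. ennreal (yosida m l)) (q t, p t)
      \<le> ennreal ((1 + 2 * H_minus A (q 0, p 0))\<^sup>2) * weighted (\<lambda>l. ennreal (yosida m l)) (q 0, p 0)"
    and solution_mass: "weighted (\<lambda>_. 1) (q t, p t)
      \<le> ennreal ((1 + 2 * H_minus A (q 0, p 0))\<^sup>2) * weighted (\<lambda>_. 1) (q 0, p 0)"
proof -
  have oI: "open I" and cI: "convex I"
    using I by (auto simp: open_interval_def is_interval_convex_1)
  define z where "z t = \<Phi> (\<lambda>l. l) (q t)" for t
  define c where "c t = c_minus A (q t)" for t
  define Q where "Q t = op_form A (q t)" for t
  define E where "E = 1 + 2 * H_minus A (q 0, p 0)"
  note reg = solution_regularity[OF sol]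
  note eqs = solution_equations[OF sol _ oI]
  have Q: "Q s = inner (q s) (z s)" if "s \<in> I" for s
    using op_form_eq reg[OF that] by (simp add: Q_def z_def)
  have Q0: "0 \<le> Q s" for s by (simp add: Q_def op_form_def)
  have Q1: "Q s < 1" if "s \<in> I" for s using reg[OF that] by (simp add: Q_def)
  have cQ: "c s = 1 / (1 - Q s)" for s by (simp add: c_def Q_def c_minus_def)
  have c1: "1 \<le> c s" if "s \<in> I" for s
    using c_minus_ge_one reg[OF that] by (simp add: c_def)
  have cQ1: "c s * (1 - Q s) = 1" if "s \<in> I" for s
    using Q1[OF that] by (simp add: cQ)
  have q': "(q has_vector_derivative p s) (at s)" if "s \<in> I" for s by (rule eqs(1)[OF that])
  have p': "(p has_vector_derivative - ((c s)\<^sup>2 *\<^sub>R z s)) (at s)" if "s \<in> I" for s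
    unfolding c_def z_def by (rule eqs(2)[OF that])
  have Q': "(Q has_real_derivative 2 * inner (p s) (z s)) (at s)" if s: "s \<in> I" for s
  proof -
    have "((\<lambda>s. inner (q s) (z s)) has_real_derivative 2 * inner (p s) (z s)) (at s)"
    proof (rule symmetric_form_derivative[OF oI s q'[OF s]])
      show "isCont z s" using eqs(3)[OF s] by (simp add: z_def[abs_def])
      show "inner (q s') (z s) = inner (z s') (q s)" if "s' \<in> I" for s'
        unfolding z_def using \<Phi>_sym[OF reg(2)[OF that] reg(2)[OF s]] by simp
    qed
    then show ?thesis
      using Q has_field_derivative_transform_within_open[OF _ oI s, of _ _ Q] by simp
  qed
  have c': "(c has_real_derivative 2 * (c s)\<^sup>2 * inner (p s) (z s)) (at s)" if s: "s \<in> I" for s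
  proof -
    have "((\<lambda>s. 1 / (1 - Q s)) has_real_derivative 2 * (c s)\<^sup>2 * inner (p s) (z s)) (at s)"
      using Q1[OF s] by (auto intro!: derivative_eq_intros Q'[OF s] simp: cQ power2_eq_square)
    moreover have "(\<lambda>s. 1 / (1 - Q s)) = c" using cQ by (simp add: fun_eq_iff)
    ultimately show ?thesis by simp
  qed
  have E: "E = inner (p 0) (p 0) + c 0"
    unfolding E_def c_def by (rule H_minus_eq[OF reg(3)[OF I(2)]])
  have energy: "inner (p t) (p t) + c t = E"
    unfolding E by (rule kirchhoff_energy[OF cI p' c' I(3) I(2)])
  have ct: "c t \<le> E" using energy inner_ge_zero[of "p t"] by linarith
  have c0: "c 0 \<le> E" using E inner_ge_zero[of "p 0"] by linarith
  have E1: "1 \<le> E" using c1[OF I(3)] ct by linarith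
  show "weighted (\<lambda>_. 1) (q t, p t) \<le> ennreal ((1 + 2 * H_minus A (q 0, p 0))\<^sup>2) * weighted (\<lambda>_. 1) (q 0, p 0)"
  proof -
    have w: "weighted (\<lambda>_. 1) (q s, p s) = ennreal (Q s + inner (p s) (p s))" for s
      by (simp add: weighted_def emeasure_scalar_measure E_UNIV Q_def op_form_def power2_norm_eq_inner)
    have cc: "c s * Q s = c s - 1" if "s \<in> I" for s
      using cQ1[OF that] by (simp add: algebra_simps)
    have "Q t * 1 \<le> Q t * c t" by (rule mult_left_mono[OF c1[OF I(3)] Q0])
    then have "Q t + inner (p t) (p t) \<le> c t * Q t + inner (p t) (p t)" by (simp add: mult.commute)
    also have "\<dots> = c 0 * Q 0 + inner (p 0) (p 0)"
      using cc[OF I(3)] cc[OF I(2)] energy E by simp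
    also have "\<dots> \<le> E * Q 0 + E * inner (p 0) (p 0)"
    proof (rule add_mono)
      show "c 0 * Q 0 \<le> E * Q 0" by (rule mult_right_mono[OF c0 Q0])
      show "inner (p 0) (p 0) \<le> E * inner (p 0) (p 0)"
        using mult_right_mono[OF E1 inner_ge_zero[of "p 0"]] by simp
    qed
    also have "\<dots> = E * (Q 0 + inner (p 0) (p 0))" by (simp add: distrib_left)
    also have "\<dots> \<le> E\<^sup>2 * (Q 0 + inner (p 0) (p 0))"
      using E1 Q0[of 0] inner_ge_zero[of "p 0"]
      by (intro mult_right_mono) (auto simp: power2_eq_square)
    finally show ?thesis
      unfolding w E_def[symmetric] using Q0[of 0] by (subst ennreal_mult[symmetric]) auto
  qed
  assume m: "0 < m"
  let ?N = "\<Phi> (yosida m)"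
  define G where "G s = generating_fun ?N m (c s) (q s) (p s)" for s
  define D where "D s = inner (\<Phi> sqrt (q s)) (?N (\<Phi> sqrt (q s)))" for s
  define P where "P s = inner (p s) (?N (p s))" for s
  have D0: "0 \<le> D s" "0 \<le> P s" for s unfolding D_def P_def by (rule yosida_form_nonneg[OF m])+
  have GG: "G t = G 0"
    unfolding G_def
  proof (rule kirchhoff_conserved(1)[OF cI q' p' c' bounded_linear_\<Phi>[OF yosida_ess_bdd[OF m]]])
    show "?N (z s) = z s - m *\<^sub>R ?N (q s)" if "s \<in> I" for s
      unfolding z_def by (rule yosida_A[OF m reg(2)[OF that]])
  qed (use cQ1 Q I yosida_sym[OF m] in auto)
  have bnds: "c s * D s + P s / c s \<le> G s - 1 \<and> G s - 1 \<le> c s * D s + P s" if s: "s \<in> I" for s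
  proof -
    have D: "D s = Q s - m * inner (q s) (?N (q s))"
      unfolding D_def using yosida_sqrt[OF m reg(2)[OF s] reg(1)[OF s]] Q[OF s] by (simp add: z_def)
    show ?thesis
      unfolding G_def
      using generating_fun_bounds[OF m c1[OF s] cQ1[OF s] D D0(1) D0(2) refl P_def]
        yosida_Cauchy_Schwarz[OF m, of "q s" "p s"] by (simp add: P_def)
  qed
  have w: "weighted (\<lambda>l. ennreal (yosida m l)) (q s, p s) = ennreal (D s + P s)" if s: "s \<in> I" for s
    using D0 reg(1)[OF s] by (simp add: weighted_def D_def P_def yosida_form[OF m, symmetric] sqrt_op_eq sqrt_dom_eq)
  \<comment> \<open>The lower bound for G - 1 contains only P / c. Multiplying by c restores P and,
    as c is at least 1, keeps at least D. Bounding this c by E costs one factor E; the coefficient c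
    0 at the initial time costs the other.\<close>
  have "D t + P t \<le> c t * (c t * D t + P t / c t)"
  proof -
    have "D t * 1 \<le> D t * (c t * c t)"
      using c1[OF I(3)] mult_mono[of 1 "c t" 1 "c t"] by (intro mult_left_mono D0) auto
    moreover have "c t * (P t / c t) = P t" using c1[OF I(3)] by simp
    ultimately show ?thesis by (simp add: distrib_left mult_ac)
  qed
  also have "\<dots> \<le> E * (c t * D t + P t / c t)"
    using ct c1[OF I(3)] D0 by (intro mult_right_mono) auto
  also have "\<dots> \<le> E * (c 0 * D 0 + P 0)"
    using bnds[OF I(3)] bnds[OF I(2)] GG E1 by (intro mult_left_mono) auto
  also have "\<dots> \<le> E * (E * (D 0 + P 0))"
  proof (intro mult_left_mono)
    have "c 0 * D 0 \<le> E * D 0" using c0 D0 by (intro mult_right_mono)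
    moreover have "1 * P 0 \<le> E * P 0" using E1 D0 by (intro mult_right_mono)
    ultimately show "c 0 * D 0 + P 0 \<le> E * (D 0 + P 0)" by (simp add: distrib_left)
  qed (use E1 in simp)
  finally have "D t + P t \<le> E\<^sup>2 * (D 0 + P 0)" by (simp add: power2_eq_square mult.assoc)
  then show "weighted (\<lambda>l. ennreal (yosida m l)) (q t, p t)
      \<le> ennreal ((1 + 2 * H_minus A (q 0, p 0))\<^sup>2) * weighted (\<lambda>l. ennreal (yosida m l)) (q 0, p 0)"
    unfolding w[OF I(3)] w[OF I(2)] E_def[symmetric]
    using D0 by (subst ennreal_mult[symmetric]) (auto intro: ennreal_leI simp del: ennreal_plus)
qed

end

section \<open>A dyadic superposition of the weights\<close>

text \<open>For \<open>0 \<le> \<sigma> < 1\<close> the function \<open>\<Sum>n. m\<^sup>\<sigma> (2\<^sup>n\<^sup>\<sigma> - 2\<^sup>(\<^sup>n\<^sup>-\<^sup>1\<^sup>)\<^sup>\<sigma>) l / (l + 2\<^sup>n m)\<close>, whose first term is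
  \<open>m\<^sup>\<sigma> l / (l + m)\<close>, is comparable with \<open>l\<^sup>\<sigma>\<close> for \<open>l \<ge> m\<close> and is at most of order
  \<open>m\<^sup>\<sigma>\<^sup>-\<^sup>1 l\<close> for \<open>l < m\<close>.  Taking increments of \<open>2\<^sup>n\<^sup>\<sigma>\<close> makes this true for \<open>\<sigma> = 0\<close> too.\<close>

definition dyadic_coeff :: "real \<Rightarrow> nat \<Rightarrow> real" where
  "dyadic_coeff \<sigma> n = (case n of 0 \<Rightarrow> 1 | Suc k \<Rightarrow> 2 powr (real (Suc k) * \<sigma>) - 2 powr (real k * \<sigma>))"

definition dyadic :: "real \<Rightarrow> real \<Rightarrow> real \<Rightarrow> ennreal" where
  "dyadic \<sigma> m l = (\<Sum>n. ennreal (m powr \<sigma> * dyadic_coeff \<sigma> n) * ennreal (yosida (m * 2 ^ n) l))"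

text \<open>The sum of the geometric series with ratio 2^(sigma - 1), finite because sigma <
  1.\<close>

definition dyadic_const :: "real \<Rightarrow> real" where
  "dyadic_const \<sigma> = 1 / (1 - 2 powr (\<sigma> - 1))"

context
  fixes \<sigma> :: real
  assumes \<sigma>: "0 \<le> \<sigma>" "\<sigma> < 1"
begin

lemma dyadic_coeff_bounds: "0 \<le> dyadic_coeff \<sigma> n" "dyadic_coeff \<sigma> n \<le> 2 powr (real n * \<sigma>)"
  using \<sigma> by (auto simp: dyadic_coeff_def mult_right_mono split: nat.split)

lemma dyadic_coeff_sum: "(\<Sum>k\<le>n. dyadic_coeff \<sigma> k) = 2 powr (real n * \<sigma>)"
  by (induction n) (auto simp: dyadic_coeff_def)

lemma ratio_bounds: "0 < 2 powr (\<sigma> - 1)" "2 powr (\<sigma> - 1) < (1::real)"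
  using \<sigma> by (auto simp: powr_less_one)

lemma dyadic_const_pos: "0 < dyadic_const \<sigma>"
  using ratio_bounds by (simp add: dyadic_const_def)

lemma geometric_term:
  assumes "0 < m"
  shows "m powr \<sigma> * 2 powr (real n * \<sigma>) / (m * 2 ^ n) = m powr (\<sigma> - 1) * (2 powr (\<sigma> - 1)) ^ n"
proof -
  have "(2 powr (\<sigma> - 1)) ^ n = 2 powr (real n * \<sigma>) / 2 ^ n"
    by (simp add: powr_realpow[symmetric] powr_powr powr_diff[symmetric] algebra_simps)
  moreover have "m powr (\<sigma> - 1) = m powr \<sigma> / m" using assms by (simp add: powr_diff)
  ultimately show ?thesis by simp
qed

lemma dyadic_term_le:
  assumes "0 < m" "0 \<le> l"
  shows "m powr \<sigma> * dyadic_coeff \<sigma> n * yosida (m * 2 ^ n) l \<le> m powr (\<sigma> - 1) * l * (2 powr (\<sigma> - 1)) ^ n"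
proof -
  have "m powr \<sigma> * dyadic_coeff \<sigma> n * yosida (m * 2 ^ n) l
      \<le> m powr \<sigma> * 2 powr (real n * \<sigma>) * (l / (m * 2 ^ n))"
    using assms dyadic_coeff_bounds
    by (intro mult_mono) (auto simp: yosida_def intro!: divide_left_mono mult_pos_pos add_nonneg_pos)
  also have "\<dots> = (m powr \<sigma> * 2 powr (real n * \<sigma>) / (m * 2 ^ n)) * l" by simp
  finally show ?thesis unfolding geometric_term[OF assms(1)] by (simp add: mult_ac)
qed

lemma dyadic_term_nonneg: "0 < m \<Longrightarrow> 0 \<le> m powr \<sigma> * dyadic_coeff \<sigma> n * yosida (m * 2 ^ n) l"
  using dyadic_coeff_bounds yosida_bounds[of "m * 2 ^ n" l] by simp

lemma dyadic_eq: "0 < m \<Longrightarrow> dyadic \<sigma> m l = (\<Sum>n. ennreal (m powr \<sigma> * dyadic_coeff \<sigma> n * yosida (m * 2 ^ n) l))"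
  unfolding dyadic_def using dyadic_coeff_bounds yosida_bounds[of "m * 2 ^ _" l]
  by (simp add: ennreal_mult)

lemma dyadic_le_sums:
  assumes "0 < m" "\<And>n. m powr \<sigma> * dyadic_coeff \<sigma> n * yosida (m * 2 ^ n) l \<le> f n" "f sums S"
  shows "dyadic \<sigma> m l \<le> ennreal S"
proof -
  have "0 \<le> f n" for n using dyadic_term_nonneg[OF assms(1), of n l] assms(2)[of n] by linarith
  then have "(\<Sum>n. ennreal (f n)) = ennreal S" using assms(3) by (rule suminf_ennreal_eq)
  moreover have "dyadic \<sigma> m l \<le> (\<Sum>n. ennreal (f n))"
    unfolding dyadic_eq[OF assms(1)] using assms(2) by (intro suminf_le ennreal_leI) auto
  ultimately show ?thesis by simp
qed

lemma dyadic_le_linear: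
  assumes "0 < m" "0 \<le> l"
  shows "dyadic \<sigma> m l \<le> ennreal (dyadic_const \<sigma> * m powr (\<sigma> - 1) * l)"
proof -
  have "(\<lambda>n. (m powr (\<sigma> - 1) * l) * (2 powr (\<sigma> - 1)) ^ n) sums ((m powr (\<sigma> - 1) * l) * (1 / (1 - 2 powr (\<sigma> - 1))))"
    using ratio_bounds by (intro sums_mult geometric_sums) auto
  from dyadic_le_sums[OF assms(1) dyadic_term_le[OF assms] this] show ?thesis
    by (simp add: dyadic_const_def mult_ac)
qed

lemma dyadic_scale_exists:
  fixes m l :: real
  assumes "0 < m" "m \<le> l"
  obtains n where "m * 2 ^ n \<le> l" "l < m * 2 ^ Suc n"
proof -
  obtain N where "l / m < 2 ^ N" using real_arch_pow[of 2 "l / m"] by auto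
  then have N: "l < m * 2 ^ N" using assms(1) by (simp add: field_simps)
  define k where "k = (LEAST k. l < m * 2 ^ k)"
  have k: "l < m * 2 ^ k" unfolding k_def by (rule LeastI[of _ N]) (rule N)
  then have "k \<noteq> 0" using assms(2) by (intro notI) simp
  then obtain n where n: "k = Suc n" using not0_implies_Suc by blast
  have "\<not> l < m * 2 ^ n" by (rule not_less_Least) (simp add: k_def[symmetric] n)
  then show thesis using k n by (intro that[of n]) auto
qed

text \<open>At every scale up to l the weight is at least 1 / 2, and the coefficients of these
  scales telescope to (m 2^n)^sigma. One factor 1 / 2 of the constant comes from the weights, the
  other from l < 2 m 2^n with 2^sigma <= 2.\<close>

lemma dyadic_ge:
  assumes "0 < m" "m \<le> l"
  shows "ennreal (l powr \<sigma> / 4) \<le> dyadic \<sigma> m l"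
proof -
  obtain n where n: "m * 2 ^ n \<le> l" "l < m * 2 ^ Suc n" using dyadic_scale_exists[OF assms] .
  have half: "1 / 2 \<le> yosida (m * 2 ^ k) l" if "k \<le> n" for k
  proof -
    have "m * 2 ^ k \<le> m * 2 ^ n" using that assms(1) by simp
    then have "m * 2 ^ k \<le> l" using n(1) by linarith
    moreover have "0 < m * 2 ^ k" "0 < l" using assms by auto
    ultimately show ?thesis by (simp add: yosida_def field_simps)
  qed
  have "l powr \<sigma> \<le> (m * 2 ^ Suc n) powr \<sigma>" using n(2) assms \<sigma> by (intro powr_mono2) auto
  also have "\<dots> = m powr \<sigma> * 2 powr (real n * \<sigma>) * 2 powr \<sigma>"
    using assms(1) by (simp add: powr_mult powr_realpow[symmetric] powr_powr powr_add[symmetric] algebra_simps)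
  also have "\<dots> \<le> m powr \<sigma> * 2 powr (real n * \<sigma>) * 2 powr 1"
    using \<sigma> by (intro mult_left_mono powr_mono) auto
  finally have "l powr \<sigma> / 4 \<le> m powr \<sigma> * 2 powr (real n * \<sigma>) * (1 / 2)" by simp
  also have "\<dots> = (\<Sum>k\<le>n. m powr \<sigma> * dyadic_coeff \<sigma> k * (1 / 2))"
    by (simp add: dyadic_coeff_sum[symmetric] sum_distrib_left sum_divide_distrib)
  also have "\<dots> \<le> (\<Sum>k\<le>n. m powr \<sigma> * dyadic_coeff \<sigma> k * yosida (m * 2 ^ k) l)"
    using half dyadic_coeff_bounds by (intro sum_mono mult_left_mono) auto
  finally have "ennreal (l powr \<sigma> / 4) \<le> ennreal (\<Sum>k\<le>n. m powr \<sigma> * dyadic_coeff \<sigma> k * yosida (m * 2 ^ k) l)"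
    by (rule ennreal_leI)
  also have "\<dots> = (\<Sum>k\<le>n. ennreal (m powr \<sigma> * dyadic_coeff \<sigma> k * yosida (m * 2 ^ k) l))"
    by (rule sum_ennreal[symmetric]) (rule dyadic_term_nonneg[OF assms(1)])
  also have "\<dots> \<le> dyadic \<sigma> m l"
    unfolding dyadic_eq[OF assms(1)] by (rule sum_le_suminf) auto
  finally show ?thesis .
qed

lemma dyadic_le_powr:
  assumes "0 < m" "m \<le> l"
  shows "dyadic \<sigma> m l \<le> ennreal ((1 + dyadic_const \<sigma>) * l powr \<sigma>)"
proof -
  obtain n where n: "m * 2 ^ n \<le> l" "l < m * 2 ^ Suc n" using dyadic_scale_exists[OF assms] .
  let ?\<theta> = "2 powr (\<sigma> - 1)"
  \<comment> \<open>The series is split at the scale of l. Up to it the weights are bounded by 1 and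
    the coefficients telescope to (m 2^n)^sigma, at most l^sigma; beyond it the linear bound leaves
    a geometric tail, at most a constant times l (m 2^(n+1))^(sigma - 1), where the exponent is
    negative and l < m 2^(n+1).\<close>
  define f where "f k = (if k \<in> {..n} then m powr \<sigma> * dyadic_coeff \<sigma> k else 0)" for k
  define g where "g k = (if k < Suc n then 0 else m powr (\<sigma> - 1) * l * ?\<theta> ^ k)" for k
  have f: "f sums (m powr \<sigma> * 2 powr (real n * \<sigma>))"
  proof -
    have "f sums (\<Sum>k\<in>{..n}. m powr \<sigma> * dyadic_coeff \<sigma> k)"
      unfolding f_def by (rule sums_If_finite_set) simp
    then show ?thesis by (simp add: sum_distrib_left[symmetric] dyadic_coeff_sum)
  qed
  have g: "g sums (m powr (\<sigma> - 1) * l * ?\<theta> ^ Suc n * dyadic_const \<sigma>)"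
  proof -
    have "(\<lambda>k. m powr (\<sigma> - 1) * l * ?\<theta> ^ Suc n * ?\<theta> ^ k) sums (m powr (\<sigma> - 1) * l * ?\<theta> ^ Suc n * dyadic_const \<sigma>)"
      unfolding dyadic_const_def using ratio_bounds by (intro sums_mult geometric_sums) auto
    then have "(\<lambda>k. g (k + Suc n)) sums (m powr (\<sigma> - 1) * l * ?\<theta> ^ Suc n * dyadic_const \<sigma>)"
      by (simp add: g_def power_add mult_ac)
    then show ?thesis
      by (subst (asm) sums_zero_iff_shift) (auto simp: g_def)
  qed
  have l: "0 < l" using assms by simp
  have le: "m powr \<sigma> * dyadic_coeff \<sigma> k * yosida (m * 2 ^ k) l \<le> f k + g k" for k
  proof (cases "k \<le> n")
    case True
    have "m powr \<sigma> * dyadic_coeff \<sigma> k * yosida (m * 2 ^ k) l \<le> m powr \<sigma> * dyadic_coeff \<sigma> k * 1"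
      using dyadic_coeff_bounds yosida_bounds[of "m * 2 ^ k" l] assms(1) by (intro mult_left_mono) auto
    then show ?thesis using True by (simp add: f_def g_def)
  next
    case False
    then show ?thesis using dyadic_term_le[OF assms(1), of l k] l by (simp add: f_def g_def)
  qed
  have "dyadic \<sigma> m l \<le> ennreal (m powr \<sigma> * 2 powr (real n * \<sigma>) + m powr (\<sigma> - 1) * l * ?\<theta> ^ Suc n * dyadic_const \<sigma>)"
    by (rule dyadic_le_sums[OF assms(1) le sums_add[OF f g]])
  also have "\<dots> \<le> ennreal ((1 + dyadic_const \<sigma>) * l powr \<sigma>)"
  proof (rule ennreal_leI)
    have 1: "m powr \<sigma> * 2 powr (real n * \<sigma>) = (m * 2 ^ n) powr \<sigma>"
      using assms(1) by (simp add: powr_mult powr_realpow[symmetric] powr_powr)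
    have 2: "m powr (\<sigma> - 1) * ?\<theta> ^ Suc n = (m * 2 ^ Suc n) powr (\<sigma> - 1)"
      using assms(1) by (simp add: powr_mult powr_realpow[symmetric] powr_powr powr_add[symmetric] algebra_simps del: power_Suc)
    have "(m * 2 ^ n) powr \<sigma> \<le> l powr \<sigma>" using n(1) \<sigma> assms(1) by (intro powr_mono2) auto
    moreover have "(m * 2 ^ Suc n) powr (\<sigma> - 1) \<le> l powr (\<sigma> - 1)"
      using n(2) \<sigma> l by (intro powr_mono2') auto
    then have "(m * 2 ^ Suc n) powr (\<sigma> - 1) * (l * dyadic_const \<sigma>) \<le> l powr (\<sigma> - 1) * (l * dyadic_const \<sigma>)"
      using l dyadic_const_pos by (intro mult_right_mono) auto
    moreover have "l powr (\<sigma> - 1) * (l * dyadic_const \<sigma>) = dyadic_const \<sigma> * l powr \<sigma>"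
      using l by (simp add: powr_diff)
    ultimately have "m powr \<sigma> * 2 powr (real n * \<sigma>) + (m powr (\<sigma> - 1) * ?\<theta> ^ Suc n) * (l * dyadic_const \<sigma>)
        \<le> l powr \<sigma> + dyadic_const \<sigma> * l powr \<sigma>"
      unfolding 1 2 by linarith
    then show "m powr \<sigma> * 2 powr (real n * \<sigma>) + m powr (\<sigma> - 1) * l * ?\<theta> ^ Suc n * dyadic_const \<sigma>
        \<le> (1 + dyadic_const \<sigma>) * l powr \<sigma>" by (simp add: algebra_simps)
  qed
  finally show ?thesis .
qed

text \<open>A factor 2 comes from 1 + l <= 2 l, valid as l >= 1, and a factor 4 from
  \<open>dyadic_ge\<close>.\<close>

lemma powr_le_dyadic:
  assumes "1 \<le> m" "m \<le> l"
  shows "ennreal ((1 + l) powr \<sigma>) \<le> 8 * dyadic \<sigma> m l"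
proof -
  have "(1 + l) powr \<sigma> \<le> (2 * l) powr \<sigma>" using assms \<sigma> by (intro powr_mono2) auto
  also have "\<dots> = 2 powr \<sigma> * l powr \<sigma>" using assms by (simp add: powr_mult)
  also have "\<dots> \<le> 2 powr 1 * l powr \<sigma>" using \<sigma> by (intro mult_right_mono powr_mono) auto
  finally have "ennreal ((1 + l) powr \<sigma>) \<le> ennreal (8 * (l powr \<sigma> / 4))" by (intro ennreal_leI) simp
  also have "\<dots> = 8 * ennreal (l powr \<sigma> / 4)" by (subst ennreal_mult) auto
  also have "\<dots> \<le> 8 * dyadic \<sigma> m l" using assms by (intro mult_left_mono dyadic_ge) auto
  finally show ?thesis .
qed

text \<open>Below k the linear bound applies with l < k, above k the bound by l^sigma. The point is
  that the coefficient of the first term tends to 0 as m grows with k fixed.\<close>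

lemma dyadic_le_split:
  assumes m: "0 < m" and k: "0 < k" and l: "0 \<le> l"
  shows "dyadic \<sigma> m l \<le> ennreal (dyadic_const \<sigma> * m powr (\<sigma> - 1) * k) * ennreal ((1 + l) powr \<sigma>)
      + ennreal (1 + dyadic_const \<sigma>) * (indicator {k..} l * ennreal ((1 + l) powr \<sigma>))"
proof (cases "l < k")
  case True
  have "dyadic \<sigma> m l \<le> ennreal (dyadic_const \<sigma> * m powr (\<sigma> - 1) * l)" by (rule dyadic_le_linear[OF m l])
  also have "\<dots> \<le> ennreal ((dyadic_const \<sigma> * m powr (\<sigma> - 1) * k) * (1 + l) powr \<sigma>)"
  proof (rule ennreal_leI)
    have "1 \<le> (1 + l) powr \<sigma>" using l \<sigma> by (simp add: ge_one_powr_ge_zero)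
    moreover have "dyadic_const \<sigma> * m powr (\<sigma> - 1) * l \<le> dyadic_const \<sigma> * m powr (\<sigma> - 1) * k"
      using True dyadic_const_pos by (intro mult_left_mono) auto
    moreover have "0 \<le> dyadic_const \<sigma> * m powr (\<sigma> - 1) * k" using k dyadic_const_pos by simp
    ultimately show "dyadic_const \<sigma> * m powr (\<sigma> - 1) * l \<le> (dyadic_const \<sigma> * m powr (\<sigma> - 1) * k) * (1 + l) powr \<sigma>"
      using mult_left_mono[of 1 "(1 + l) powr \<sigma>" "dyadic_const \<sigma> * m powr (\<sigma> - 1) * k"] by linarith
  qed
  also have "\<dots> = ennreal (dyadic_const \<sigma> * m powr (\<sigma> - 1) * k) * ennreal ((1 + l) powr \<sigma>)"
    using k dyadic_const_pos by (intro ennreal_mult) auto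
  finally show ?thesis using True by simp
next
  case False
  then have l0: "0 < l" using k by simp
  have mono: "l powr \<sigma> \<le> (1 + l) powr \<sigma>" using l \<sigma> by (intro powr_mono2) auto
  have "dyadic \<sigma> m l \<le> ennreal ((1 + dyadic_const \<sigma>) * l powr \<sigma>)"
  proof (cases "m \<le> l")
    case True
    then show ?thesis by (rule dyadic_le_powr[OF m])
  next
    case False
    have "dyadic \<sigma> m l \<le> ennreal (dyadic_const \<sigma> * m powr (\<sigma> - 1) * l)" by (rule dyadic_le_linear[OF m l])
    also have "\<dots> \<le> ennreal ((1 + dyadic_const \<sigma>) * l powr \<sigma>)"
    proof (rule ennreal_leI)
      have "m powr (\<sigma> - 1) \<le> l powr (\<sigma> - 1)" using False \<sigma> l0 by (intro powr_mono2') auto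
      then have "dyadic_const \<sigma> * (m powr (\<sigma> - 1) * l) \<le> dyadic_const \<sigma> * (l powr (\<sigma> - 1) * l)"
        using l0 dyadic_const_pos by (intro mult_left_mono mult_right_mono) auto
      also have "l powr (\<sigma> - 1) * l = l powr \<sigma>" using l0 by (simp add: powr_diff)
      finally show "dyadic_const \<sigma> * m powr (\<sigma> - 1) * l \<le> (1 + dyadic_const \<sigma>) * l powr \<sigma>"
        by (simp add: algebra_simps add_increasing)
    qed
    finally show ?thesis .
  qed
  also have "\<dots> \<le> ennreal ((1 + dyadic_const \<sigma>) * (1 + l) powr \<sigma>)"
    using mono dyadic_const_pos by (intro ennreal_leI mult_left_mono) auto
  also have "\<dots> = ennreal (1 + dyadic_const \<sigma>) * ennreal ((1 + l) powr \<sigma>)"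
    using dyadic_const_pos by (intro ennreal_mult) auto
  finally show ?thesis using False by (simp add: add_increasing)
qed

end

lemma dyadic_measurable [measurable]: "dyadic \<sigma> m \<in> borel_measurable borel"
  unfolding dyadic_def[abs_def] by measurable

section \<open>Norm bounds and equicontinuity\<close>

context nonneg_op
begin

lemma weighted_mono:
  assumes "\<And>l. 0 \<le> l \<Longrightarrow> w l \<le> w' l" shows "weighted w u \<le> weighted w' u"
proof -
  have "(\<integral>\<^sup>+l. w l \<partial>\<mu> x) \<le> (\<integral>\<^sup>+l. w' l \<partial>\<mu> x)" for x
  proof (rule nn_integral_mono_AE)
    show "AE l in \<mu> x. w l \<le> w' l" using AE_spectrum[of x] by eventually_elim (rule assms)
  qed
  then show ?thesis by (auto simp: weighted_def add_mono split: prod.split)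
qed

lemma weighted_add:
  assumes [measurable]: "w \<in> borel_measurable borel" "w' \<in> borel_measurable borel"
  shows "weighted (\<lambda>l. w l + w' l) u = weighted w u + weighted w' u"
  by (auto simp: weighted_def nn_integral_add add_ac split: prod.split)

lemma weighted_cmult:
  assumes [measurable]: "w \<in> borel_measurable borel"
  shows "weighted (\<lambda>l. a * w l) u = a * weighted w u"
  by (auto simp: weighted_def nn_integral_cmult distrib_left split: prod.split)

lemma weighted_suminf:
  assumes [measurable]: "\<And>n. w n \<in> borel_measurable borel"
  shows "weighted (\<lambda>l. \<Sum>n. w n l) u = (\<Sum>n. weighted (w n) u)"
  by (auto simp: weighted_def nn_integral_suminf suminf_add[OF summableI summableI] split: prod.split)

lemma phase_norm_power2:
  assumes "u \<in> phase_space A s"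
  shows "ennreal ((phase_norm A s u)\<^sup>2) = weighted (\<lambda>l. ennreal ((1 + l) powr (s - 1))) u"
proof (cases u)
  case (Pair q p)
  then have *: "sqrt_op A q \<in> Hs A (s - 1)" "p \<in> Hs A (s - 1)" using assms by (auto simp: phase_space_def)
  show ?thesis
    using * by (simp add: Pair phase_norm_def weighted_def Hs_norm_power2[symmetric])
qed

text \<open>The spectral projection commutes with A^(1/2), and its effect on the spectral measure of
  a vector is restriction to the upper half-line.\<close>

lemma high_proj_phase_norm:
  assumes u: "(q, p) \<in> phase_space A s"
  shows "ennreal ((phase_norm A s (high_proj A \<kappa> q, high_proj A \<kappa> p))\<^sup>2)
      = weighted (\<lambda>l. indicator {\<kappa>\<^sup>2..} l * ennreal ((1 + l) powr (s - 1))) (q, p)"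
proof -
  let ?i = "indicator {\<kappa>\<^sup>2..} :: real \<Rightarrow> real"
  have b: "ess_bdd ?i" by (rule ess_bdd_indicator) simp
  note bi = ess_bdd_sq_int[OF b]
  have P: "high_proj A \<kappa> x = \<Phi> ?i x" for x by (simp add: high_proj_def fun_op_eq[OF bi])
  have q: "sq_int (\<mu> q) sqrt" and r: "sq_int (\<mu> (\<Phi> sqrt q)) (Hs_weight (s - 1))"
    and p: "sq_int (\<mu> p) (Hs_weight (s - 1))"
    using u by (auto simp: phase_space_def sqrt_dom_eq Hs_eq sqrt_op_eq)
  have qi: "sq_int (\<mu> q) (\<lambda>l. sqrt l * ?i l)"
    using sq_int_ess_bdd_mult[OF b q] by (simp add: mult.commute)
  have Pq: "sq_int (\<mu> (\<Phi> ?i q)) sqrt" using sq_int_\<Phi>_iff[OF bi, of sqrt q] qi by simp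
  have "\<Phi> sqrt (\<Phi> ?i q) = \<Phi> (\<lambda>l. sqrt l * ?i l) q" by (rule \<Phi>_comp[OF bi qi]) simp
  also have "\<dots> = \<Phi> ?i (\<Phi> sqrt q)" by (simp add: \<Phi>_comp_bdd[OF b q] mult.commute)
  finally have comm: "\<Phi> sqrt (\<Phi> ?i q) = \<Phi> ?i (\<Phi> sqrt q)" .
  have Hs: "\<Phi> ?i x \<in> Hs A (s - 1)" if "sq_int (\<mu> x) (Hs_weight (s - 1))" for x
    using sq_int_\<Phi>_iff[OF bi, of "Hs_weight (s - 1)" x] sq_int_ess_bdd_mult[OF b that]
    by (simp add: Hs_eq mult.commute)
  have mem: "(\<Phi> ?i q, \<Phi> ?i p) \<in> phase_space A s"
    using Pq Hs[OF r] Hs[OF p] by (simp add: phase_space_def sqrt_dom_eq sqrt_op_eq comm)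
  have nn: "(\<integral>\<^sup>+l. ennreal ((1 + l) powr (s - 1)) \<partial>\<mu> (\<Phi> ?i x))
      = (\<integral>\<^sup>+l. indicator {\<kappa>\<^sup>2..} l * ennreal ((1 + l) powr (s - 1)) \<partial>\<mu> x)" for x
    by (subst nn_integral_M_\<Phi>[OF bi]) (auto intro!: nn_integral_cong simp: indicator_def)
  show ?thesis
    unfolding P phase_norm_power2[OF mem]
    using q Pq by (simp add: weighted_def nn sqrt_op_eq sqrt_dom_eq comm)
qed

text \<open>The factor in \<open>solution_yosida\<close> is the same for all m, so the estimate
  passes to infinite nonnegative combinations of the weights.\<close>

lemma solution_dyadic:
  assumes sol: "K_minus_solution_inf A I q p" and I: "open_interval I" "0 \<in> I" "t \<in> I"
    and m: "0 < m"
  shows "weighted (dyadic \<sigma> m) (q t, p t)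
      \<le> ennreal ((1 + 2 * H_minus A (q 0, p 0))\<^sup>2) * weighted (dyadic \<sigma> m) (q 0, p 0)"
proof -
  let ?a = "\<lambda>n. ennreal (m powr \<sigma> * dyadic_coeff \<sigma> n)"
  let ?y = "\<lambda>n l. ennreal (yosida (m * 2 ^ n) l)"
  have eq: "weighted (dyadic \<sigma> m) u = (\<Sum>n. ?a n * weighted (?y n) u)" for u
    unfolding dyadic_def[abs_def] by (subst weighted_suminf) (auto simp: weighted_cmult)
  have "weighted (dyadic \<sigma> m) (q t, p t)
      \<le> (\<Sum>n. ennreal ((1 + 2 * H_minus A (q 0, p 0))\<^sup>2) * (?a n * weighted (?y n) (q 0, p 0)))"
    unfolding eq
  proof (rule suminf_le[OF _ summableI summableI])
    fix n
    have "?a n * weighted (?y n) (q t, p t)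
        \<le> ?a n * (ennreal ((1 + 2 * H_minus A (q 0, p 0))\<^sup>2) * weighted (?y n) (q 0, p 0))"
      using m by (intro mult_left_mono solution_yosida[OF sol I]) auto
    then show "?a n * weighted (?y n) (q t, p t)
        \<le> ennreal ((1 + 2 * H_minus A (q 0, p 0))\<^sup>2) * (?a n * weighted (?y n) (q 0, p 0))"
      by (simp add: mult.left_commute)
  qed
  then show ?thesis unfolding eq by simp
qed

lemma solution_energy_ge_one:
  assumes "K_minus_solution_inf A I q p" "t \<in> I"
  shows "1 \<le> 1 + 2 * H_minus A (q t, p t)"
  using H_minus_eq[of "q t" "p t"] c_minus_ge_one[of "q t"] solution_regularity(3)[OF assms] inner_ge_zero[of "p t"]
  by linarith

lemma solution_phase_space:
  "K_minus_solution_inf A I q p \<Longrightarrow> t \<in> I \<Longrightarrow> 1 \<le> s \<Longrightarrow> (q t, p t) \<in> phase_space A s"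
  by (simp add: K_minus_solution_inf_def K_minus_solution_def)

lemma phase_norm_nonneg [simp]: "0 \<le> phase_norm A s u"
  by (cases u) (simp add: phase_norm_def)

lemma weighted_dyadic_le:
  assumes \<sigma>: "0 \<le> \<sigma>" "\<sigma> < 1" and m: "0 < m" and k: "0 < k"
  shows "weighted (dyadic \<sigma> m) u
    \<le> ennreal (dyadic_const \<sigma> * m powr (\<sigma> - 1) * k) * weighted (\<lambda>l. ennreal ((1 + l) powr \<sigma>)) u
      + ennreal (1 + dyadic_const \<sigma>) * weighted (\<lambda>l. indicator {k..} l * ennreal ((1 + l) powr \<sigma>)) u"
    (is "_ \<le> ?a * weighted ?w u + ?b * weighted ?v u")
proof -
  have "weighted (dyadic \<sigma> m) u \<le> weighted (\<lambda>l. ?a * ?w l + ?b * ?v l) u"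
    by (intro weighted_mono dyadic_le_split[OF \<sigma> m k])
  also have "\<dots> = ?a * weighted ?w u + ?b * weighted ?v u"
    by (subst weighted_add) (auto simp: weighted_cmult)
  finally show ?thesis .
qed

text \<open>The weight (1 + l)^sigma is at most 2 + 8 \<open>dyadic \<sigma> 1\<close>: the constant
  covers l < 1, where the dyadic weight degenerates. Initially the mass is bounded by the norm and
  the dyadic weight by 1 + 2 K times it, whence 2 + 8 (1 + 2 K) = 10 + 16 K for squared
  norms.\<close>

lemma solution_norm_bound:
  assumes s: "1 \<le> s" "s < 2"
    and sol: "K_minus_solution_inf A I q p" and I: "open_interval I" "0 \<in> I" "t \<in> I"
  shows "phase_norm A s (q t, p t) \<le> sqrt (10 + 16 * dyadic_const (s - 1))
      * (1 + 2 * H_minus A (q 0, p 0)) * phase_norm A s (q 0, p 0)"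
proof -
  define \<sigma> where "\<sigma> = s - 1"
  have \<sigma>: "0 \<le> \<sigma>" "\<sigma> < 1" using s by (auto simp: \<sigma>_def)
  let ?K = "dyadic_const \<sigma>"
  have K: "0 < ?K" by (rule dyadic_const_pos[OF \<sigma>])
  define E where "E = 1 + 2 * H_minus A (q 0, p 0)"
  have E: "1 \<le> E" unfolding E_def by (rule solution_energy_ge_one[OF sol I(2)])
  let ?w = "\<lambda>l::real. ennreal ((1 + l) powr \<sigma>)"
  have le1: "?w l \<le> 2 * 1 + 8 * dyadic \<sigma> 1 l" if "0 \<le> l" for l
  proof (cases "1 \<le> l")
    case True
    then show ?thesis using powr_le_dyadic[OF \<sigma>, of 1 l] by (simp add: add_increasing)
  next
    case False
    then have "(1 + l) powr \<sigma> \<le> 2 powr \<sigma>" using that \<sigma> by (intro powr_mono2) auto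
    also have "\<dots> \<le> 2 powr 1" using \<sigma> by (intro powr_mono) auto
    finally have "?w l \<le> ennreal 2" by (intro ennreal_leI) simp
    then show ?thesis by (simp add: add_increasing2)
  qed
  have mass: "weighted (\<lambda>_. 1) u \<le> weighted ?w u" for u
    using \<sigma> by (intro weighted_mono) (simp add: ge_one_powr_ge_zero)
  have dyad: "weighted (dyadic \<sigma> 1) u \<le> ennreal (1 + 2 * ?K) * weighted ?w u" for u
  proof -
    have "weighted (dyadic \<sigma> 1) u \<le> ennreal ?K * weighted ?w u
        + ennreal (1 + ?K) * weighted (\<lambda>l. indicator {1..} l * ?w l) u"
      using weighted_dyadic_le[OF \<sigma>, of 1 1 u] by simp
    also have "\<dots> \<le> ennreal ?K * weighted ?w u + ennreal (1 + ?K) * weighted ?w u"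
      by (intro add_left_mono mult_left_mono weighted_mono) (auto simp: indicator_def)
    also have "\<dots> = ennreal (?K + (1 + ?K)) * weighted ?w u"
      using K by (subst ennreal_plus) (auto simp: distrib_right)
    finally show ?thesis by (simp add: algebra_simps)
  qed
  have W: "weighted ?w (q r, p r) = ennreal ((phase_norm A s (q r, p r))\<^sup>2)" if "r \<in> I" for r
    unfolding \<sigma>_def by (rule phase_norm_power2[OF solution_phase_space[OF sol that s(1)], symmetric])
  have "weighted ?w (q t, p t) \<le> weighted (\<lambda>l. 2 * 1 + 8 * dyadic \<sigma> 1 l) (q t, p t)"
    by (rule weighted_mono) (rule le1)
  also have "\<dots> = 2 * weighted (\<lambda>_. 1) (q t, p t) + 8 * weighted (dyadic \<sigma> 1) (q t, p t)"
    by (subst weighted_add) (auto simp: weighted_cmult[of "\<lambda>_. 1" 2, simplified] weighted_cmult)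
  also have "\<dots> \<le> 2 * (ennreal (E\<^sup>2) * weighted (\<lambda>_. 1) (q 0, p 0)) + 8 * (ennreal (E\<^sup>2) * weighted (dyadic \<sigma> 1) (q 0, p 0))"
    unfolding E_def using solution_mass[OF sol I] solution_dyadic[OF sol I, of 1 \<sigma>]
    by (intro add_mono mult_left_mono) auto
  also have "\<dots> \<le> 2 * (ennreal (E\<^sup>2) * weighted ?w (q 0, p 0)) + 8 * (ennreal (E\<^sup>2) * (ennreal (1 + 2 * ?K) * weighted ?w (q 0, p 0)))"
    by (intro add_mono mult_left_mono mass dyad) auto
  also have "\<dots> = ennreal ((sqrt (10 + 16 * ?K) * E * phase_norm A s (q 0, p 0))\<^sup>2)"
  proof -
    let ?n = "(phase_norm A s (q 0, p 0))\<^sup>2"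
    have "(sqrt (10 + 16 * ?K) * E * phase_norm A s (q 0, p 0))\<^sup>2 = 2 * (E\<^sup>2 * ?n) + 8 * (E\<^sup>2 * ((1 + 2 * ?K) * ?n))"
      using K by (simp add: power_mult_distrib algebra_simps)
    then show ?thesis
      unfolding W[OF I(2)] using K by (simp add: ennreal_mult ennreal_plus)
  qed
  finally have "(phase_norm A s (q t, p t))\<^sup>2 \<le> (sqrt (10 + 16 * ?K) * E * phase_norm A s (q 0, p 0))\<^sup>2"
    unfolding W[OF I(3)] by (subst (asm) ennreal_le_iff) auto
  then have "phase_norm A s (q t, p t) \<le> sqrt (10 + 16 * ?K) * E * phase_norm A s (q 0, p 0)"
    by (rule power2_le_imp_le) (use E K in simp)
  then show ?thesis by (simp add: E_def \<sigma>_def)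
qed

text \<open>The dyadic weight with m = \<open>\<kappa>\<^sup>2\<close> dominates the tail at time t
  up to the factor 8. At time 0 the same weight is split at the independent threshold
  \<open>\<kappa>'\<^sup>2\<close>, so that the initial tail and the initial norm enter
  separately.\<close>

lemma solution_tail_bound:
  assumes s: "1 \<le> s" "s < 2"
    and sol: "K_minus_solution_inf A I q p" and I: "open_interval I" "0 \<in> I" "t \<in> I"
    and \<kappa>: "1 \<le> \<kappa>" and \<kappa>': "0 < \<kappa>'"
  shows "(phase_norm A s (high_proj A \<kappa> (q t), high_proj A \<kappa> (p t)))\<^sup>2
    \<le> 8 * (1 + 2 * H_minus A (q 0, p 0))\<^sup>2 *
      (dyadic_const (s - 1) * (\<kappa>\<^sup>2) powr (s - 2) * \<kappa>'\<^sup>2 * (phase_norm A s (q 0, p 0))\<^sup>2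
       + (1 + dyadic_const (s - 1)) * (phase_norm A s (high_proj A \<kappa>' (q 0), high_proj A \<kappa>' (p 0)))\<^sup>2)"
    (is "?lhs \<le> ?rhs")
proof -
  define \<sigma> where "\<sigma> = s - 1"
  have \<sigma>: "0 \<le> \<sigma>" "\<sigma> < 1" using s by (auto simp: \<sigma>_def)
  let ?K = "dyadic_const \<sigma>"
  have K: "0 < ?K" by (rule dyadic_const_pos[OF \<sigma>])
  let ?w = "\<lambda>l::real. ennreal ((1 + l) powr \<sigma>)"
  let ?E = "(1 + 2 * H_minus A (q 0, p 0))\<^sup>2"
  let ?a = "?K * (\<kappa>\<^sup>2) powr (\<sigma> - 1) * \<kappa>'\<^sup>2"
  have m: "1 \<le> \<kappa>\<^sup>2" "0 < \<kappa>\<^sup>2" "0 < \<kappa>'\<^sup>2" using \<kappa> \<kappa>' by (auto simp: one_le_power)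
  have mem: "(q t, p t) \<in> phase_space A s" "(q 0, p 0) \<in> phase_space A s"
    using solution_phase_space[OF sol _ s(1)] I by auto
  have "ennreal ?lhs = weighted (\<lambda>l. indicator {\<kappa>\<^sup>2..} l * ?w l) (q t, p t)"
    unfolding high_proj_phase_norm[OF mem(1)] \<sigma>_def ..
  also have "\<dots> \<le> weighted (\<lambda>l. 8 * dyadic \<sigma> (\<kappa>\<^sup>2) l) (q t, p t)"
    by (rule weighted_mono) (use powr_le_dyadic[OF \<sigma> m(1)] in \<open>auto simp: indicator_def\<close>)
  also have "\<dots> = 8 * weighted (dyadic \<sigma> (\<kappa>\<^sup>2)) (q t, p t)" by (rule weighted_cmult) simp
  also have "\<dots> \<le> 8 * (ennreal ?E * weighted (dyadic \<sigma> (\<kappa>\<^sup>2)) (q 0, p 0))"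
    by (intro mult_left_mono solution_dyadic[OF sol I m(2)]) simp
  also have "\<dots> \<le> 8 * (ennreal ?E * (ennreal ?a * weighted ?w (q 0, p 0)
      + ennreal (1 + ?K) * weighted (\<lambda>l. indicator {\<kappa>'\<^sup>2..} l * ?w l) (q 0, p 0)))"
    by (intro mult_left_mono weighted_dyadic_le[OF \<sigma> m(2,3)]) auto
  also have "ennreal ?a * weighted ?w (q 0, p 0) + ennreal (1 + ?K) * weighted (\<lambda>l. indicator {\<kappa>'\<^sup>2..} l * ?w l) (q 0, p 0)
      = ennreal ?a * ennreal ((phase_norm A s (q 0, p 0))\<^sup>2)
      + ennreal (1 + ?K) * ennreal ((phase_norm A s (high_proj A \<kappa>' (q 0), high_proj A \<kappa>' (p 0)))\<^sup>2)"
    unfolding phase_norm_power2[OF mem(2)] high_proj_phase_norm[OF mem(2)] \<sigma>_def ..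
  also have "8 * (ennreal ?E * \<dots>) = ennreal (8 * (?E * (?a * (phase_norm A s (q 0, p 0))\<^sup>2
      + (1 + ?K) * (phase_norm A s (high_proj A \<kappa>' (q 0), high_proj A \<kappa>' (p 0)))\<^sup>2)))"
    using K by (simp add: ennreal_mult ennreal_plus)
  finally show ?thesis
    using K by (subst (asm) ennreal_le_iff) (auto simp: \<sigma>_def mult.assoc)
qed

section \<open>Boundedness and equicontinuity of sets of orbits\<close>

lemma orbits_bounded:
  assumes s: "1 \<le> s" "s < 2"
    and bdd: "phase_bounded A s \<Omega>" and H: "bdd_above (H_minus A ` \<Omega>)"
  shows "phase_bounded A s (orbits A \<Omega>)"
proof -
  obtain M where M: "\<And>u. u \<in> \<Omega> \<Longrightarrow> phase_norm A s u \<le> M" using bdd by (auto simp: phase_bounded_def)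
  obtain h where h: "\<And>u. u \<in> \<Omega> \<Longrightarrow> H_minus A u \<le> h" using H by (auto simp: bdd_above_def)
  let ?C = "sqrt (10 + 16 * dyadic_const (s - 1))"
  have C: "0 \<le> ?C" using dyadic_const_pos[of "s - 1"] s by simp
  have "u \<in> phase_space A s \<and> phase_norm A s u \<le> ?C * (1 + 2 * h) * M" if u: "u \<in> orbits A \<Omega>" for u
  proof -
    obtain q p t I where *: "u = (q t, p t)" "open_interval I" "0 \<in> I" "t \<in> I"
      "K_minus_solution_inf A I q p" "(q 0, p 0) \<in> \<Omega>"
      using u unfolding orbits_def by blast
    have "phase_norm A s u \<le> ?C * (1 + 2 * H_minus A (q 0, p 0)) * phase_norm A s (q 0, p 0)"
      unfolding *(1) by (rule solution_norm_bound[OF s *(5,2,3,4)])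
    also have "\<dots> \<le> ?C * (1 + 2 * h) * M"
      using C h[OF *(6)] M[OF *(6)] solution_energy_ge_one[OF *(5,3)]
      by (intro mult_mono) auto
    finally show ?thesis using solution_phase_space[OF *(5,4) s(1)] *(1) by simp
  qed
  then show ?thesis unfolding phase_bounded_def by blast
qed

lemma orbits_equicontinuous:
  assumes s: "1 \<le> s" "s < 2"
    and bdd: "phase_bounded A s \<Omega>" and equi: "phase_equicontinuous A s \<Omega>"
    and H: "bdd_above (H_minus A ` \<Omega>)"
  shows "phase_equicontinuous A s (orbits A \<Omega>)"
  unfolding phase_equicontinuous_def
proof (intro allI impI)
  fix e :: real assume e: "0 < e"
  obtain M where M: "\<And>u. u \<in> \<Omega> \<Longrightarrow> phase_norm A s u \<le> M" using bdd by (auto simp: phase_bounded_def)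
  obtain h where h: "\<And>u. u \<in> \<Omega> \<Longrightarrow> H_minus A u \<le> h" using H by (auto simp: bdd_above_def)
  let ?K = "dyadic_const (s - 1)"
  have K: "0 < ?K" using dyadic_const_pos[of "s - 1"] s by simp
  \<comment> \<open>The absolute value keeps L positive when the set is empty and its upper bound h
    is arbitrary.\<close>
  define L where "L = 8 * (1 + 2 * \<bar>h\<bar>)\<^sup>2"
  have L: "0 < L" unfolding L_def by (intro mult_pos_pos zero_less_power) auto
  have X: "0 < L * (1 + ?K)" using L K by simp
  \<comment> \<open>Chosen so that the initial tail contributes e^2 / 2. The other half is reached
    afterwards by enlarging \<open>\<kappa>\<close> with \<open>\<kappa>'\<close> fixed, as the
    exponent s - 2 is negative.\<close>
  define \<delta> where "\<delta> = sqrt (e\<^sup>2 / (2 * (L * (1 + ?K))))"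
  have "0 < e\<^sup>2 / (2 * (L * (1 + ?K)))" using e X by simp
  then have \<delta>0: "0 < \<delta>" and \<delta>2: "\<delta>\<^sup>2 = e\<^sup>2 / (2 * (L * (1 + ?K)))"
    unfolding \<delta>_def by (simp_all only: real_sqrt_gt_zero real_sqrt_pow2 less_imp_le)
  have "L * ((1 + ?K) * \<delta>\<^sup>2) = (L * (1 + ?K)) * (e\<^sup>2 / (2 * (L * (1 + ?K))))"
    unfolding \<delta>2 by (simp only: mult.assoc)
  also have "\<dots> = e\<^sup>2 / 2"
  proof -
    have "Y * (a / (2 * Y)) = a / 2" if "0 < Y" for Y a :: real using that by simp
    from this[OF X] show ?thesis .
  qed
  finally have \<delta>: "0 < \<delta>" "L * ((1 + ?K) * \<delta>\<^sup>2) = e\<^sup>2 / 2" using \<delta>0 by simp_all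
  obtain \<kappa>' where \<kappa>': "0 < \<kappa>'"
    and small: "\<And>q p. (q, p) \<in> \<Omega> \<Longrightarrow> phase_norm A s (high_proj A \<kappa>' q, high_proj A \<kappa>' p) \<le> \<delta>"
    using equi \<delta>(1) unfolding phase_equicontinuous_def by blast
  have "((\<lambda>\<kappa>::real. (\<kappa>\<^sup>2) powr (s - 2)) \<longlongrightarrow> 0) at_top"
    using s by (intro tendsto_neg_powr filterlim_pow_at_top filterlim_ident) auto
  then have "((\<lambda>\<kappa>::real. L * (?K * (\<kappa>\<^sup>2) powr (s - 2) * \<kappa>'\<^sup>2 * M\<^sup>2)) \<longlongrightarrow> L * (?K * 0 * \<kappa>'\<^sup>2 * M\<^sup>2)) at_top"
    by (intro tendsto_intros)
  then have "\<forall>\<^sub>F \<kappa> in at_top. L * (?K * (\<kappa>\<^sup>2) powr (s - 2) * \<kappa>'\<^sup>2 * M\<^sup>2) < e\<^sup>2 / 2"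
    using e by (intro order_tendstoD) auto
  then obtain \<kappa> where \<kappa>: "1 \<le> \<kappa>" "L * (?K * (\<kappa>\<^sup>2) powr (s - 2) * \<kappa>'\<^sup>2 * M\<^sup>2) < e\<^sup>2 / 2"
    using eventually_conj[OF _ eventually_ge_at_top[of "1::real"]]
    by (metis (mono_tags, lifting) eventually_happens' trivial_limit_at_top_linorder)
  have "phase_norm A s (high_proj A \<kappa> x, high_proj A \<kappa> y) \<le> e" if u: "(x, y) \<in> orbits A \<Omega>" for x y
  proof -
    obtain q p t I where *: "x = q t" "y = p t" "open_interval I" "0 \<in> I" "t \<in> I"
      "K_minus_solution_inf A I q p" "(q 0, p 0) \<in> \<Omega>"
      using u unfolding orbits_def by blast
    let ?n = "phase_norm A s (q 0, p 0)"
    let ?t = "phase_norm A s (high_proj A \<kappa>' (q 0), high_proj A \<kappa>' (p 0))"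
    have "8 * (1 + 2 * H_minus A (q 0, p 0))\<^sup>2 \<le> L"
      unfolding L_def using h[OF *(7)] solution_energy_ge_one[OF *(6,4)]
      by (intro mult_left_mono power_mono) auto
    moreover have "?n\<^sup>2 \<le> M\<^sup>2" using M[OF *(7)] by (intro power_mono) auto
    moreover have "?t\<^sup>2 \<le> \<delta>\<^sup>2" using small[OF *(7)] by (intro power_mono) auto
    ultimately have "8 * (1 + 2 * H_minus A (q 0, p 0))\<^sup>2 *
        (?K * (\<kappa>\<^sup>2) powr (s - 2) * \<kappa>'\<^sup>2 * ?n\<^sup>2 + (1 + ?K) * ?t\<^sup>2)
      \<le> L * (?K * (\<kappa>\<^sup>2) powr (s - 2) * \<kappa>'\<^sup>2 * M\<^sup>2 + (1 + ?K) * \<delta>\<^sup>2)"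
      using K L by (intro mult_mono add_mono mult_left_mono) auto
    also have "\<dots> \<le> e\<^sup>2" using \<kappa>(2) \<delta>(2) by (simp add: distrib_left)
    finally have "(phase_norm A s (high_proj A \<kappa> (q t), high_proj A \<kappa> (p t)))\<^sup>2 \<le> e\<^sup>2"
      using solution_tail_bound[OF s *(6,3,4,5) \<kappa>(1) \<kappa>'] by linarith
    then show ?thesis unfolding *(1,2) by (rule power2_le_imp_le) (use e in simp)
  qed
  then show "\<exists>\<kappa>>0. \<forall>(q, p)\<in>orbits A \<Omega>. phase_norm A s (high_proj A \<kappa> q, high_proj A \<kappa> p) \<le> e"
    using \<kappa>(1) by (intro exI[of _ \<kappa>]) auto
qed

end

theorem theorem4p4:
  fixes s :: real
  assumes "1 \<le> s" and "s < 2"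
  shows "(\<exists>C. \<forall>A :: ('a::{real_inner,complete_space}) lin_op. nonneg_selfadjoint A \<longrightarrow>
           (\<forall>I q p q\<^sub>0 p\<^sub>0. open_interval I \<and> 0 \<in> I \<and> K_minus_solution_inf A I q p \<and>
               (q 0, p 0) = (q\<^sub>0, p\<^sub>0) \<longrightarrow>
             (\<forall>t\<in>I. phase_norm A s (q t, p t)
                \<le> C * (1 + 2 * H_minus A (q\<^sub>0, p\<^sub>0)) * phase_norm A s (q\<^sub>0, p\<^sub>0))))
       \<and> (\<forall>(A :: 'a lin_op) \<Omega>. nonneg_selfadjoint A \<and>
           \<Omega> \<subseteq> phase_space_inf A \<and> (\<forall>(q, p)\<in>\<Omega>. op_form A q < 1) \<and>
           phase_bounded A s \<Omega> \<and> phase_equicontinuous A s \<Omega> \<and> bdd_above (H_minus A ` \<Omega>) \<longrightarrow>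
           phase_bounded A s (orbits A \<Omega>) \<and> phase_equicontinuous A s (orbits A \<Omega>))"
proof (intro conjI exI[of _ "sqrt (10 + 16 * dyadic_const (s - 1))"] allI impI ballI)
  fix A :: "'a lin_op" and I q p and q\<^sub>0 p\<^sub>0 :: 'a and t
  assume A: "nonneg_selfadjoint A" and *: "open_interval I \<and> 0 \<in> I \<and> K_minus_solution_inf A I q p \<and>
    (q 0, p 0) = (q\<^sub>0, p\<^sub>0)" and t: "t \<in> I"
  interpret nonneg_op A by (rule nonneg_op.intro[OF A])
  show "phase_norm A s (q t, p t)
      \<le> sqrt (10 + 16 * dyadic_const (s - 1)) * (1 + 2 * H_minus A (q\<^sub>0, p\<^sub>0)) * phase_norm A s (q\<^sub>0, p\<^sub>0)"
    using solution_norm_bound[OF assms, of I q p t] * t by simp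
next
  fix A :: "'a lin_op" and \<Omega>
  assume *: "nonneg_selfadjoint A \<and> \<Omega> \<subseteq> phase_space_inf A \<and> (\<forall>(q, p)\<in>\<Omega>. op_form A q < 1) \<and>
    phase_bounded A s \<Omega> \<and> phase_equicontinuous A s \<Omega> \<and> bdd_above (H_minus A ` \<Omega>)"
  interpret nonneg_op A by (rule nonneg_op.intro) (use * in simp)
  show "phase_bounded A s (orbits A \<Omega>)" using orbits_bounded[OF assms] * by simp
  show "phase_equicontinuous A s (orbits A \<Omega>)" using orbits_equicontinuous[OF assms] * by simp
qed

end
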